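(* Let $G\colon\mathcal{A}\to\mathcal{B}$ be a full and faithful, representably small functor between locally small categories, with $\mathcal{B}$ complete. Let $\mathsf{Mnd}_{\mathcal{B}}^{\mathrm{res}G}$ be the full subcategory of $\mathsf{Mnd}_{\mathcal{B}}$ on the monads that restrict along $G$. Then pushforward along $G$ and monad lift along $G$ define functors $$G_\#\colon \mathsf{Mnd}_{\mathcal{A}}\to\mathsf{Mnd}_{\mathcal{B}}^{\mathrm{res}G},\qquad G^\#\colon \mathsf{Mnd}_{\mathcal{B}}^{\mathrm{res}G}\to\mathsf{Mnd}_{\mathcal{A}},$$ and there is an adjunction $G^\#\dashv G_\#$. Moreover, the right adjoint $G_\#$ is full and faithful.
   Context: $\mathsf{Mnd}_{\mathcal{C}}$ is the category of monads on $\mathcal{C}$ and monad maps, i.e. natural transformations $\theta\colon T\to S$ with $\theta\cdot\eta^T=\eta^S$ and $\theta\cdot\mu^T=\mu^S\cdot(\theta*\theta)$. A functor $P\colon\mathcal{A}\to\mathsf{Set}$ is small if it is a small colimit of representables; $G\colon\mathcal{A}\to\mathcal{B}$ is representably small if $\mathcal{B}(b,G-)\colon\mathcal{A}\to\mathsf{Set}$ is small for every $b\in\mathcal{B}$. Pushforward: for a monad $T$ on $\mathcal{A}$, $G_\#T$ is the right Kan extension $(G_\#T,\varepsilon\colon(G_\#T)G\to GT)$ of $GT$ along $G$, with the unique monad structure such that $\varepsilon\cdot\eta^{G_\#T}G=G\eta^T$ and $\varepsilon\cdot\mu^{G_\#T}G=G\mu^T\cdot\varepsilon T\cdot(G_\#T)\varepsilon$.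 On a monad map $\theta\colon T\to S$, $G_\#\theta$ is the unique natural transformation with $\varepsilon^S\cdot(G_\#\theta)G=G\theta\cdot\varepsilon^T$. Monad lift: for a monad $S$ on $\mathcal{B}$, $G^\#S$ is, when it exists, the right Kan lift of $SG$ through $G$, i.e. a terminal pair $(G^\#S,\kappa)$ consisting of an endofunctor $G^\#S$ of $\mathcal{A}$ and a natural transformation $\kappa\colon G(G^\#S)\to SG$, with the unique monad structure such that $\kappa\cdot G\eta^{G^\#S}=\eta^SG$ and $\kappa\cdot G\mu^{G^\#S}=\mu^SG\cdot S\kappa\cdot\kappa(G^\#S)$; it is functorial in $S$ via the universal property. A monad $S$ on $\mathcal{B}$ restricts along (the full and faithful functor) $G$ if there exist an endofunctor $S'$ of $\mathcal{A}$ and a natural isomorphism $GS'\cong SG$; in that case $G^\#S$ exists, with underlying endofunctor $S'$. *)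

theory Defs
  imports "HOL-Library.FuncSet" "HOL-Library.Equipollence"
begin

section \<open>Size\<close>

text \<open>
  The type \<open>'u\<close> plays the role of the universe: its subsets are the classes of elements of the
  universe, and the sets (the small ones among these classes) are the subsets of cardinality strictly
  below that of \<open>'u\<close>. The predicate \<open>universe\<close> says that this cardinality is regular and a strong
  limit. Every (strongly) inaccessible cardinal, i.e. every Grothendieck universe, is covered.
  Uncountability is not demanded, so \<open>nat\<close>, i.e. the universe of hereditarily finite sets, is also an
  instance.
\<close>

definition small :: "'u set \<Rightarrow> bool" where
  "small X \<longleftrightarrow> X \<prec> (UNIV :: 'u set)"

definition universe :: "'u itself \<Rightarrow> bool" where
  "universe _ \<longleftrightarrow>
     infinite (UNIV :: 'u set) \<and>
     (\<forall>X :: 'u set. small X \<longrightarrow> Pow X \<prec> (UNIV :: 'u set)) \<and>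
     (\<forall>(I :: 'u set) X :: 'u \<Rightarrow> 'u set. small I \<longrightarrow> (\<forall>i\<in>I. small (X i)) \<longrightarrow> small (\<Union>i\<in>I. X i))"

lemma small_nat_iff: "small (X :: nat set) \<longleftrightarrow> finite X"
proof
  assume "small X"
  then show "finite X"
    unfolding small_def
    by (metis countable_eqpoll countableI_type eqpoll_sym lesspoll_def infinite_iff_countable_subset
        infinite_le_lepoll lepoll_antisym subset_UNIV subset_imp_lepoll)
next
  assume "finite X"
  then show "small X"
    unfolding small_def using finite_lesspoll_infinite by blast
qed

lemma universe_nat: "universe TYPE(nat)"
  unfolding universe_def small_nat_iff by (auto intro: finite_lesspoll_infinite)


section \<open>Categories, functors and natural transformations\<close>

text \<open>
  Hom-sets need not be disjoint, so composition is indexed by objects: \<open>Comp C a b c g f\<close> is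
  \<open>g \<circ> f\<close> for \<open>f : a \<rightarrow> b\<close> and \<open>g : b \<rightarrow> c\<close>.
\<close>

record ('o, 'm) category =
  Ob :: "'o set"
  Hom :: "'o \<Rightarrow> 'o \<Rightarrow> 'm set"
  Idn :: "'o \<Rightarrow> 'm"
  Comp :: "'o \<Rightarrow> 'o \<Rightarrow> 'o \<Rightarrow> 'm \<Rightarrow> 'm \<Rightarrow> 'm"

locale category =
  fixes C :: "('o, 'm) category"
  assumes Idn_in_Hom: "a \<in> Ob C \<Longrightarrow> Idn C a \<in> Hom C a a"
    and Comp_in_Hom: "\<lbrakk>a \<in> Ob C; b \<in> Ob C; c \<in> Ob C; f \<in> Hom C a b; g \<in> Hom C b c\<rbrakk>
          \<Longrightarrow> Comp C a b c g f \<in> Hom C a c"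
    and Comp_Idn_left: "\<lbrakk>a \<in> Ob C; b \<in> Ob C; f \<in> Hom C a b\<rbrakk> \<Longrightarrow> Comp C a b b (Idn C b) f = f"
    and Comp_Idn_right: "\<lbrakk>a \<in> Ob C; b \<in> Ob C; f \<in> Hom C a b\<rbrakk> \<Longrightarrow> Comp C a a b f (Idn C a) = f"
    and Comp_assoc: "\<lbrakk>a \<in> Ob C; b \<in> Ob C; c \<in> Ob C; d \<in> Ob C;
            f \<in> Hom C a b; g \<in> Hom C b c; h \<in> Hom C c d\<rbrakk>
          \<Longrightarrow> Comp C a b d (Comp C b c d h g) f = Comp C a c d h (Comp C a b c g f)"

definition locally_small :: "('o, 'u) category \<Rightarrow> bool" where
  "locally_small C \<longleftrightarrow> category C \<and> (\<forall>a\<in>Ob C. \<forall>b\<in>Ob C. small (Hom C a b))"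

definition small_category :: "('u, 'u) category \<Rightarrow> bool" where
  "small_category C \<longleftrightarrow> locally_small C \<and> small (Ob C)"

definition full_subcategory :: "('o, 'm) category \<Rightarrow> 'o set \<Rightarrow> ('o, 'm) category" where
  "full_subcategory C X = C\<lparr>Ob := Ob C \<inter> X\<rparr>"

definition isomorphic :: "('o, 'm) category \<Rightarrow> 'o \<Rightarrow> 'o \<Rightarrow> bool" where
  "isomorphic C a b \<longleftrightarrow>
     (\<exists>f\<in>Hom C a b. \<exists>g\<in>Hom C b a. Comp C a b a g f = Idn C a \<and> Comp C b a b f g = Idn C b)"

text \<open>
  Functors and natural transformations are \<open>undefined\<close> outside their domains, so that equality of
  functors and of natural transformations is equality in HOL.
\<close>

record ('o, 'm, 'p, 'n) cfunctor =
  fob :: "'o \<Rightarrow> 'p"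
  far :: "'o \<Rightarrow> 'o \<Rightarrow> 'm \<Rightarrow> 'n"

locale cfunctor = dom: category C + cod: category D
  for C :: "('o, 'm) category" and D :: "('p, 'n) category" +
  fixes F :: "('o, 'm, 'p, 'n) cfunctor"
  assumes fob_in_Ob: "a \<in> Ob C \<Longrightarrow> fob F a \<in> Ob D"
    and far_in_Hom: "\<lbrakk>a \<in> Ob C; b \<in> Ob C; f \<in> Hom C a b\<rbrakk> \<Longrightarrow> far F a b f \<in> Hom D (fob F a) (fob F b)"
    and far_Idn: "a \<in> Ob C \<Longrightarrow> far F a a (Idn C a) = Idn D (fob F a)"
    and far_Comp: "\<lbrakk>a \<in> Ob C; b \<in> Ob C; c \<in> Ob C; f \<in> Hom C a b; g \<in> Hom C b c\<rbrakk>
          \<Longrightarrow> far F a c (Comp C a b c g f)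
              = Comp D (fob F a) (fob F b) (fob F c) (far F b c g) (far F a b f)"
    and fob_undefined: "a \<notin> Ob C \<Longrightarrow> fob F a = undefined"
    and far_undefined: "\<not> (a \<in> Ob C \<and> b \<in> Ob C \<and> f \<in> Hom C a b) \<Longrightarrow> far F a b f = undefined"

definition mk_functor ::
    "('o, 'm) category \<Rightarrow> ('o \<Rightarrow> 'p) \<Rightarrow> ('o \<Rightarrow> 'o \<Rightarrow> 'm \<Rightarrow> 'n) \<Rightarrow> ('o, 'm, 'p, 'n) cfunctor" where
  "mk_functor C p q =
     \<lparr>fob = (\<lambda>a\<in>Ob C. p a),
      far = (\<lambda>a b f. if a \<in> Ob C \<and> b \<in> Ob C \<and> f \<in> Hom C a b then q a b f else undefined)\<rparr>"

definition idf :: "('o, 'm) category \<Rightarrow> ('o, 'm, 'o, 'm) cfunctor" where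
  "idf C = mk_functor C (\<lambda>a. a) (\<lambda>a b f. f)"

text \<open>The composite \<open>G \<circ> F\<close> of functors, where \<open>C\<close> is the domain of \<open>F\<close>.\<close>

definition cfcomp :: "('o, 'm) category \<Rightarrow> ('p, 'n, 'q, 'k) cfunctor \<Rightarrow> ('o, 'm, 'p, 'n) cfunctor
    \<Rightarrow> ('o, 'm, 'q, 'k) cfunctor" where
  "cfcomp C G F = mk_functor C (\<lambda>a. fob G (fob F a)) (\<lambda>a b f. far G (fob F a) (fob F b) (far F a b f))"

definition full_functor :: "('o, 'm) category \<Rightarrow> ('p, 'n) category \<Rightarrow> ('o, 'm, 'p, 'n) cfunctor \<Rightarrow> bool" where
  "full_functor C D F \<longleftrightarrow>
     (\<forall>a\<in>Ob C. \<forall>b\<in>Ob C. \<forall>g\<in>Hom D (fob F a) (fob F b). \<exists>f\<in>Hom C a b. far F a b f = g)"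

definition faithful_functor :: "('o, 'm) category \<Rightarrow> ('o, 'm, 'p, 'n) cfunctor \<Rightarrow> bool" where
  "faithful_functor C F \<longleftrightarrow> (\<forall>a\<in>Ob C. \<forall>b\<in>Ob C. inj_on (far F a b) (Hom C a b))"

locale nat_trans = src: cfunctor C D F + tgt: cfunctor C D G
  for C :: "('o, 'm) category" and D :: "('p, 'n) category"
    and F G :: "('o, 'm, 'p, 'n) cfunctor" +
  fixes \<alpha> :: "'o \<Rightarrow> 'n"
  assumes component: "a \<in> Ob C \<Longrightarrow> \<alpha> a \<in> Hom D (fob F a) (fob G a)"
    and naturality: "\<lbrakk>a \<in> Ob C; b \<in> Ob C; f \<in> Hom C a b\<rbrakk>
          \<Longrightarrow> Comp D (fob F a) (fob F b) (fob G b) (\<alpha> b) (far F a b f)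
              = Comp D (fob F a) (fob G a) (fob G b) (far G a b f) (\<alpha> a)"
    and extensional: "\<alpha> \<in> extensional (Ob C)"

definition nat_id :: "('o, 'm) category \<Rightarrow> ('p, 'n) category \<Rightarrow> ('o, 'm, 'p, 'n) cfunctor
    \<Rightarrow> ('o \<Rightarrow> 'n)" where
  "nat_id C D F = (\<lambda>a\<in>Ob C. Idn D (fob F a))"

text \<open>\<open>nat_comp C D F G H \<beta> \<alpha>\<close> is the vertical composite of \<open>\<alpha> : F \<rightarrow> G\<close> and \<open>\<beta> : G \<rightarrow> H\<close>.\<close>

definition nat_comp :: "('o, 'm) category \<Rightarrow> ('p, 'n) category \<Rightarrow> ('o, 'm, 'p, 'n) cfunctor
    \<Rightarrow> ('o, 'm, 'p, 'n) cfunctor \<Rightarrow> ('o, 'm, 'p, 'n) cfunctor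
    \<Rightarrow> ('o \<Rightarrow> 'n) \<Rightarrow> ('o \<Rightarrow> 'n) \<Rightarrow> ('o \<Rightarrow> 'n)" where
  "nat_comp C D F G H \<beta> \<alpha> = (\<lambda>a\<in>Ob C. Comp D (fob F a) (fob G a) (fob H a) (\<beta> a) (\<alpha> a))"

definition functor_category :: "('o, 'm) category \<Rightarrow> ('p, 'n) category
    \<Rightarrow> (('o, 'm, 'p, 'n) cfunctor, 'o \<Rightarrow> 'n) category" where
  "functor_category C D =
     \<lparr>Ob = {F. cfunctor C D F},
      Hom = (\<lambda>F G. {\<alpha>. nat_trans C D F G \<alpha>}),
      Idn = nat_id C D,
      Comp = nat_comp C D\<rparr>"

text \<open>\<open>F : C \<rightarrow> D\<close> is left adjoint to \<open>U : D \<rightarrow> C\<close>, in terms of unit, counit and triangle identities.\<close>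

definition adjunction :: "('o, 'm) category \<Rightarrow> ('p, 'n) category
    \<Rightarrow> ('o, 'm, 'p, 'n) cfunctor \<Rightarrow> ('p, 'n, 'o, 'm) cfunctor \<Rightarrow> bool" where
  "adjunction C D F U \<longleftrightarrow>
     cfunctor C D F \<and> cfunctor D C U \<and>
     (\<exists>\<eta> \<epsilon>. nat_trans C C (idf C) (cfcomp C U F) \<eta> \<and> nat_trans D D (cfcomp D F U) (idf D) \<epsilon> \<and>
       (\<forall>c\<in>Ob C. Comp D (fob F c) (fob F (fob U (fob F c))) (fob F c)
                   (\<epsilon> (fob F c)) (far F c (fob U (fob F c)) (\<eta> c)) = Idn D (fob F c)) \<and>
       (\<forall>d\<in>Ob D. Comp C (fob U d) (fob U (fob F (fob U d))) (fob U d)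
                   (far U (fob F (fob U d)) d (\<epsilon> d)) (\<eta> (fob U d)) = Idn C (fob U d)))"


section \<open>Limits and colimits\<close>

definition is_cone :: "('o, 'm) category \<Rightarrow> ('i, 'j) category \<Rightarrow> ('i, 'j, 'o, 'm) cfunctor
    \<Rightarrow> 'o \<Rightarrow> ('i \<Rightarrow> 'm) \<Rightarrow> bool" where
  "is_cone C I D x \<pi> \<longleftrightarrow>
     x \<in> Ob C \<and> (\<forall>i\<in>Ob I. \<pi> i \<in> Hom C x (fob D i)) \<and>
     (\<forall>i\<in>Ob I. \<forall>j\<in>Ob I. \<forall>k\<in>Hom I i j. Comp C x (fob D i) (fob D j) (far D i j k) (\<pi> i) = \<pi> j)"

definition is_limit :: "('o, 'm) category \<Rightarrow> ('i, 'j) category \<Rightarrow> ('i, 'j, 'o, 'm) cfunctor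
    \<Rightarrow> 'o \<Rightarrow> ('i \<Rightarrow> 'm) \<Rightarrow> bool" where
  "is_limit C I D x \<pi> \<longleftrightarrow>
     is_cone C I D x \<pi> \<and>
     (\<forall>y \<tau>. is_cone C I D y \<tau> \<longrightarrow>
       (\<exists>!h. h \<in> Hom C y x \<and> (\<forall>i\<in>Ob I. Comp C y x (fob D i) (\<pi> i) h = \<tau> i)))"

definition is_cocone :: "('o, 'm) category \<Rightarrow> ('i, 'j) category \<Rightarrow> ('i, 'j, 'o, 'm) cfunctor
    \<Rightarrow> 'o \<Rightarrow> ('i \<Rightarrow> 'm) \<Rightarrow> bool" where
  "is_cocone C I D x \<iota> \<longleftrightarrow>
     x \<in> Ob C \<and> (\<forall>i\<in>Ob I. \<iota> i \<in> Hom C (fob D i) x) \<and>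
     (\<forall>i\<in>Ob I. \<forall>j\<in>Ob I. \<forall>k\<in>Hom I i j. Comp C (fob D i) (fob D j) x (\<iota> j) (far D i j k) = \<iota> i)"

definition is_colimit :: "('o, 'm) category \<Rightarrow> ('i, 'j) category \<Rightarrow> ('i, 'j, 'o, 'm) cfunctor
    \<Rightarrow> 'o \<Rightarrow> ('i \<Rightarrow> 'm) \<Rightarrow> bool" where
  "is_colimit C I D x \<iota> \<longleftrightarrow>
     is_cocone C I D x \<iota> \<and>
     (\<forall>y \<tau>. is_cocone C I D y \<tau> \<longrightarrow>
       (\<exists>!h. h \<in> Hom C x y \<and> (\<forall>i\<in>Ob I. Comp C (fob D i) x y h (\<iota> i) = \<tau> i)))"

text \<open>Up to isomorphism, every small category has its objects and its arrows in \<open>'u\<close>.\<close>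

definition complete_category :: "('o, 'u) category \<Rightarrow> bool" where
  "complete_category C \<longleftrightarrow>
     (\<forall>(I :: ('u, 'u) category) D. small_category I \<longrightarrow> cfunctor I C D \<longrightarrow> (\<exists>x \<pi>. is_limit C I D x \<pi>))"


section \<open>Small functors\<close>

definition Set_cat :: "('u set, 'u \<Rightarrow> 'u) category" where
  "Set_cat =
     \<lparr>Ob = {X. small X},
      Hom = (\<lambda>X Y. X \<rightarrow>\<^sub>E Y),
      Idn = (\<lambda>X. \<lambda>x\<in>X. x),
      Comp = (\<lambda>X Y Z g f. compose X g f)\<rparr>"

definition hom_functor :: "('o, 'u) category \<Rightarrow> 'o \<Rightarrow> ('o, 'u, 'u set, 'u \<Rightarrow> 'u) cfunctor" where
  "hom_functor C a =
     mk_functor C (Hom C a) (\<lambda>x y f. \<lambda>g\<in>Hom C a x. Comp C a x y f g)"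

definition representable :: "('o, 'u) category \<Rightarrow> ('o, 'u, 'u set, 'u \<Rightarrow> 'u) cfunctor \<Rightarrow> bool" where
  "representable C P \<longleftrightarrow>
     (\<exists>a\<in>Ob C. isomorphic (functor_category C Set_cat) P (hom_functor C a))"

definition small_functor :: "('o, 'u) category \<Rightarrow> ('o, 'u, 'u set, 'u \<Rightarrow> 'u) cfunctor \<Rightarrow> bool" where
  "small_functor C P \<longleftrightarrow>
     (\<exists>(I :: ('u, 'u) category) D \<iota>.
        small_category I \<and> cfunctor I (functor_category C Set_cat) D \<and>
        (\<forall>i\<in>Ob I. representable C (fob D i)) \<and>
        is_colimit (functor_category C Set_cat) I D P \<iota>)"

definition representably_small :: "('a, 'u) category \<Rightarrow> ('b, 'u) category
    \<Rightarrow> ('a, 'u, 'b, 'u) cfunctor \<Rightarrow> bool" where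
  "representably_small A B G \<longleftrightarrow> (\<forall>b\<in>Ob B. small_functor A (cfcomp A (hom_functor B b) G))"


section \<open>Monads\<close>

record ('o, 'm) monad =
  mfun :: "('o, 'm, 'o, 'm) cfunctor"
  munit :: "'o \<Rightarrow> 'm"
  mmult :: "'o \<Rightarrow> 'm"

abbreviation mob :: "('o, 'm) monad \<Rightarrow> 'o \<Rightarrow> 'o" where
  "mob T \<equiv> fob (mfun T)"

abbreviation mar :: "('o, 'm) monad \<Rightarrow> 'o \<Rightarrow> 'o \<Rightarrow> 'm \<Rightarrow> 'm" where
  "mar T \<equiv> far (mfun T)"

locale monad =
  unit: nat_trans C C "idf C" "mfun T" "munit T" +
  mult: nat_trans C C "cfcomp C (mfun T) (mfun T)" "mfun T" "mmult T"
  for C :: "('o, 'm) category" and T :: "('o, 'm) monad" +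
  assumes unit_left: "a \<in> Ob C \<Longrightarrow>
      Comp C (mob T a) (mob T (mob T a)) (mob T a) (mmult T a) (munit T (mob T a)) = Idn C (mob T a)"
    and unit_right: "a \<in> Ob C \<Longrightarrow>
      Comp C (mob T a) (mob T (mob T a)) (mob T a) (mmult T a) (mar T a (mob T a) (munit T a))
      = Idn C (mob T a)"
    and mult_assoc: "a \<in> Ob C \<Longrightarrow>
      Comp C (mob T (mob T (mob T a))) (mob T (mob T a)) (mob T a)
        (mmult T a) (mmult T (mob T a))
      = Comp C (mob T (mob T (mob T a))) (mob T (mob T a)) (mob T a)
          (mmult T a) (mar T (mob T (mob T a)) (mob T a) (mmult T a))"

text \<open>
  The component of \<open>\<theta> * \<theta> : TT \<rightarrow> SS\<close> at \<open>a\<close> is \<open>S \<theta>\<^sub>a \<circ> \<theta>\<^bsub>Ta\<^esub>\<close>.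
\<close>

locale monad_map =
  dom: monad C T + cod: monad C S + nat_trans C C "mfun T" "mfun S" \<theta>
  for C :: "('o, 'm) category" and T S :: "('o, 'm) monad" and \<theta> :: "'o \<Rightarrow> 'm" +
  assumes map_unit: "a \<in> Ob C \<Longrightarrow> Comp C a (mob T a) (mob S a) (\<theta> a) (munit T a) = munit S a"
    and map_mult: "a \<in> Ob C \<Longrightarrow>
      Comp C (mob T (mob T a)) (mob T a) (mob S a) (\<theta> a) (mmult T a)
      = Comp C (mob T (mob T a)) (mob S (mob S a)) (mob S a) (mmult S a)
          (Comp C (mob T (mob T a)) (mob S (mob T a)) (mob S (mob S a))
            (mar S (mob T a) (mob S a) (\<theta> a)) (\<theta> (mob T a)))"

definition Mnd :: "('o, 'm) category \<Rightarrow> (('o, 'm) monad, 'o \<Rightarrow> 'm) category" where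
  "Mnd C =
     \<lparr>Ob = {T. monad C T},
      Hom = (\<lambda>T S. {\<theta>. monad_map C T S \<theta>}),
      Idn = (\<lambda>T. nat_id C C (mfun T)),
      Comp = (\<lambda>T S R. nat_comp C C (mfun T) (mfun S) (mfun R))\<rparr>"

definition restricts :: "('a, 'm) category \<Rightarrow> ('b, 'n) category \<Rightarrow> ('a, 'm, 'b, 'n) cfunctor
    \<Rightarrow> ('b, 'n) monad \<Rightarrow> bool" where
  "restricts A B G S \<longleftrightarrow>
     (\<exists>S'. cfunctor A A S' \<and> isomorphic (functor_category A B) (cfcomp A G S') (cfcomp A (mfun S) G))"

definition Mnd_res :: "('a, 'm) category \<Rightarrow> ('b, 'n) category \<Rightarrow> ('a, 'm, 'b, 'n) cfunctor
    \<Rightarrow> (('b, 'n) monad, 'b \<Rightarrow> 'n) category" where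
  "Mnd_res A B G = full_subcategory (Mnd B) {S. restricts A B G S}"


section \<open>Pushforward\<close>

text \<open>
  \<open>(R, \<epsilon> : R G \<rightarrow> F)\<close> is a right Kan extension of \<open>F : A \<rightarrow> C\<close> along \<open>G : A \<rightarrow> B\<close>. No pointwiseness is
  required.
\<close>

definition right_kan_extension :: "('a, 'm) category \<Rightarrow> ('b, 'n) category \<Rightarrow> ('c, 'k) category
    \<Rightarrow> ('a, 'm, 'b, 'n) cfunctor \<Rightarrow> ('a, 'm, 'c, 'k) cfunctor
    \<Rightarrow> ('b, 'n, 'c, 'k) cfunctor \<Rightarrow> ('a \<Rightarrow> 'k) \<Rightarrow> bool" where
  "right_kan_extension A B C G F R \<epsilon> \<longleftrightarrow>
     cfunctor B C R \<and> nat_trans A C (cfcomp A R G) F \<epsilon> \<and>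
     (\<forall>M \<alpha>. cfunctor B C M \<longrightarrow> nat_trans A C (cfcomp A M G) F \<alpha> \<longrightarrow>
       (\<exists>!\<beta>. nat_trans B C M R \<beta> \<and>
          (\<forall>a\<in>Ob A. Comp C (fob M (fob G a)) (fob R (fob G a)) (fob F a) (\<epsilon> a) (\<beta> (fob G a)) = \<alpha> a)))"

definition is_pushforward :: "('a, 'm) category \<Rightarrow> ('b, 'n) category \<Rightarrow> ('a, 'm, 'b, 'n) cfunctor
    \<Rightarrow> ('a, 'm) monad \<Rightarrow> ('b, 'n) monad \<Rightarrow> ('a \<Rightarrow> 'n) \<Rightarrow> bool" where
  "is_pushforward A B G T P \<epsilon> \<longleftrightarrow>
     right_kan_extension A B B G (cfcomp A G (mfun T)) (mfun P) \<epsilon> \<and> monad B P \<and>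
     (\<forall>a\<in>Ob A.
        Comp B (fob G a) (mob P (fob G a)) (fob G (mob T a)) (\<epsilon> a) (munit P (fob G a))
        = far G a (mob T a) (munit T a)) \<and>
     (\<forall>a\<in>Ob A.
        Comp B (mob P (mob P (fob G a))) (mob P (fob G a)) (fob G (mob T a))
          (\<epsilon> a) (mmult P (fob G a))
        = Comp B (mob P (mob P (fob G a))) (fob G (mob T (mob T a))) (fob G (mob T a))
            (far G (mob T (mob T a)) (mob T a) (mmult T a))
            (Comp B (mob P (mob P (fob G a))) (mob P (fob G (mob T a))) (fob G (mob T (mob T a)))
              (\<epsilon> (mob T a))
              (mar P (mob P (fob G a)) (fob G (mob T a)) (\<epsilon> a))))"

text \<open>
  Pushforwards are determined only up to isomorphism; \<open>(P T, \<epsilon> T)\<close> is a chosen pushforward of \<open>T\<close>.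
\<close>

definition pushforward_choice :: "('a, 'm) category \<Rightarrow> ('b, 'n) category
    \<Rightarrow> ('a, 'm, 'b, 'n) cfunctor \<Rightarrow> (('a, 'm) monad \<Rightarrow> ('b, 'n) monad)
    \<Rightarrow> (('a, 'm) monad \<Rightarrow> 'a \<Rightarrow> 'n) \<Rightarrow> bool" where
  "pushforward_choice A B G P \<epsilon> \<longleftrightarrow> (\<forall>T\<in>Ob (Mnd A). is_pushforward A B G T (P T) (\<epsilon> T))"

definition pushforward_functor :: "('a, 'm) category \<Rightarrow> ('b, 'n) category
    \<Rightarrow> ('a, 'm, 'b, 'n) cfunctor \<Rightarrow> (('a, 'm) monad \<Rightarrow> ('b, 'n) monad)
    \<Rightarrow> (('a, 'm) monad \<Rightarrow> 'a \<Rightarrow> 'n)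
    \<Rightarrow> (('a, 'm) monad, 'a \<Rightarrow> 'm, ('b, 'n) monad, 'b \<Rightarrow> 'n) cfunctor" where
  "pushforward_functor A B G P \<epsilon> =
     mk_functor (Mnd A) P
       (\<lambda>T S \<theta>. THE \<phi>. nat_trans B B (mfun (P T)) (mfun (P S)) \<phi> \<and>
          (\<forall>a\<in>Ob A.
             Comp B (mob (P T) (fob G a)) (mob (P S) (fob G a)) (fob G (mob S a))
               (\<epsilon> S a) (\<phi> (fob G a))
             = Comp B (mob (P T) (fob G a)) (fob G (mob T a)) (fob G (mob S a))
                 (far G (mob T a) (mob S a) (\<theta> a)) (\<epsilon> T a)))"


section \<open>Monad lift\<close>

text \<open>\<open>(L, \<kappa> : G L \<rightarrow> H)\<close> is a right Kan lift of \<open>H : C \<rightarrow> B\<close> through \<open>G : A \<rightarrow> B\<close>.\<close>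

definition right_kan_lift :: "('c, 'k) category \<Rightarrow> ('a, 'm) category \<Rightarrow> ('b, 'n) category
    \<Rightarrow> ('a, 'm, 'b, 'n) cfunctor \<Rightarrow> ('c, 'k, 'b, 'n) cfunctor
    \<Rightarrow> ('c, 'k, 'a, 'm) cfunctor \<Rightarrow> ('c \<Rightarrow> 'n) \<Rightarrow> bool" where
  "right_kan_lift C A B G H L \<kappa> \<longleftrightarrow>
     cfunctor C A L \<and> nat_trans C B (cfcomp C G L) H \<kappa> \<and>
     (\<forall>M \<alpha>. cfunctor C A M \<longrightarrow> nat_trans C B (cfcomp C G M) H \<alpha> \<longrightarrow>
       (\<exists>!\<beta>. nat_trans C A M L \<beta> \<and>
          (\<forall>c\<in>Ob C. Comp B (fob G (fob M c)) (fob G (fob L c)) (fob H c)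
                      (\<kappa> c) (far G (fob M c) (fob L c) (\<beta> c)) = \<alpha> c)))"

definition is_monad_lift :: "('a, 'm) category \<Rightarrow> ('b, 'n) category \<Rightarrow> ('a, 'm, 'b, 'n) cfunctor
    \<Rightarrow> ('b, 'n) monad \<Rightarrow> ('a, 'm) monad \<Rightarrow> ('a \<Rightarrow> 'n) \<Rightarrow> bool" where
  "is_monad_lift A B G S L \<kappa> \<longleftrightarrow>
     right_kan_lift A A B G (cfcomp A (mfun S) G) (mfun L) \<kappa> \<and> monad A L \<and>
     (\<forall>a\<in>Ob A.
        Comp B (fob G a) (fob G (mob L a)) (mob S (fob G a)) (\<kappa> a) (far G a (mob L a) (munit L a))
        = munit S (fob G a)) \<and>
     (\<forall>a\<in>Ob A.
        Comp B (fob G (mob L (mob L a))) (fob G (mob L a)) (mob S (fob G a))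
          (\<kappa> a) (far G (mob L (mob L a)) (mob L a) (mmult L a))
        = Comp B (fob G (mob L (mob L a))) (mob S (mob S (fob G a))) (mob S (fob G a))
            (mmult S (fob G a))
            (Comp B (fob G (mob L (mob L a))) (mob S (fob G (mob L a))) (mob S (mob S (fob G a)))
              (mar S (fob G (mob L a)) (mob S (fob G a)) (\<kappa> a))
              (\<kappa> (mob L a))))"

definition monad_lift_choice :: "('a, 'm) category \<Rightarrow> ('b, 'n) category
    \<Rightarrow> ('a, 'm, 'b, 'n) cfunctor \<Rightarrow> (('b, 'n) monad \<Rightarrow> ('a, 'm) monad)
    \<Rightarrow> (('b, 'n) monad \<Rightarrow> 'a \<Rightarrow> 'n) \<Rightarrow> bool" where
  "monad_lift_choice A B G L \<kappa> \<longleftrightarrow> (\<forall>S\<in>Ob (Mnd_res A B G). is_monad_lift A B G S (L S) (\<kappa> S))"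

definition monad_lift_functor :: "('a, 'm) category \<Rightarrow> ('b, 'n) category
    \<Rightarrow> ('a, 'm, 'b, 'n) cfunctor \<Rightarrow> (('b, 'n) monad \<Rightarrow> ('a, 'm) monad)
    \<Rightarrow> (('b, 'n) monad \<Rightarrow> 'a \<Rightarrow> 'n)
    \<Rightarrow> (('b, 'n) monad, 'b \<Rightarrow> 'n, ('a, 'm) monad, 'a \<Rightarrow> 'm) cfunctor" where
  "monad_lift_functor A B G L \<kappa> =
     mk_functor (Mnd_res A B G) L
       (\<lambda>S R \<phi>. THE \<theta>. nat_trans A A (mfun (L S)) (mfun (L R)) \<theta> \<and>
          (\<forall>a\<in>Ob A.
             Comp B (fob G (mob (L S) a)) (fob G (mob (L R) a)) (mob R (fob G a))
               (\<kappa> R a) (far G (mob (L S) a) (mob (L R) a) (\<theta> a))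
             = Comp B (fob G (mob (L S) a)) (mob S (fob G a)) (mob R (fob G a))
                 (\<phi> (fob G a)) (\<kappa> S a)))"

end

theory Submission
  imports Defs
begin

text \<open>
  A presentation of \<open>B(b, G-)\<close> as a small colimit of representables turns the limit over the large category
  \<open>b \<down> G\<close> into a small one, so every right Kan extension along \<open>G\<close> exists and is pointwise. As \<open>G\<close> is full
  and faithful, the counit \<open>\<epsilon> : (G\<^sub># T) G \<rightarrow> G T\<close> is then invertible, so \<open>G\<^sub># T\<close> restricts along \<open>G\<close>.
  Monad maps \<open>M \<rightarrow> G\<^sub># T\<close> correspond to transformations \<open>M G \<rightarrow> G T\<close> compatible with the monad
  structures (lax maps), and monad maps \<open>T \<rightarrow> G\<^sup># S\<close> to compatible transformations \<open>G T \<rightarrow> S G\<close> (colax maps).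
  An invertible transformation is lax iff its inverse is colax. Hence \<open>\<kappa>\<^sup>-\<^sup>1 : S G \<rightarrow> G (G\<^sup># S)\<close> induces the
  unit. Dually, \<open>(T, \<epsilon>\<^sup>-\<^sup>1)\<close> has the universal property of a lift of \<open>G\<^sub># T\<close>, so \<open>\<kappa> : G (G\<^sup># G\<^sub># T) \<rightarrow> (G\<^sub># T) G\<close>
  induces the counit, and every monad map \<open>G\<^sub># T \<rightarrow> G\<^sub># S\<close> comes from a monad map \<open>T \<rightarrow> S\<close>.
\<close>

section \<open>Categories, functors and natural transformations\<close>

text \<open>\<open>right_kan_extension\<close> asks for no pointwise formula, and the theorem speaks
  of all choices of pushforwards and lifts, so neither \<epsilon> nor \<kappa> is invertible by
  construction. Both facts are obtained by comparing an arbitrary Kan extension or lift with one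
  that has been built: the comparison is invertible by uniqueness, and pointwiseness, or
  invertibility of \<kappa>, travels along it. Pointwiseness does more than invert \<epsilon>. The
  arrows \<open>\<epsilon>\<^sub>a \<circ> R g\<close> with \<open>g : b \<rightarrow> G a\<close>
  are jointly monic on \<open>R b\<close>, so an equation between arrows into \<open>R b\<close> may
  be tested after them. Naturality then moves the test to the object \<open>G a\<close>, where the
  structure of \<open>T\<close> is visible although \<open>b\<close> itself need not lie in the
  image of \<open>G\<close>. On the side of \<open>A\<close> the test is to apply the faithful
  \<open>G\<close> and to cancel the invertible \<kappa>.\<close>

declare (in category) Idn_in_Hom [simp] Comp_in_Hom [simp]
  Comp_Idn_left [simp] Comp_Idn_right [simp] Comp_assoc [simp]

declare (in cfunctor) fob_in_Ob [simp] far_in_Hom [simp] far_Idn [simp] far_Comp [simp]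

text \<open>Composites are normalised to right-nested form, where \<open>g \<circ> f\<close> is no
  longer a subterm once an arrow is composed on the right. This is the form of the equation that
  still rewrites there; the name \<open>right\<close> stands for it in later proofs.\<close>

lemma (in category) Comp_eq_Comp_right:
  assumes "Comp C a b d g f = h" "a \<in> Ob C" "b \<in> Ob C" "d \<in> Ob C" "f \<in> Hom C a b" "g \<in> Hom C b d"
    and "z \<in> Ob C" "x \<in> Hom C z a"
  shows "Comp C z b d g (Comp C z a b f x) = Comp C z a d h x"
  using assms by (metis Comp_assoc)

text \<open>As \<open>far_Comp\<close> splits images of composites, the image of an equation under a
  functor rewrites only if its left side is already split.\<close>

lemma (in cfunctor) far_eq:
  assumes "Comp C a b d g f = h" "a \<in> Ob C" "b \<in> Ob C" "d \<in> Ob C" "f \<in> Hom C a b" "g \<in> Hom C b d"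
  shows "Comp D (fob F a) (fob F b) (fob F d) (far F b d g) (far F a b f) = far F a d h"
  using assms by (metis far_Comp)

text \<open>k y = k (y f) g = k (h x) g = x g. It yields naturality of families of inverses and,
  with a composite for \<open>f\<close>, the passage between lax and colax multiplication
  laws.\<close>

lemma (in category) inverse_square:
  assumes "a \<in> Ob C" "b \<in> Ob C" "c \<in> Ob C" "d \<in> Ob C"
    and "f \<in> Hom C a b" "g \<in> Hom C b a" "h \<in> Hom C c d" "k \<in> Hom C d c"
    and "Comp C b a b f g = Idn C b" "Comp C c d c k h = Idn C c"
    and "x \<in> Hom C a c" "y \<in> Hom C b d"
    and "Comp C a b d y f = Comp C a c d h x"
  shows "Comp C b d c k y = Comp C b a c x g"
proof -
  have "Comp C b d c k y = Comp C b d c k (Comp C b a d (Comp C a b d y f) g)"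
    using assms(1-12) by simp
  also have "\<dots> = Comp C b c c (Comp C c d c k h) (Comp C b a c x g)"
    unfolding assms(13) using assms(1-8,11,12) by simp
  finally show ?thesis
    using assms by simp
qed

lemma fob_mk_functor [simp]: "a \<in> Ob C \<Longrightarrow> fob (mk_functor C p q) a = p a"
  and far_mk_functor [simp]:
    "\<lbrakk>a \<in> Ob C; b \<in> Ob C; f \<in> Hom C a b\<rbrakk> \<Longrightarrow> far (mk_functor C p q) a b f = q a b f"
  by (simp_all add: mk_functor_def)

lemma cfunctor_mk_functor:
  assumes "category C" "category D"
    and "\<And>a. a \<in> Ob C \<Longrightarrow> p a \<in> Ob D"
    and "\<And>a b f. \<lbrakk>a \<in> Ob C; b \<in> Ob C; f \<in> Hom C a b\<rbrakk> \<Longrightarrow> q a b f \<in> Hom D (p a) (p b)"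
    and "\<And>a. a \<in> Ob C \<Longrightarrow> q a a (Idn C a) = Idn D (p a)"
    and "\<And>a b c f g. \<lbrakk>a \<in> Ob C; b \<in> Ob C; c \<in> Ob C; f \<in> Hom C a b; g \<in> Hom C b c\<rbrakk>
          \<Longrightarrow> q a c (Comp C a b c g f) = Comp D (p a) (p b) (p c) (q b c g) (q a b f)"
  shows "cfunctor C D (mk_functor C p q)"
proof -
  interpret C: category C by fact
  interpret D: category D by fact
  show ?thesis
    by unfold_locales (use assms in \<open>auto simp: mk_functor_def\<close>)
qed

text \<open>For pushforward and lift, \<open>q\<close> is a definite description. The conditions are
  therefore put on \<open>far F\<close>, about which usable facts are available, and not on
  \<open>q\<close>.\<close>

lemma cfunctor_of_mk_functor:
  assumes F: "F = mk_functor C p q" and "category C" "category D"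
    and "\<And>a. a \<in> Ob C \<Longrightarrow> p a \<in> Ob D"
    and "\<And>a b f. \<lbrakk>a \<in> Ob C; b \<in> Ob C; f \<in> Hom C a b\<rbrakk> \<Longrightarrow> far F a b f \<in> Hom D (p a) (p b)"
    and "\<And>a. a \<in> Ob C \<Longrightarrow> far F a a (Idn C a) = Idn D (p a)"
    and "\<And>a b c f g. \<lbrakk>a \<in> Ob C; b \<in> Ob C; c \<in> Ob C; f \<in> Hom C a b; g \<in> Hom C b c\<rbrakk>
          \<Longrightarrow> far F a c (Comp C a b c g f) = Comp D (p a) (p b) (p c) (far F b c g) (far F a b f)"
  shows "cfunctor C D F"
proof -
  interpret category C by fact
  show ?thesis
    using assms(4-) unfolding F by (intro cfunctor_mk_functor assms(2,3)) simp_all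
qed

lemma fob_cfcomp [simp]: "a \<in> Ob C \<Longrightarrow> fob (cfcomp C G F) a = fob G (fob F a)"
  and far_cfcomp [simp]: "\<lbrakk>a \<in> Ob C; b \<in> Ob C; f \<in> Hom C a b\<rbrakk>
      \<Longrightarrow> far (cfcomp C G F) a b f = far G (fob F a) (fob F b) (far F a b f)"
  by (simp_all add: cfcomp_def)

lemma fob_idf [simp]: "a \<in> Ob C \<Longrightarrow> fob (idf C) a = a"
  and far_idf [simp]: "\<lbrakk>a \<in> Ob C; b \<in> Ob C; f \<in> Hom C a b\<rbrakk> \<Longrightarrow> far (idf C) a b f = f"
  by (simp_all add: idf_def)

lemma cfunctor_cfcomp:
  assumes "cfunctor C D F" "cfunctor D E G"
  shows "cfunctor C E (cfcomp C G F)"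
proof -
  interpret F: cfunctor C D F by fact
  interpret G: cfunctor D E G by fact
  show ?thesis
    unfolding cfcomp_def
    by (rule cfunctor_mk_functor) (auto simp: F.dom.category_axioms G.cod.category_axioms)
qed

lemma cfunctor_idf: "category C \<Longrightarrow> cfunctor C C (idf C)"
  unfolding idf_def by (rule cfunctor_mk_functor) (auto simp: category.Comp_in_Hom)

lemma nat_transI:
  assumes "cfunctor C D F" "cfunctor C D G"
    and "\<And>a. a \<in> Ob C \<Longrightarrow> \<alpha> a \<in> Hom D (fob F a) (fob G a)"
    and "\<And>a b f. \<lbrakk>a \<in> Ob C; b \<in> Ob C; f \<in> Hom C a b\<rbrakk>
          \<Longrightarrow> Comp D (fob F a) (fob F b) (fob G b) (\<alpha> b) (far F a b f)
              = Comp D (fob F a) (fob G a) (fob G b) (far G a b f) (\<alpha> a)"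
    and "\<alpha> \<in> extensional (Ob C)"
  shows "nat_trans C D F G \<alpha>"
  using assms by (simp add: nat_trans_def nat_trans_axioms_def)

lemma nat_trans_eqI:
  assumes "nat_trans C D F G \<alpha>" "nat_trans C D F' G' \<beta>" "\<And>a. a \<in> Ob C \<Longrightarrow> \<alpha> a = \<beta> a"
  shows "\<alpha> = \<beta>"
  by (rule extensionalityI[OF nat_trans.extensional nat_trans.extensional]) (use assms in auto)

lemma functor_category_simps [simp]:
  "Ob (functor_category C D) = {F. cfunctor C D F}"
  "Hom (functor_category C D) = (\<lambda>F G. {\<alpha>. nat_trans C D F G \<alpha>})"
  "Idn (functor_category C D) = nat_id C D"
  "Comp (functor_category C D) = nat_comp C D"
  by (simp_all add: functor_category_def)

lemma Mnd_simps [simp]: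
  "Ob (Mnd C) = {T. monad C T}"
  "Hom (Mnd C) = (\<lambda>T S. {\<theta>. monad_map C T S \<theta>})"
  "Idn (Mnd C) = (\<lambda>T. nat_id C C (mfun T))"
  "Comp (Mnd C) = (\<lambda>T S R. nat_comp C C (mfun T) (mfun S) (mfun R))"
  by (simp_all add: Mnd_def)

lemma nat_id_apply [simp]: "a \<in> Ob C \<Longrightarrow> nat_id C D F a = Idn D (fob F a)"
  by (simp add: nat_id_def)

lemma nat_comp_apply [simp]: "a \<in> Ob C \<Longrightarrow>
    nat_comp C D F G H \<beta> \<alpha> a = Comp D (fob F a) (fob G a) (fob H a) (\<beta> a) (\<alpha> a)"
  by (simp add: nat_comp_def)

lemma nat_trans_nat_id:
  assumes "cfunctor C D F"
  shows "nat_trans C D F F (nat_id C D F)"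
proof -
  interpret F: cfunctor C D F by fact
  show ?thesis
    by (rule nat_transI) (auto simp: assms nat_id_def)
qed

lemma nat_trans_nat_comp:
  assumes "nat_trans C D F G \<alpha>" "nat_trans C D G H \<beta>"
  shows "nat_trans C D F H (nat_comp C D F G H \<beta> \<alpha>)"
proof -
  interpret \<alpha>: nat_trans C D F G \<alpha> by fact
  interpret \<beta>: nat_trans C D G H \<beta> by fact
  show ?thesis
  proof (rule nat_transI)
    fix a b f assume *: "a \<in> Ob C" "b \<in> Ob C" "f \<in> Hom C a b"
    note [simp] = \<alpha>.component \<beta>.component
    have "Comp D (fob F a) (fob F b) (fob H b) (nat_comp C D F G H \<beta> \<alpha> b) (far F a b f)
      = Comp D (fob F a) (fob G b) (fob H b) (\<beta> b)
          (Comp D (fob F a) (fob F b) (fob G b) (\<alpha> b) (far F a b f))"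
      using * by simp
    also have "\<dots> = Comp D (fob F a) (fob G a) (fob H b)
        (Comp D (fob G a) (fob G b) (fob H b) (\<beta> b) (far G a b f)) (\<alpha> a)"
      using * by (simp add: \<alpha>.naturality)
    also have "\<dots> = Comp D (fob F a) (fob H a) (fob H b) (far H a b f) (nat_comp C D F G H \<beta> \<alpha> a)"
      using * by (simp add: \<beta>.naturality)
    finally show "Comp D (fob F a) (fob F b) (fob H b) (nat_comp C D F G H \<beta> \<alpha> b) (far F a b f)
      = Comp D (fob F a) (fob H a) (fob H b) (far H a b f) (nat_comp C D F G H \<beta> \<alpha> a)" .
  qed (auto simp: \<alpha>.src.cfunctor_axioms \<beta>.tgt.cfunctor_axioms \<alpha>.component \<beta>.component nat_comp_def)
qed

section \<open>Set-valued functors\<close>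

lemma Set_cat_simps [simp]:
  "Ob Set_cat = {X. small X}"
  "Hom Set_cat = (\<lambda>X Y. X \<rightarrow>\<^sub>E Y)"
  "Idn Set_cat = (\<lambda>X. \<lambda>x\<in>X. x)"
  "Comp Set_cat = (\<lambda>X Y Z g f. compose X g f)"
  by (simp_all add: Set_cat_def)

lemma category_Set_cat: "category Set_cat"
  by unfold_locales
    (auto simp: compose_def PiE_def extensional_def Pi_def fun_eq_iff)

lemma set_functor_app:
  assumes "cfunctor C Set_cat P" "a \<in> Ob C" "b \<in> Ob C" "f \<in> Hom C a b" "x \<in> fob P a"
  shows "far P a b f x \<in> fob P b"
  using cfunctor.far_in_Hom[OF assms(1-4)] assms(5) by (auto simp: PiE_def)

lemma set_functor_Idn:
  assumes "cfunctor C Set_cat P" "a \<in> Ob C" "x \<in> fob P a"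
  shows "far P a a (Idn C a) x = x"
  using cfunctor.far_Idn[OF assms(1-2)] assms(3) by simp

lemma set_functor_Comp:
  assumes "cfunctor C Set_cat P" "a \<in> Ob C" "b \<in> Ob C" "c \<in> Ob C"
    and "f \<in> Hom C a b" "g \<in> Hom C b c" "x \<in> fob P a"
  shows "far P a c (Comp C a b c g f) x = far P b c g (far P a b f x)"
  using cfunctor.far_Comp[OF assms(1-6)] assms(7) by (simp add: compose_def)

lemma set_nat_app:
  assumes "nat_trans C Set_cat P Q \<tau>" "a \<in> Ob C" "x \<in> fob P a"
  shows "\<tau> a x \<in> fob Q a"
  using nat_trans.component[OF assms(1-2)] assms(3) by (auto simp: PiE_def)

lemma set_nat_naturality:
  assumes "nat_trans C Set_cat P Q \<tau>" "a \<in> Ob C" "b \<in> Ob C" "f \<in> Hom C a b" "x \<in> fob P a"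
  shows "\<tau> b (far P a b f x) = far Q a b f (\<tau> a x)"
  using fun_cong[OF nat_trans.naturality[OF assms(1-4)], of x] assms(5) by (simp add: compose_def)

lemma set_natI:
  assumes "cfunctor C Set_cat P" "cfunctor C Set_cat Q"
    and "\<And>a x. \<lbrakk>a \<in> Ob C; x \<in> fob P a\<rbrakk> \<Longrightarrow> t a x \<in> fob Q a"
    and "\<And>a b f x. \<lbrakk>a \<in> Ob C; b \<in> Ob C; f \<in> Hom C a b; x \<in> fob P a\<rbrakk>
          \<Longrightarrow> t b (far P a b f x) = far Q a b f (t a x)"
  shows "nat_trans C Set_cat P Q (\<lambda>a\<in>Ob C. \<lambda>x\<in>fob P a. t a x)"
proof (rule nat_transI)
  fix a b f assume "a \<in> Ob C" "b \<in> Ob C" "f \<in> Hom C a b"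
  then show "Comp Set_cat (fob P a) (fob P b) (fob Q b)
      ((\<lambda>a\<in>Ob C. \<lambda>x\<in>fob P a. t a x) b) (far P a b f)
    = Comp Set_cat (fob P a) (fob Q a) (fob Q b) (far Q a b f) ((\<lambda>a\<in>Ob C. \<lambda>x\<in>fob P a. t a x) a)"
    using assms set_functor_app[OF assms(1)] by (auto simp: compose_def fun_eq_iff)
qed (use assms in auto)

lemma set_nat_eqI:
  assumes "nat_trans C Set_cat P Q \<sigma>" "nat_trans C Set_cat P Q \<tau>"
    and "\<And>a x. \<lbrakk>a \<in> Ob C; x \<in> fob P a\<rbrakk> \<Longrightarrow> \<sigma> a x = \<tau> a x"
  shows "\<sigma> = \<tau>"
proof (rule nat_trans_eqI[OF assms(1,2)])
  fix a assume a: "a \<in> Ob C"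
  show "\<sigma> a = \<tau> a"
    using nat_trans.component[OF assms(1) a] nat_trans.component[OF assms(2) a] assms(3) a
    by (auto intro: PiE_ext)
qed

lemma locally_smallD:
  "locally_small C \<Longrightarrow> category C"
  "\<lbrakk>locally_small C; a \<in> Ob C; b \<in> Ob C\<rbrakk> \<Longrightarrow> small (Hom C a b)"
  by (auto simp: locally_small_def)

lemma cfunctor_hom_functor:
  assumes "locally_small C" "a \<in> Ob C"
  shows "cfunctor C Set_cat (hom_functor C a)"
proof -
  interpret category C using assms(1) by (rule locally_smallD)
  show ?thesis
    unfolding hom_functor_def
    by (rule cfunctor_mk_functor)
      (use assms in \<open>auto simp: locally_smallD category_axioms category_Set_cat compose_def
          fun_eq_iff\<close>)
qed

lemma hom_functor_apply [simp]:
  "x \<in> Ob C \<Longrightarrow> fob (hom_functor C a) x = Hom C a x"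
  "\<lbrakk>x \<in> Ob C; y \<in> Ob C; f \<in> Hom C x y; g \<in> Hom C a x\<rbrakk>
    \<Longrightarrow> far (hom_functor C a) x y f g = Comp C a x y f g"
  by (simp_all add: hom_functor_def)

text \<open>Yoneda: \<open>u\<close> corresponds to the identity of \<open>a\<close>. Having an
  element instead of a natural isomorphism lets the limit argument compute with arrows of
  \<open>C\<close>.\<close>

lemma representable_universal_element:
  assumes "locally_small C" "cfunctor C Set_cat P" "representable C P"
  shows "\<exists>a\<in>Ob C. \<exists>u\<in>fob P a. \<forall>c\<in>Ob C. \<forall>x\<in>fob P c. \<exists>!h. h \<in> Hom C a c \<and> far P a c h u = x"
proof -
  interpret category C using assms(1) by (rule locally_smallD)
  obtain a f g where a: "a \<in> Ob C"
    and f: "nat_trans C Set_cat P (hom_functor C a) f"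
    and g: "nat_trans C Set_cat (hom_functor C a) P g"
    and gf: "nat_comp C Set_cat P (hom_functor C a) P g f = nat_id C Set_cat P"
    and fg: "nat_comp C Set_cat (hom_functor C a) P (hom_functor C a) f g
        = nat_id C Set_cat (hom_functor C a)"
    using assms(3) by (auto simp: representable_def isomorphic_def)
  have gf': "g c (f c x) = x" if "c \<in> Ob C" "x \<in> fob P c" for c x
    using fun_cong[OF fun_cong[OF gf, of c], of x] that by (simp add: compose_def)
  have fg': "f c (g c h) = h" if "c \<in> Ob C" "h \<in> Hom C a c" for c h
    using fun_cong[OF fun_cong[OF fg, of c], of h] that by (simp add: compose_def)
  define u where "u = g a (Idn C a)"
  have u: "u \<in> fob P a"
    unfolding u_def using set_nat_app[OF g a] a by simp
  have gu: "far P a c h u = g c h" if "c \<in> Ob C" "h \<in> Hom C a c" for c h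
    using set_nat_naturality[OF g a that, of "Idn C a"] a that by (simp add: u_def)
  show ?thesis
  proof (intro bexI[OF _ a] bexI[OF _ u] ballI)
    fix c x assume c: "c \<in> Ob C" and x: "x \<in> fob P c"
    have "f c x \<in> Hom C a c"
      using set_nat_app[OF f c x] c by simp
    then show "\<exists>!h. h \<in> Hom C a c \<and> far P a c h u = x"
      using c x gf' fg' gu by metis
  qed
qed

section \<open>Limits over comma categories\<close>

locale span = G: cfunctor A B G + F: cfunctor A C F
  for A :: "('a, 'm) category" and B :: "('b, 'n) category" and C :: "('c, 'k) category"
    and G :: "('a, 'm, 'b, 'n) cfunctor" and F :: "('a, 'm, 'c, 'k) cfunctor"
begin

text \<open>A cone with vertex \<open>y\<close> over the composite of \<open>F\<close> with the projection \<open>b \<down> G \<rightarrow> A\<close>.\<close>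

definition comma_cone :: "'b \<Rightarrow> 'c \<Rightarrow> ('a \<Rightarrow> 'n \<Rightarrow> 'k) \<Rightarrow> bool" where
  "comma_cone b y \<sigma> \<longleftrightarrow> y \<in> Ob C \<and>
     (\<forall>a\<in>Ob A. \<forall>g\<in>Hom B b (fob G a). \<sigma> a g \<in> Hom C y (fob F a)) \<and>
     (\<forall>a\<in>Ob A. \<forall>a'\<in>Ob A. \<forall>f\<in>Hom A a a'. \<forall>g\<in>Hom B b (fob G a).
        \<sigma> a' (Comp B b (fob G a) (fob G a') (far G a a' f) g)
        = Comp C y (fob F a) (fob F a') (far F a a' f) (\<sigma> a g))"

text \<open>A limit over the comma category of pairs \<open>(a, g)\<close>, curried and without
  forming that category; it is what a pointwise right Kan extension has as its value at
  \<open>b\<close>.\<close>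

definition comma_limit :: "'b \<Rightarrow> 'c \<Rightarrow> ('a \<Rightarrow> 'n \<Rightarrow> 'k) \<Rightarrow> bool" where
  "comma_limit b r l \<longleftrightarrow> comma_cone b r l \<and>
     (\<forall>y \<sigma>. comma_cone b y \<sigma> \<longrightarrow>
       (\<exists>!h. h \<in> Hom C y r \<and>
         (\<forall>a\<in>Ob A. \<forall>g\<in>Hom B b (fob G a). Comp C y r (fob F a) (l a g) h = \<sigma> a g)))"

lemma comma_coneI:
  assumes "y \<in> Ob C"
    and "\<And>a g. \<lbrakk>a \<in> Ob A; g \<in> Hom B b (fob G a)\<rbrakk> \<Longrightarrow> \<sigma> a g \<in> Hom C y (fob F a)"
    and "\<And>a a' f g. \<lbrakk>a \<in> Ob A; a' \<in> Ob A; f \<in> Hom A a a'; g \<in> Hom B b (fob G a)\<rbrakk>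
      \<Longrightarrow> \<sigma> a' (Comp B b (fob G a) (fob G a') (far G a a' f) g)
        = Comp C y (fob F a) (fob F a') (far F a a' f) (\<sigma> a g)"
  shows "comma_cone b y \<sigma>"
  using assms by (auto simp: comma_cone_def)

lemma comma_coneD:
  assumes "comma_cone b y \<sigma>"
  shows "y \<in> Ob C"
    and "\<lbrakk>a \<in> Ob A; g \<in> Hom B b (fob G a)\<rbrakk> \<Longrightarrow> \<sigma> a g \<in> Hom C y (fob F a)"
    and "\<lbrakk>a \<in> Ob A; a' \<in> Ob A; f \<in> Hom A a a'; g \<in> Hom B b (fob G a)\<rbrakk>
      \<Longrightarrow> \<sigma> a' (Comp B b (fob G a) (fob G a') (far G a a' f) g)
        = Comp C y (fob F a) (fob F a') (far F a a' f) (\<sigma> a g)"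
  using assms by (auto simp: comma_cone_def)

lemma comma_limitD:
  assumes "comma_limit b r l"
  shows "comma_cone b r l"
    and "comma_cone b y \<sigma> \<Longrightarrow> \<exists>!h. h \<in> Hom C y r \<and>
         (\<forall>a\<in>Ob A. \<forall>g\<in>Hom B b (fob G a). Comp C y r (fob F a) (l a g) h = \<sigma> a g)"
  using assms by (auto simp: comma_limit_def)

lemma comma_cone_Comp:
  assumes "comma_cone b r l" "y \<in> Ob C" "h \<in> Hom C y r"
  shows "comma_cone b y (\<lambda>a g. Comp C y r (fob F a) (l a g) h)"
  using assms by (intro comma_coneI) (auto simp: comma_coneD)

text \<open>Both arrows mediate the cone obtained by composing the legs with \<open>h\<close>; thus
  limit legs are jointly monic.\<close>

lemma comma_limit_eqI:
  assumes "comma_limit b r l" "y \<in> Ob C" "h \<in> Hom C y r" "k \<in> Hom C y r"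
    and "\<And>a g. \<lbrakk>a \<in> Ob A; g \<in> Hom B b (fob G a)\<rbrakk>
      \<Longrightarrow> Comp C y r (fob F a) (l a g) h = Comp C y r (fob F a) (l a g) k"
  shows "h = k"
  using comma_limitD(2)[OF assms(1) comma_cone_Comp[OF comma_limitD(1)[OF assms(1)] assms(2,3)]]
    assms(3-5) by auto

end

text \<open>The diagram over \<open>b \<down> G\<close> may be large. A presentation of \<open>B(b, G-)\<close> as a colimit of
    representables
  \<open>A(p i, -)\<close> over a small \<open>I\<close> makes its limit the limit of \<open>F \<circ> p\<close> over the opposite of \<open>I\<close>, since
      cones
  with vertex \<open>y\<close> are the natural transformations from \<open>B(b, G-)\<close> to \<open>C(y, F-)\<close>.\<close>

locale small_span = span A B C G F
  for A :: "('a, 'u) category" and B :: "('b, 'u) category" and C :: "('c, 'u) category"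
    and G :: "('a, 'u, 'b, 'u) cfunctor" and F :: "('a, 'u, 'c, 'u) cfunctor" +
  assumes lsA: "locally_small A" and lsB: "locally_small B" and lsC: "locally_small C"
begin

lemma cfunctor_weight: "b \<in> Ob B \<Longrightarrow> cfunctor A Set_cat (cfcomp A (hom_functor B b) G)"
  by (intro cfunctor_cfcomp[of A B] cfunctor_hom_functor lsB G.cfunctor_axioms)

lemma cfunctor_hom_F: "y \<in> Ob C \<Longrightarrow> cfunctor A Set_cat (cfcomp A (hom_functor C y) F)"
  by (intro cfunctor_cfcomp[of A C] cfunctor_hom_functor lsC F.cfunctor_axioms)

lemma comma_cone_nat_trans:
  assumes "b \<in> Ob B" "comma_cone b y \<sigma>"
  shows "nat_trans A Set_cat (cfcomp A (hom_functor B b) G) (cfcomp A (hom_functor C y) F)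
    (\<lambda>a\<in>Ob A. \<lambda>g\<in>fob (cfcomp A (hom_functor B b) G) a. \<sigma> a g)"
  using comma_coneD[OF assms(2)] assms(1)
  by (intro set_natI cfunctor_weight cfunctor_hom_F) auto

lemma nat_trans_comma_cone:
  assumes "b \<in> Ob B" "y \<in> Ob C"
    and t: "nat_trans A Set_cat (cfcomp A (hom_functor B b) G) (cfcomp A (hom_functor C y) F) \<tau>"
  shows "comma_cone b y \<tau>"
proof (rule comma_coneI)
  fix a g assume "a \<in> Ob A" "g \<in> Hom B b (fob G a)"
  then show "\<tau> a g \<in> Hom C y (fob F a)"
    using set_nat_app[OF t, of a g] by simp
next
  fix a a' f g assume *: "a \<in> Ob A" "a' \<in> Ob A" "f \<in> Hom A a a'" "g \<in> Hom B b (fob G a)"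
  then have "\<tau> a g \<in> Hom C y (fob F a)"
    using set_nat_app[OF t, of a g] by simp
  then show "\<tau> a' (Comp B b (fob G a) (fob G a') (far G a a' f) g)
      = Comp C y (fob F a) (fob F a') (far F a a' f) (\<tau> a g)"
    using set_nat_naturality[OF t, of a a' f g] * by simp
qed fact

text \<open>The objects \<open>(p i, el i)\<close> of the comma category suffice to know a cone: by
  \<open>restrict\<close>, \<open>extend\<close> and \<open>unique\<close>, cones over the comma
  category are the same as cones over the small diagram \<open>E\<close>. Hence the limit of
  \<open>E\<close>, with its cone extended, is the limit over the comma category.\<close>

lemma comma_limit_exists:
  assumes b: "b \<in> Ob B" and complete: "complete_category C"
    and small: "small_functor A (cfcomp A (hom_functor B b) G)"
  shows "\<exists>r l. comma_limit b r l"
proof -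
  define W where "W = cfcomp A (hom_functor B b) G"
  obtain I :: "('u, 'u) category" and D \<iota>
    where small_I: "small_category I" and D: "cfunctor I (functor_category A Set_cat) D"
      and rep: "\<And>i. i \<in> Ob I \<Longrightarrow> representable A (fob D i)"
      and colim: "is_colimit (functor_category A Set_cat) I D W \<iota>"
    using small unfolding small_functor_def W_def by blast
  interpret D: cfunctor I "functor_category A Set_cat" D by fact
  have D_cfun: "cfunctor A Set_cat (fob D i)" if "i \<in> Ob I" for i
    using D.fob_in_Ob[OF that] by simp
  have D_nat: "nat_trans A Set_cat (fob D i) (fob D j) (far D i j k)"
    if "i \<in> Ob I" "j \<in> Ob I" "k \<in> Hom I i j" for i j k
    using D.far_in_Hom[OF that] by simp
  have \<iota>_nat: "nat_trans A Set_cat (fob D i) W (\<iota> i)" if "i \<in> Ob I" for i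
    using colim that by (auto simp: is_colimit_def is_cocone_def)
  have \<iota>_cocone: "\<iota> j a (far D i j k a x) = \<iota> i a x"
    if "i \<in> Ob I" "j \<in> Ob I" "k \<in> Hom I i j" "a \<in> Ob A" "x \<in> fob (fob D i) a" for i j k a x
  proof -
    have "nat_comp A Set_cat (fob D i) (fob D j) W (\<iota> j) (far D i j k) = \<iota> i"
      using colim that by (auto simp: is_colimit_def is_cocone_def)
    from fun_cong[OF fun_cong[OF this, of a], of x] show ?thesis
      using that by (simp add: compose_def)
  qed
  have D_Idn: "far D i i (Idn I i) a x = x"
    if "i \<in> Ob I" "a \<in> Ob A" "x \<in> fob (fob D i) a" for i a x
    using fun_cong[OF fun_cong[OF D.far_Idn, of i a], of x] that by simp
  have D_Comp: "far D i m (Comp I i j m l k) a x = far D j m l a (far D i j k a x)"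
    if "i \<in> Ob I" "j \<in> Ob I" "m \<in> Ob I" "k \<in> Hom I i j" "l \<in> Hom I j m"
      "a \<in> Ob A" "x \<in> fob (fob D i) a" for i j m k l a x
    using fun_cong[OF fun_cong[OF D.far_Comp[OF that(1-5)], of a], of x] that
    by (simp add: compose_def)
  have "\<forall>i\<in>Ob I. \<exists>a u. a \<in> Ob A \<and> u \<in> fob (fob D i) a \<and>
      (\<forall>c\<in>Ob A. \<forall>x\<in>fob (fob D i) c. \<exists>!h. h \<in> Hom A a c \<and> far (fob D i) a c h u = x)"
    using representable_universal_element[OF lsA D_cfun rep] by blast
  then obtain p u where p: "\<And>i. i \<in> Ob I \<Longrightarrow> p i \<in> Ob A"
    and u: "\<And>i. i \<in> Ob I \<Longrightarrow> u i \<in> fob (fob D i) (p i)"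
    and ex1: "\<And>i c x. \<lbrakk>i \<in> Ob I; c \<in> Ob A; x \<in> fob (fob D i) c\<rbrakk>
      \<Longrightarrow> \<exists>!h. h \<in> Hom A (p i) c \<and> far (fob D i) (p i) c h (u i) = x"
    by metis
  \<comment> \<open>The inverse of the Yoneda bijection: \<open>q i c\<close> identifies
    \<open>D i c\<close> with \<open>A(p i, c)\<close>, the universal element \<open>u i\<close>
    going to the identity.\<close>
  define q where "q i c x = (THE h. h \<in> Hom A (p i) c \<and> far (fob D i) (p i) c h (u i) = x)" for i c
      x
  have q: "q i c x \<in> Hom A (p i) c" and q_app: "far (fob D i) (p i) c (q i c x) (u i) = x"
    if "i \<in> Ob I" "c \<in> Ob A" "x \<in> fob (fob D i) c" for i c x
    using theI'[OF ex1[OF that]] by (simp_all add: q_def)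
  have q_eq: "q i c x = h"
    if "i \<in> Ob I" "c \<in> Ob A" "x \<in> fob (fob D i) c" "h \<in> Hom A (p i) c"
      "far (fob D i) (p i) c h (u i) = x" for i c x h
    using ex1[OF that(1-3)] q[OF that(1-3)] q_app[OF that(1-3)] that(4,5) by blast
  note [simp] = p u q q_app
  \<comment> \<open>Yoneda turns the transformation \<open>D i \<rightarrow> D j\<close> given by
    \<open>k\<close> into an arrow \<open>p j \<rightarrow> p i\<close>. This reversal is why the
    limit is indexed by the opposite \<open>J\<close> of \<open>I\<close>.\<close>
  define e where "e i j k = q j (p i) (far D i j k (p i) (u i))" for i j k
  have app: "far D i j k a x \<in> fob (fob D j) a"
    if "i \<in> Ob I" "j \<in> Ob I" "k \<in> Hom I i j" "a \<in> Ob A" "x \<in> fob (fob D i) a" for i j k a x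
    using set_nat_app[OF D_nat] that by blast
  have e: "e i j k \<in> Hom A (p j) (p i)"
    and e_app: "far (fob D j) (p j) (p i) (e i j k) (u j) = far D i j k (p i) (u i)"
    if "i \<in> Ob I" "j \<in> Ob I" "k \<in> Hom I i j" for i j k
    unfolding e_def using that by (simp_all add: app)
  have q_natural: "q i c (far (fob D i) a c f x) = Comp A (p i) a c f (q i a x)"
    if "i \<in> Ob I" "a \<in> Ob A" "c \<in> Ob A" "f \<in> Hom A a c" "x \<in> fob (fob D i) a" for i a c f x
    by (rule q_eq)
      (use that in \<open>auto simp: set_functor_app[OF D_cfun] set_functor_Comp[OF D_cfun]\<close>)
  \<comment> \<open>Under the identifications \<open>q\<close>, arrows of \<open>A\<close> act by
    postcomposition (\<open>q_natural\<close>) and arrows of \<open>I\<close> by precomposition with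
    \<open>e\<close>.\<close>
  have q_dinatural: "q j a (far D i j k a x) = Comp A (p j) (p i) a (q i a x) (e i j k)"
    if "i \<in> Ob I" "j \<in> Ob I" "k \<in> Hom I i j" "a \<in> Ob A" "x \<in> fob (fob D i) a" for i j k a x
    by (rule q_eq)
      (use that in \<open>auto simp: app e e_app set_functor_Comp[OF D_cfun, OF _ p p]
        set_nat_naturality[OF D_nat, symmetric]\<close>)
  define J where "J = I\<lparr>Hom := (\<lambda>i j. Hom I j i), Comp := (\<lambda>i j k g f. Comp I k j i f g)\<rparr>"
  have J_simps [simp]: "Ob J = Ob I" "Hom J i j = Hom I j i" "Idn J = Idn I"
    "Comp J i j k g f = Comp I k j i f g" for i j k g f
    by (simp_all add: J_def)
  have cat_J: "category J"
    by unfold_locales auto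
  have small_J: "small_category J"
    using small_I cat_J by (auto simp: small_category_def locally_small_def)
  define E where "E = mk_functor J (\<lambda>i. fob F (p i)) (\<lambda>j i k. far F (p j) (p i) (e i j k))"
  have E: "cfunctor J C E"
    unfolding E_def
  proof (rule cfunctor_mk_functor[OF cat_J F.cod.category_axioms])
    fix i assume "i \<in> Ob J"
    moreover from this have "e i i (Idn J i) = Idn A (p i)"
      unfolding e_def by (intro q_eq) (auto simp: D_Idn set_functor_Idn[OF D_cfun])
    ultimately show "far F (p i) (p i) (e i i (Idn J i)) = Idn C (fob F (p i))"
      by simp
  next
    fix m j i l k assume "m \<in> Ob J" "j \<in> Ob J" "i \<in> Ob J" "l \<in> Hom J m j" "k \<in> Hom J j i"
    then have *: "m \<in> Ob I" "j \<in> Ob I" "i \<in> Ob I" "l \<in> Hom I j m" "k \<in> Hom I i j"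
      by simp_all
    have "e i m (Comp I i j m l k) = q m (p i) (far D j m l (p i) (far D i j k (p i) (u i)))"
      unfolding e_def using * by (simp add: compose_def)
    also have "\<dots> = Comp A (p m) (p j) (p i) (e i j k) (e j m l)"
      using * by (subst q_dinatural) (auto simp: app e_def)
    finally show "far F (p m) (p i) (e i m (Comp J m j i k l))
      = Comp C (fob F (p m)) (fob F (p j)) (fob F (p i))
          (far F (p j) (p i) (e i j k)) (far F (p m) (p j) (e j m l))"
      using * e by simp
  qed (auto simp: e)
  \<comment> \<open>The coprojection at the universal element, an arrow
    \<open>b \<rightarrow> G (p i)\<close>. By Yoneda it determines all of \<open>\<iota> i\<close>,
    which is \<open>\<iota>_eq\<close>.\<close>
  define el where "el i = \<iota> i (p i) (u i)" for i
  have el: "el i \<in> Hom B b (fob G (p i))" if "i \<in> Ob I" for i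
    using set_nat_app[OF \<iota>_nat[OF that] p[OF that] u[OF that]] that by (simp add: el_def W_def)
  have \<iota>_eq: "\<iota> i a x = Comp B b (fob G (p i)) (fob G a) (far G (p i) a (q i a x)) (el i)"
    if "i \<in> Ob I" "a \<in> Ob A" "x \<in> fob (fob D i) a" for i a x
    using set_nat_naturality[OF \<iota>_nat[OF that(1)] p[OF that(1)] that(2) q[OF that] u[OF that(1)]]
      that el[OF that(1)] by (simp add: W_def el_def)
  have W_iff: "x \<in> fob W a \<longleftrightarrow> x \<in> Hom B b (fob G a)" if "a \<in> Ob A" for x a
    using that by (simp add: W_def)
  have restrict: "is_cone C J E y (\<lambda>i. \<sigma> (p i) (el i))" if "comma_cone b y \<sigma>" for y \<sigma>
  proof -
    have "\<sigma> (p i) (el i) = Comp C y (fob F (p j)) (fob F (p i)) (far F (p j) (p i) (e i j k))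
        (\<sigma> (p j) (el j))"
      if "i \<in> Ob I" "j \<in> Ob I" "k \<in> Hom I i j" for i j k
    proof -
      have "el i = \<iota> j (p i) (far D i j k (p i) (u i))"
        using that by (simp add: el_def \<iota>_cocone)
      also have "\<dots> = Comp B b (fob G (p j)) (fob G (p i)) (far G (p j) (p i) (e i j k)) (el j)"
        using that by (subst \<iota>_eq) (auto simp: app e_def)
      finally show ?thesis
        using comma_coneD[OF \<open>comma_cone b y \<sigma>\<close>] that el e by simp
    qed
    then show ?thesis
      using comma_coneD[OF that] el by (auto simp: is_cone_def E_def)
  qed
  have extend: "\<exists>\<sigma>. comma_cone b y \<sigma> \<and> (\<forall>i\<in>Ob I. \<sigma> (p i) (el i) = \<pi> i)"
    and unique: "\<And>\<sigma> \<sigma>' a g. \<lbrakk>comma_cone b y \<sigma>; comma_cone b y \<sigma>';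
        \<And>i. i \<in> Ob I \<Longrightarrow> \<sigma> (p i) (el i) = \<pi> i; \<And>i. i \<in> Ob I \<Longrightarrow> \<sigma>' (p i) (el i) = \<pi> i;
        a \<in> Ob A; g \<in> Hom B b (fob G a)\<rbrakk> \<Longrightarrow> \<sigma> a g = \<sigma>' a g"
    if cone: "is_cone C J E y \<pi>" for y \<pi>
  proof -
    define Y where "Y = cfcomp A (hom_functor C y) F"
    have y: "y \<in> Ob C" and \<pi>: "\<And>i. i \<in> Ob I \<Longrightarrow> \<pi> i \<in> Hom C y (fob F (p i))"
      and \<pi>_eq: "\<And>i j k. \<lbrakk>i \<in> Ob I; j \<in> Ob I; k \<in> Hom I i j\<rbrakk>
        \<Longrightarrow> Comp C y (fob F (p j)) (fob F (p i)) (far F (p j) (p i) (e i j k)) (\<pi> j) = \<pi> i"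
      using cone by (auto simp: is_cone_def E_def)
    have Y: "cfunctor A Set_cat Y"
      unfolding Y_def by (rule cfunctor_hom_F[OF y])
    \<comment> \<open>Yoneda again: the leg \<open>\<pi> i : y \<rightarrow> F (p i)\<close> becomes
      a transformation from \<open>D i\<close> to \<open>C(y, F-)\<close>. The cone condition makes
      these a cocone, and the transformation out of the colimit is the extended cone.\<close>
    define \<tau> where "\<tau> i = (\<lambda>a\<in>Ob A. \<lambda>x\<in>fob (fob D i) a.
        Comp C y (fob F (p i)) (fob F a) (far F (p i) a (q i a x)) (\<pi> i))" for i
    have \<tau>: "nat_trans A Set_cat (fob D i) Y (\<tau> i)" if "i \<in> Ob I" for i
      unfolding \<tau>_def
      by (rule set_natI[OF D_cfun[OF that] Y])
        (use that y in \<open>auto simp: \<pi> Y_def q_natural set_functor_app[OF D_cfun]\<close>)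
    have "is_cocone (functor_category A Set_cat) I D Y \<tau>"
      unfolding is_cocone_def functor_category_simps
    proof (intro conjI ballI)
      fix i j k assume *: "i \<in> Ob I" "j \<in> Ob I" "k \<in> Hom I i j"
      show "nat_comp A Set_cat (fob D i) (fob D j) Y (\<tau> j) (far D i j k) = \<tau> i"
      proof (rule set_nat_eqI[OF nat_trans_nat_comp[OF D_nat \<tau>] \<tau>])
        fix a x assume "a \<in> Ob A" "x \<in> fob (fob D i) a"
        then show "nat_comp A Set_cat (fob D i) (fob D j) Y (\<tau> j) (far D i j k) a x = \<tau> i a x"
          using * y by (simp add: compose_def \<tau>_def app q_dinatural \<pi> \<pi>_eq e)
      qed (use * in auto)
    qed (auto simp: Y \<tau>)
    then have ex1: "\<exists>!h. nat_trans A Set_cat W Y h \<and>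
        (\<forall>i\<in>Ob I. nat_comp A Set_cat (fob D i) W Y h (\<iota> i) = \<tau> i)"
      using colim by (auto simp: is_colimit_def)
    then obtain h where h: "nat_trans A Set_cat W Y h"
      and h_eq: "\<And>i. i \<in> Ob I \<Longrightarrow> nat_comp A Set_cat (fob D i) W Y h (\<iota> i) = \<tau> i"
      by blast
    have "h (p i) (el i) = \<pi> i" if i: "i \<in> Ob I" for i
    proof -
      have "q i (p i) (u i) = Idn A (p i)"
        using i by (intro q_eq) (auto simp: set_functor_Idn[OF D_cfun])
      then show ?thesis
        using fun_cong[OF fun_cong[OF h_eq[OF i], of "p i"], of "u i"] i y
        by (simp add: \<tau>_def compose_def el_def \<pi>)
    qed
    moreover have "comma_cone b y h"
      by (rule nat_trans_comma_cone[OF b y]) (use h in \<open>simp add: W_def Y_def\<close>)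
    ultimately show "\<exists>\<sigma>. comma_cone b y \<sigma> \<and> (\<forall>i\<in>Ob I. \<sigma> (p i) (el i) = \<pi> i)"
      by blast
    \<comment> \<open>A comma cone with the prescribed values at the \<open>el i\<close> has
      composites \<open>\<tau> i\<close> with the coprojections, so it is the mediating
      transformation out of the colimit.\<close>
    have h_unique: "(\<lambda>a\<in>Ob A. \<lambda>g\<in>fob W a. \<sigma> a g) = h"
      if \<sigma>: "comma_cone b y \<sigma>" and \<sigma>_el: "\<And>i. i \<in> Ob I \<Longrightarrow> \<sigma> (p i) (el i) = \<pi> i" for \<sigma>
    proof -
      let ?t = "\<lambda>a\<in>Ob A. \<lambda>g\<in>fob W a. \<sigma> a g"
      have t: "nat_trans A Set_cat W Y ?t"
        unfolding W_def Y_def by (rule comma_cone_nat_trans[OF b \<sigma>])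
      have "nat_comp A Set_cat (fob D i) W Y ?t (\<iota> i) = \<tau> i" if i: "i \<in> Ob I" for i
      proof (rule set_nat_eqI[OF nat_trans_nat_comp[OF \<iota>_nat t] \<tau>])
        fix a x assume *: "a \<in> Ob A" "x \<in> fob (fob D i) a"
        have "\<iota> i a x \<in> fob W a"
          using set_nat_app[OF \<iota>_nat] i * by blast
        then show "nat_comp A Set_cat (fob D i) W Y ?t (\<iota> i) a x = \<tau> i a x"
          using comma_coneD(3)[OF \<sigma> p[OF i] *(1) q el, OF i * i] \<sigma>_el[OF i] * i
          by (simp add: compose_def \<tau>_def \<iota>_eq)
      qed (use i in auto)
      then show ?thesis
        using ex1 h h_eq t by blast
    qed
    show "\<sigma> a g = \<sigma>' a g"
      if "comma_cone b y \<sigma>" "comma_cone b y \<sigma>'" "\<And>i. i \<in> Ob I \<Longrightarrow> \<sigma> (p i) (el i) = \<pi> i"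
        "\<And>i. i \<in> Ob I \<Longrightarrow> \<sigma>' (p i) (el i) = \<pi> i" "a \<in> Ob A" "g \<in> Hom B b (fob G a)" for \<sigma> \<sigma>' a g
      using fun_cong[OF fun_cong[OF
          trans[OF h_unique[OF that(1,3)] h_unique[OF that(2,4), symmetric]],
        of a], of g] that(5,6) by (simp add: W_iff)
  qed
  obtain r \<pi> where lim: "is_limit C J E r \<pi>"
    using complete small_J E unfolding complete_category_def by blast
  then have \<pi>: "is_cone C J E r \<pi>"
    by (simp add: is_limit_def)
  obtain l where l: "comma_cone b r l" and l_el: "\<And>i. i \<in> Ob I \<Longrightarrow> l (p i) (el i) = \<pi> i"
    using extend[OF \<pi>] by blast
  have "\<exists>!h. h \<in> Hom C y r \<and>
      (\<forall>a\<in>Ob A. \<forall>g\<in>Hom B b (fob G a). Comp C y r (fob F a) (l a g) h = \<sigma> a g)"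
    if \<sigma>: "comma_cone b y \<sigma>" for y \<sigma>
  proof -
    \<comment> \<open>The limit of \<open>E\<close> controls only the legs at
      \<open>(p i, el i)\<close>; \<open>unique\<close> spreads the resulting equations to all
      \<open>(a, g)\<close>.\<close>
    have ex1: "\<exists>!h. h \<in> Hom C y r \<and> (\<forall>i\<in>Ob I. Comp C y r (fob F (p i)) (\<pi> i) h = \<sigma> (p i) (el i))"
      using lim restrict[OF \<sigma>] unfolding is_limit_def by (auto simp: E_def)
    then obtain h where h: "h \<in> Hom C y r"
      and h_eq: "\<And>i. i \<in> Ob I \<Longrightarrow> Comp C y r (fob F (p i)) (\<pi> i) h = \<sigma> (p i) (el i)"
      by blast
    show ?thesis
    proof (intro ex1I[of _ h] conjI ballI)
      fix a g assume "a \<in> Ob A" "g \<in> Hom B b (fob G a)"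
      then show "Comp C y r (fob F a) (l a g) h = \<sigma> a g"
        using unique[OF restrict[OF \<sigma>] comma_cone_Comp[OF l _ h] \<sigma>] comma_coneD(1)[OF \<sigma>]
        by (simp add: l_el h_eq)
    next
      fix k assume "k \<in> Hom C y r \<and>
        (\<forall>a\<in>Ob A. \<forall>g\<in>Hom B b (fob G a). Comp C y r (fob F a) (l a g) k = \<sigma> a g)"
      then show "k = h"
        using ex1 h h_eq el l_el p by metis
    qed fact
  qed
  with l have "comma_limit b r l"
    by (simp add: comma_limit_def)
  then show ?thesis
    by blast
qed

end

section \<open>Pointwise right Kan extensions\<close>

context span
begin

text \<open>The limit formula for right Kan extensions with legs prescribed by \<epsilon>, so that
  the leg at an identity is \<epsilon> itself.\<close>

definition pointwise_extension :: "('b, 'n, 'c, 'k) cfunctor \<Rightarrow> ('a \<Rightarrow> 'k) \<Rightarrow> bool" where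
  "pointwise_extension R \<epsilon> \<longleftrightarrow> cfunctor B C R \<and> nat_trans A C (cfcomp A R G) F \<epsilon> \<and>
     (\<forall>b\<in>Ob B. comma_limit b (fob R b)
       (\<lambda>a g. Comp C (fob R b) (fob R (fob G a)) (fob F a) (\<epsilon> a) (far R b (fob G a) g)))"

lemma counit_in_Hom:
  assumes "nat_trans A C (cfcomp A R G) F \<epsilon>" "a \<in> Ob A"
  shows "\<epsilon> a \<in> Hom C (fob R (fob G a)) (fob F a)"
  using nat_trans.component[OF assms] assms(2) by simp

lemma counit_naturality:
  assumes "nat_trans A C (cfcomp A R G) F \<epsilon>" "a \<in> Ob A" "a' \<in> Ob A" "f \<in> Hom A a a'"
  shows "Comp C (fob R (fob G a)) (fob R (fob G a')) (fob F a') (\<epsilon> a')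
      (far R (fob G a) (fob G a') (far G a a' f))
    = Comp C (fob R (fob G a)) (fob F a) (fob F a') (far F a a' f) (\<epsilon> a)"
  using nat_trans.naturality[OF assms] assms(2-) by simp

text \<open>Precomposition with \<open>f : b \<rightarrow> b'\<close> turns the limit cone at
  \<open>b\<close> into a cone for \<open>b'\<close>. The induced arrow is the value of
  \<open>R\<close> at \<open>f\<close>, and functoriality is uniqueness of mediating arrows.\<close>

lemma pointwise_extension_exists:
  assumes "\<And>b. b \<in> Ob B \<Longrightarrow> \<exists>r l. comma_limit b r l"
  shows "\<exists>R \<epsilon>. pointwise_extension R \<epsilon>"
proof -
  obtain r l where lim: "\<And>b. b \<in> Ob B \<Longrightarrow> comma_limit b (r b) (l b)"
    using assms by metis
  note cone = comma_limitD(1)[OF lim]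
  note [simp] = comma_coneD(1,2)[OF cone]
  have "comma_cone b' (r b) (\<lambda>a g. l b a (Comp B b b' (fob G a) g f))"
    if "b \<in> Ob B" "b' \<in> Ob B" "f \<in> Hom B b b'" for b b' f
    using that by (intro comma_coneI) (auto simp: comma_coneD(3)[OF cone, symmetric])
  from comma_limitD(2)[OF lim this]
  have ex1: "\<exists>!h. h \<in> Hom C (r b) (r b') \<and> (\<forall>a\<in>Ob A. \<forall>g\<in>Hom B b' (fob G a).
      Comp C (r b) (r b') (fob F a) (l b' a g) h = l b a (Comp B b b' (fob G a) g f))"
    if "b \<in> Ob B" "b' \<in> Ob B" "f \<in> Hom B b b'" for b b' f
    using that by blast
  define m where "m b b' f = (THE h. h \<in> Hom C (r b) (r b') \<and> (\<forall>a\<in>Ob A. \<forall>g\<in>Hom B b' (fob G a).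
      Comp C (r b) (r b') (fob F a) (l b' a g) h = l b a (Comp B b b' (fob G a) g f)))" for b b' f
  have m [simp]: "m b b' f \<in> Hom C (r b) (r b')"
    and l_m [simp]: "\<lbrakk>a \<in> Ob A; g \<in> Hom B b' (fob G a)\<rbrakk> \<Longrightarrow>
      Comp C (r b) (r b') (fob F a) (l b' a g) (m b b' f) = l b a (Comp B b b' (fob G a) g f)"
    if "b \<in> Ob B" "b' \<in> Ob B" "f \<in> Hom B b b'" for b b' f a g
    using theI'[OF ex1[OF that]] by (auto simp: m_def)
  note l_m_right = F.cod.Comp_eq_Comp_right[OF l_m]
  define R where "R = mk_functor B r m"
  have R: "cfunctor B C R"
    unfolding R_def
  proof (rule cfunctor_mk_functor[OF G.cod.category_axioms F.cod.category_axioms])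
    fix b assume b: "b \<in> Ob B"
    show "m b b (Idn B b) = Idn C (r b)"
      by (rule comma_limit_eqI[OF lim, where y = "r b"]) (use b in auto)
  next
    fix b b' b'' f g
    assume *: "b \<in> Ob B" "b' \<in> Ob B" "b'' \<in> Ob B" "f \<in> Hom B b b'" "g \<in> Hom B b' b''"
    show "m b b'' (Comp B b b' b'' g f) = Comp C (r b) (r b') (r b'') (m b' b'' g) (m b b' f)"
      by (rule comma_limit_eqI[OF lim[of b''], where y = "r b"]) (use * in \<open>auto simp: l_m_right\<close>)
  qed auto
  \<comment> \<open>The leg at the object \<open>(a, id)\<close> of the comma category of
    \<open>G a\<close>. As every \<open>g : b \<rightarrow> G a\<close> is
    \<open>id \<circ> g\<close>, all other legs are
    \<open>\<epsilon>\<^sub>a \<circ> R g\<close>.\<close>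
  define \<epsilon> where "\<epsilon> = (\<lambda>a\<in>Ob A. l (fob G a) a (Idn B (fob G a)))"
  have "nat_trans A C (cfcomp A R G) F \<epsilon>"
  proof (rule nat_transI[OF cfunctor_cfcomp[OF G.cfunctor_axioms R] F.cfunctor_axioms])
    fix a a' f assume *: "a \<in> Ob A" "a' \<in> Ob A" "f \<in> Hom A a a'"
    then show "Comp C (fob (cfcomp A R G) a) (fob (cfcomp A R G) a') (fob F a') (\<epsilon> a')
        (far (cfcomp A R G) a a' f)
      = Comp C (fob (cfcomp A R G) a) (fob F a) (fob F a') (far F a a' f) (\<epsilon> a)"
      using comma_coneD(3)[OF cone[of "fob G a"], of a a' f "Idn B (fob G a)"]
      by (simp add: R_def \<epsilon>_def)
  qed (auto simp: R_def \<epsilon>_def)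
  moreover have "comma_limit b (fob R b)
      (\<lambda>a g. Comp C (fob R b) (fob R (fob G a)) (fob F a) (\<epsilon> a) (far R b (fob G a) g))"
    if "b \<in> Ob B" for b
    using lim[OF that] that
    unfolding comma_limit_def comma_cone_def by (simp add: R_def \<epsilon>_def cong: conj_cong)
  ultimately have "pointwise_extension R \<epsilon>"
    using R by (simp add: pointwise_extension_def)
  then show ?thesis
    by blast
qed

text \<open>The factor at \<open>b\<close> mediates the cone
  \<open>\<alpha>\<^sub>a \<circ> M g\<close>, and its leg at the identity of \<open>G a\<close> is
  the required equation. Conversely, naturality of a factor fixes its composite with every leg,
  whence uniqueness.\<close>

lemma pointwise_right_kan_extension:
  assumes "pointwise_extension R \<epsilon>"
  shows "right_kan_extension A B C G F R \<epsilon>"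
  unfolding right_kan_extension_def
proof (intro conjI allI impI)
  show R: "cfunctor B C R" and \<epsilon>: "nat_trans A C (cfcomp A R G) F \<epsilon>"
    using assms by (simp_all add: pointwise_extension_def)
  interpret R: cfunctor B C R by fact
  note [simp] = counit_in_Hom[OF \<epsilon>]
  have lim: "comma_limit b (fob R b)
      (\<lambda>a g. Comp C (fob R b) (fob R (fob G a)) (fob F a) (\<epsilon> a) (far R b (fob G a) g))"
    if "b \<in> Ob B" for b
    using assms that by (simp add: pointwise_extension_def)
  fix M \<alpha> assume M: "cfunctor B C M" and \<alpha>: "nat_trans A C (cfcomp A M G) F \<alpha>"
  interpret M: cfunctor B C M by fact
  note [simp] = counit_in_Hom[OF \<alpha>]
  have "comma_cone b (fob M b)
      (\<lambda>a g. Comp C (fob M b) (fob M (fob G a)) (fob F a) (\<alpha> a) (far M b (fob G a) g))"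
    if "b \<in> Ob B" for b
    using that by (intro comma_coneI)
      (auto simp: F.cod.Comp_eq_Comp_right[OF counit_naturality[OF \<alpha>]])
  from comma_limitD(2)[OF lim this]
  have "\<forall>b\<in>Ob B. \<exists>h. h \<in> Hom C (fob M b) (fob R b) \<and> (\<forall>a\<in>Ob A. \<forall>g\<in>Hom B b (fob G a).
      Comp C (fob M b) (fob R b) (fob F a)
        (Comp C (fob R b) (fob R (fob G a)) (fob F a) (\<epsilon> a) (far R b (fob G a) g)) h
      = Comp C (fob M b) (fob M (fob G a)) (fob F a) (\<alpha> a) (far M b (fob G a) g))"
    by blast
  then obtain h where h [simp]: "\<And>b. b \<in> Ob B \<Longrightarrow> h b \<in> Hom C (fob M b) (fob R b)"
    and "\<And>b a g. \<lbrakk>b \<in> Ob B; a \<in> Ob A; g \<in> Hom B b (fob G a)\<rbrakk> \<Longrightarrow>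
      Comp C (fob M b) (fob R b) (fob F a)
        (Comp C (fob R b) (fob R (fob G a)) (fob F a) (\<epsilon> a) (far R b (fob G a) g)) (h b)
      = Comp C (fob M b) (fob M (fob G a)) (fob F a) (\<alpha> a) (far M b (fob G a) g)"
    by metis
  then have h_eq: "Comp C (fob M b) (fob R (fob G a)) (fob F a) (\<epsilon> a)
        (Comp C (fob M b) (fob R b) (fob R (fob G a)) (far R b (fob G a) g) (h b))
      = Comp C (fob M b) (fob M (fob G a)) (fob F a) (\<alpha> a) (far M b (fob G a) g)"
    if "b \<in> Ob B" "a \<in> Ob A" "g \<in> Hom B b (fob G a)" for b a g
    using that by simp
  let ?\<beta> = "\<lambda>b\<in>Ob B. h b"
  have \<beta>: "nat_trans B C M R ?\<beta>"
  proof (rule nat_transI[OF M R])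
    fix b b' f assume *: "b \<in> Ob B" "b' \<in> Ob B" "f \<in> Hom B b b'"
    have "Comp C (fob M b) (fob M b') (fob R b') (h b') (far M b b' f)
      = Comp C (fob M b) (fob R b) (fob R b') (far R b b' f) (h b)"
    proof (rule comma_limit_eqI[OF lim])
      fix a g assume **: "a \<in> Ob A" "g \<in> Hom B b' (fob G a)"
      show "Comp C (fob M b) (fob R b') (fob F a)
          (Comp C (fob R b') (fob R (fob G a)) (fob F a) (\<epsilon> a) (far R b' (fob G a) g))
          (Comp C (fob M b) (fob M b') (fob R b') (h b') (far M b b' f))
        = Comp C (fob M b) (fob R b') (fob F a)
          (Comp C (fob R b') (fob R (fob G a)) (fob F a) (\<epsilon> a) (far R b' (fob G a) g))
          (Comp C (fob M b) (fob R b) (fob R b') (far R b b' f) (h b))" (is "?l = ?r")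
      proof -
        have "?l = Comp C (fob M b) (fob M b') (fob F a)
            (Comp C (fob M b') (fob R (fob G a)) (fob F a) (\<epsilon> a)
              (Comp C (fob M b') (fob R b') (fob R (fob G a)) (far R b' (fob G a) g) (h b')))
            (far M b b' f)"
          using * ** by simp
        also have "\<dots> = Comp C (fob M b) (fob M (fob G a)) (fob F a) (\<alpha> a)
            (far M b (fob G a) (Comp B b b' (fob G a) g f))"
          unfolding h_eq[OF *(2) **] using * ** by simp
        also have "\<dots> = Comp C (fob M b) (fob R (fob G a)) (fob F a) (\<epsilon> a)
            (Comp C (fob M b) (fob R b) (fob R (fob G a))
              (far R b (fob G a) (Comp B b b' (fob G a) g f)) (h b))"
          using * ** by (intro h_eq[symmetric]) auto
        also have "\<dots> = ?r"
          using * ** by simp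
        finally show ?thesis .
      qed
    qed (use * in auto)
    then show "Comp C (fob M b) (fob M b') (fob R b') (?\<beta> b') (far M b b' f)
      = Comp C (fob M b) (fob R b) (fob R b') (far R b b' f) (?\<beta> b)"
      using * by simp
  qed auto
  show "\<exists>!\<beta>. nat_trans B C M R \<beta> \<and>
    (\<forall>a\<in>Ob A. Comp C (fob M (fob G a)) (fob R (fob G a)) (fob F a) (\<epsilon> a) (\<beta> (fob G a)) = \<alpha> a)"
  proof (intro ex1I[of _ ?\<beta>] conjI ballI)
    fix a assume a: "a \<in> Ob A"
    then show "Comp C (fob M (fob G a)) (fob R (fob G a)) (fob F a) (\<epsilon> a) (?\<beta> (fob G a)) = \<alpha> a"
      using h_eq[of "fob G a" a "Idn B (fob G a)"] by simp
  next
    fix \<beta>' assume "nat_trans B C M R \<beta>' \<and>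
      (\<forall>a\<in>Ob A. Comp C (fob M (fob G a)) (fob R (fob G a)) (fob F a) (\<epsilon> a) (\<beta>' (fob G a)) = \<alpha> a)"
    then have \<beta>': "nat_trans B C M R \<beta>'" and \<beta>'_eq: "\<And>a. a \<in> Ob A \<Longrightarrow>
        Comp C (fob M (fob G a)) (fob R (fob G a)) (fob F a) (\<epsilon> a) (\<beta>' (fob G a)) = \<alpha> a"
      by auto
    note [simp] = nat_trans.component[OF \<beta>']
    show "\<beta>' = ?\<beta>"
    proof (rule nat_trans_eqI[OF \<beta>' \<beta>])
      fix b assume b: "b \<in> Ob B"
      have "\<beta>' b = h b"
      proof (rule comma_limit_eqI[OF lim])
        fix a g assume **: "a \<in> Ob A" "g \<in> Hom B b (fob G a)"
        show "Comp C (fob M b) (fob R b) (fob F a)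
            (Comp C (fob R b) (fob R (fob G a)) (fob F a) (\<epsilon> a) (far R b (fob G a) g)) (\<beta>' b)
          = Comp C (fob M b) (fob R b) (fob F a)
            (Comp C (fob R b) (fob R (fob G a)) (fob F a) (\<epsilon> a) (far R b (fob G a) g)) (h b)"
          using b ** by (simp add: h_eq nat_trans.naturality[OF \<beta>', symmetric]
            F.cod.Comp_eq_Comp_right[OF \<beta>'_eq])
      qed (use b in auto)
      then show "\<beta>' b = ?\<beta> b"
        using b by simp
    qed
  qed (rule \<beta>)
qed

section \<open>Pointwiseness of arbitrary right Kan extensions\<close>

lemma comma_limit_iso:
  assumes lim: "comma_limit b r l" and b: "b \<in> Ob B"
    and "r' \<in> Ob C" and i: "i \<in> Hom C r' r" and j: "j \<in> Hom C r r'"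
    and ij: "Comp C r r' r i j = Idn C r" and ji: "Comp C r' r r' j i = Idn C r'"
    and l': "\<And>a g. \<lbrakk>a \<in> Ob A; g \<in> Hom B b (fob G a)\<rbrakk> \<Longrightarrow> Comp C r' r (fob F a) (l a g) i = l' a g"
  shows "comma_limit b r' l'"
  unfolding comma_limit_def
proof (intro conjI allI impI)
  note cone = comma_limitD(1)[OF lim]
  note [simp] = comma_coneD(1,2)[OF cone] assms(2-7)
  show "comma_cone b r' l'"
    by (intro comma_coneI) (auto simp: l'[symmetric] comma_coneD(3)[OF cone])
  fix y \<sigma> assume \<sigma>: "comma_cone b y \<sigma>"
  have y [simp]: "y \<in> Ob C"
    by (rule comma_coneD(1)[OF \<sigma>])
  have l'_Comp: "Comp C y r' (fob F a) (l' a g) h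
      = Comp C y r (fob F a) (l a g) (Comp C y r' r i h)"
    if "a \<in> Ob A" "g \<in> Hom B b (fob G a)" "h \<in> Hom C y r'" for a g h
    using that by (simp add: l'[symmetric])
  obtain h where h: "h \<in> Hom C y r"
    and h_eq: "\<And>a g. \<lbrakk>a \<in> Ob A; g \<in> Hom B b (fob G a)\<rbrakk> \<Longrightarrow> Comp C y r (fob F a) (l a g) h = \<sigma> a g"
    using comma_limitD(2)[OF lim \<sigma>] by blast
  show "\<exists>!h. h \<in> Hom C y r' \<and>
      (\<forall>a\<in>Ob A. \<forall>g\<in>Hom B b (fob G a). Comp C y r' (fob F a) (l' a g) h = \<sigma> a g)"
  proof (intro ex1I[of _ "Comp C y r r' j h"] conjI ballI)
    show "Comp C y r r' j h \<in> Hom C y r'"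
      using h by simp
    fix a g assume "a \<in> Ob A" "g \<in> Hom B b (fob G a)"
    then show "Comp C y r' (fob F a) (l' a g) (Comp C y r r' j h) = \<sigma> a g"
      using h by (simp add: l'_Comp h_eq F.cod.Comp_eq_Comp_right[OF ij])
  next
    fix k assume k: "k \<in> Hom C y r' \<and>
      (\<forall>a\<in>Ob A. \<forall>g\<in>Hom B b (fob G a). Comp C y r' (fob F a) (l' a g) k = \<sigma> a g)"
    have "Comp C y r' r i k = h"
      by (rule comma_limit_eqI[OF lim y]) (use k h h_eq l'_Comp in auto)
    then show "k = Comp C y r r' j h"
      using k F.cod.Comp_eq_Comp_right[OF ji, of y k] by auto
  qed
qed

lemma right_kan_extension_endo_eq_id:
  assumes "right_kan_extension A B C G F R \<epsilon>" "nat_trans B C R R \<beta>"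
    and "\<And>a. a \<in> Ob A \<Longrightarrow>
      Comp C (fob R (fob G a)) (fob R (fob G a)) (fob F a) (\<epsilon> a) (\<beta> (fob G a)) = \<epsilon> a"
  shows "\<beta> = nat_id B C R"
proof -
  have R: "cfunctor B C R" and \<epsilon>: "nat_trans A C (cfcomp A R G) F \<epsilon>"
    using assms(1) by (auto simp: right_kan_extension_def)
  interpret R: cfunctor B C R by fact
  have "\<exists>!\<beta>. nat_trans B C R R \<beta> \<and>
    (\<forall>a\<in>Ob A. Comp C (fob R (fob G a)) (fob R (fob G a)) (fob F a) (\<epsilon> a) (\<beta> (fob G a)) = \<epsilon> a)"
    using assms(1) R \<epsilon> unfolding right_kan_extension_def by blast
  moreover have "nat_trans B C R R (nat_id B C R)
      \<and> (\<forall>a\<in>Ob A. Comp C (fob R (fob G a)) (fob R (fob G a))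
      (fob F a) (\<epsilon> a) (nat_id B C R (fob G a)) = \<epsilon> a)"
    using nat_trans_nat_id[OF R] counit_in_Hom[OF \<epsilon>] by auto
  ultimately show ?thesis
    using assms(2,3) by blast
qed

text \<open>The two extensions are isomorphic compatibly with their counits, and limits may be
  transported along the components of the isomorphism. So one pointwise extension makes every
  extension pointwise, also a freely chosen one.\<close>

lemma right_kan_extension_pointwise:
  assumes R': "right_kan_extension A B C G F R' \<epsilon>'" and pw: "pointwise_extension R \<epsilon>"
  shows "pointwise_extension R' \<epsilon>'"
proof -
  note R = pointwise_right_kan_extension[OF pw]
  have R_fun: "cfunctor B C R" and \<epsilon>: "nat_trans A C (cfcomp A R G) F \<epsilon>"
    and R'_fun: "cfunctor B C R'" and \<epsilon>': "nat_trans A C (cfcomp A R' G) F \<epsilon>'"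
    using R R' by (auto simp: right_kan_extension_def)
  interpret R: cfunctor B C R by fact
  interpret R': cfunctor B C R' by fact
  note [simp] = counit_in_Hom[OF \<epsilon>] counit_in_Hom[OF \<epsilon>']
  obtain i where i: "nat_trans B C R' R i" and i_eq: "\<And>a. a \<in> Ob A \<Longrightarrow>
      Comp C (fob R' (fob G a)) (fob R (fob G a)) (fob F a) (\<epsilon> a) (i (fob G a)) = \<epsilon>' a"
    using R R'_fun \<epsilon>' unfolding right_kan_extension_def by blast
  obtain j where j: "nat_trans B C R R' j" and j_eq: "\<And>a. a \<in> Ob A \<Longrightarrow>
      Comp C (fob R (fob G a)) (fob R' (fob G a)) (fob F a) (\<epsilon>' a) (j (fob G a)) = \<epsilon> a"
    using R' R_fun \<epsilon> unfolding right_kan_extension_def by blast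
  note [simp] = nat_trans.component[OF i] nat_trans.component[OF j]
  have ij: "nat_comp B C R R' R i j = nat_id B C R"
    by (rule right_kan_extension_endo_eq_id[OF R nat_trans_nat_comp[OF j i]])
      (simp add: F.cod.Comp_eq_Comp_right[OF i_eq] j_eq)
  have ji: "nat_comp B C R' R R' j i = nat_id B C R'"
    by (rule right_kan_extension_endo_eq_id[OF R' nat_trans_nat_comp[OF i j]])
      (simp add: F.cod.Comp_eq_Comp_right[OF j_eq] i_eq)
  have "comma_limit b (fob R' b)
      (\<lambda>a g. Comp C (fob R' b) (fob R' (fob G a)) (fob F a) (\<epsilon>' a) (far R' b (fob G a) g))"
    if b: "b \<in> Ob B" for b
  proof (rule comma_limit_iso)
    show "comma_limit b (fob R b)
      (\<lambda>a g. Comp C (fob R b) (fob R (fob G a)) (fob F a) (\<epsilon> a) (far R b (fob G a) g))"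
      using pw b by (simp add: pointwise_extension_def)
    show "Comp C (fob R b) (fob R' b) (fob R b) (i b) (j b) = Idn C (fob R b)"
      using fun_cong[OF ij, of b] b by simp
    show "Comp C (fob R' b) (fob R b) (fob R' b) (j b) (i b) = Idn C (fob R' b)"
      using fun_cong[OF ji, of b] b by simp
    fix a g assume "a \<in> Ob A" "g \<in> Hom B b (fob G a)"
    then show "Comp C (fob R' b) (fob R b) (fob F a)
        (Comp C (fob R b) (fob R (fob G a)) (fob F a) (\<epsilon> a) (far R b (fob G a) g)) (i b)
      = Comp C (fob R' b) (fob R' (fob G a)) (fob F a) (\<epsilon>' a) (far R' b (fob G a) g)"
      using b by (simp add: nat_trans.naturality[OF i, symmetric] F.cod.Comp_eq_Comp_right[OF i_eq])
  qed (use b in auto)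
  then show ?thesis
    using R'_fun \<epsilon>' by (simp add: pointwise_extension_def)
qed

text \<open>Joint monicity of the legs, with composites in the right-nested form that simplification
  produces.\<close>

lemma pointwise_extension_eqI:
  assumes "pointwise_extension R \<epsilon>" "b \<in> Ob B" "y \<in> Ob C" "h \<in> Hom C y (fob R b)"
      "k \<in> Hom C y (fob R b)"
    and "\<And>a g. \<lbrakk>a \<in> Ob A; g \<in> Hom B b (fob G a)\<rbrakk> \<Longrightarrow>
      Comp C y (fob R (fob G a)) (fob F a) (\<epsilon> a)
          (Comp C y (fob R b) (fob R (fob G a)) (far R b (fob G a) g) h)
      = Comp C y (fob R (fob G a)) (fob F a) (\<epsilon> a)
          (Comp C y (fob R b) (fob R (fob G a)) (far R b (fob G a) g) k)"
  shows "h = k"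
proof -
  have R: "cfunctor B C R" and \<epsilon>: "nat_trans A C (cfcomp A R G) F \<epsilon>"
    and lim: "comma_limit b (fob R b)
      (\<lambda>a g. Comp C (fob R b) (fob R (fob G a)) (fob F a) (\<epsilon> a) (far R b (fob G a) g))"
    using assms(1,2) by (auto simp: pointwise_extension_def)
  interpret R: cfunctor B C R by fact
  show ?thesis
    by (rule comma_limit_eqI[OF lim]) (use assms(2-) counit_in_Hom[OF \<epsilon>] in auto)
qed

text \<open>For full and faithful \<open>G\<close>, the identity of \<open>G a\<close> is initial
  among the arrows \<open>g : G a \<rightarrow> G a'\<close>, as each \<open>g\<close> is
  \<open>G f\<close> for exactly one \<open>f\<close>. The arrows \<open>F f\<close> therefore form
  a cone with vertex \<open>F a\<close>, and the inverse \<open>d\<close> mediates it.\<close>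

lemma pointwise_extension_counit_iso:
  assumes pw: "pointwise_extension R \<epsilon>"
    and full: "full_functor A B G" and faithful: "faithful_functor A G" and a: "a \<in> Ob A"
  shows "\<exists>d\<in>Hom C (fob F a) (fob R (fob G a)).
    Comp C (fob F a) (fob R (fob G a)) (fob F a) (\<epsilon> a) d = Idn C (fob F a) \<and>
    Comp C (fob R (fob G a)) (fob F a) (fob R (fob G a)) d (\<epsilon> a) = Idn C (fob R (fob G a))"
proof -
  have R: "cfunctor B C R" and \<epsilon>: "nat_trans A C (cfcomp A R G) F \<epsilon>"
    and lim: "comma_limit (fob G a) (fob R (fob G a))
      (\<lambda>a' g. Comp C (fob R (fob G a)) (fob R (fob G a')) (fob F a') (\<epsilon> a')
          (far R (fob G a) (fob G a') g))"
    using pw a by (auto simp: pointwise_extension_def)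
  interpret R: cfunctor B C R by fact
  note [simp] = counit_in_Hom[OF \<epsilon>] a
  define p where "p a' g = (THE f. f \<in> Hom A a a' \<and> far G a a' f = g)" for a' g
  have p_far: "p a' (far G a a' f) = f" if "a' \<in> Ob A" "f \<in> Hom A a a'" for a' f
    unfolding p_def using that faithful a
    by (intro the_equality) (auto simp del: a simp: faithful_functor_def inj_on_def)
  have p: "p a' g \<in> Hom A a a'" "far G a a' (p a' g) = g"
    if "a' \<in> Ob A" "g \<in> Hom B (fob G a) (fob G a')" for a' g
    using full that a p_far unfolding full_functor_def by metis+
  have "comma_cone (fob G a) (fob F a) (\<lambda>a' g. far F a a' (p a' g))"
  proof (rule comma_coneI)
    fix a' a'' f g assume *: "a' \<in> Ob A" "a'' \<in> Ob A" "f \<in> Hom A a' a''"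
        "g \<in> Hom B (fob G a) (fob G a')"
    have "p a'' (Comp B (fob G a) (fob G a') (fob G a'') (far G a' a'' f) g)
        = Comp A a a' a'' f (p a' g)"
      using p_far[of a'' "Comp A a a' a'' f (p a' g)"] * p by simp
    then show "far F a a'' (p a'' (Comp B (fob G a) (fob G a') (fob G a'') (far G a' a'' f) g))
        = Comp C (fob F a) (fob F a') (fob F a'') (far F a' a'' f) (far F a a' (p a' g))"
      using * p by simp
  qed (use p in auto)
  from comma_limitD(2)[OF lim this] obtain d where d: "d \<in> Hom C (fob F a) (fob R (fob G a))"
    and "\<And>a' g. \<lbrakk>a' \<in> Ob A; g \<in> Hom B (fob G a) (fob G a')\<rbrakk> \<Longrightarrow>
      Comp C (fob F a) (fob R (fob G a)) (fob F a')
        (Comp C (fob R (fob G a)) (fob R (fob G a')) (fob F a') (\<epsilon> a')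
            (far R (fob G a) (fob G a') g)) d
      = far F a a' (p a' g)"
    by blast
  then have d_eq: "Comp C (fob F a) (fob R (fob G a')) (fob F a') (\<epsilon> a')
        (Comp C (fob F a) (fob R (fob G a)) (fob R (fob G a')) (far R (fob G a) (fob G a') g) d)
      = far F a a' (p a' g)"
    if "a' \<in> Ob A" "g \<in> Hom B (fob G a) (fob G a')" for a' g
    using that by simp
  note [simp] = d
  have \<epsilon>d: "Comp C (fob F a) (fob R (fob G a)) (fob F a) (\<epsilon> a) d = Idn C (fob F a)"
    using d_eq[of a "Idn B (fob G a)"] p_far[of a "Idn A a"] by simp
  \<comment> \<open>Tested on the leg at \<open>g = G f\<close>: composing it with \<open>d\<close>
    gives \<open>F f\<close>, and \<open>F f \<circ> \<epsilon>\<^sub>a\<close> is the leg itself by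
    naturality of \<epsilon>.\<close>
  have "Comp C (fob R (fob G a)) (fob F a) (fob R (fob G a)) d (\<epsilon> a) = Idn C (fob R (fob G a))"
  proof (rule pointwise_extension_eqI[OF pw])
    fix a' g assume *: "a' \<in> Ob A" "g \<in> Hom B (fob G a) (fob G a')"
    have "Comp C (fob R (fob G a)) (fob R (fob G a')) (fob F a') (\<epsilon> a')
        (Comp C (fob R (fob G a)) (fob R (fob G a)) (fob R (fob G a'))
            (far R (fob G a) (fob G a') g)
          (Comp C (fob R (fob G a)) (fob F a) (fob R (fob G a)) d (\<epsilon> a)))
      = Comp C (fob R (fob G a)) (fob F a) (fob F a')
          (Comp C (fob F a) (fob R (fob G a')) (fob F a') (\<epsilon> a')
            (Comp C (fob F a) (fob R (fob G a)) (fob R (fob G a')) (far R (fob G a) (fob G a') g)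
                d))
          (\<epsilon> a)"
      using * by simp
    also have "\<dots> = Comp C (fob R (fob G a)) (fob F a) (fob F a') (far F a a' (p a' g)) (\<epsilon> a)"
      using d_eq * by simp
    also have "\<dots> = Comp C (fob R (fob G a)) (fob R (fob G a')) (fob F a') (\<epsilon> a')
        (far R (fob G a) (fob G a') g)"
      using counit_naturality[OF \<epsilon> a *(1) p(1)[OF *]] p(2)[OF *] by simp
    finally show "Comp C (fob R (fob G a)) (fob R (fob G a')) (fob F a') (\<epsilon> a')
        (Comp C (fob R (fob G a)) (fob R (fob G a)) (fob R (fob G a'))
            (far R (fob G a) (fob G a') g)
          (Comp C (fob R (fob G a)) (fob F a) (fob R (fob G a)) d (\<epsilon> a)))
      = Comp C (fob R (fob G a)) (fob R (fob G a')) (fob F a') (\<epsilon> a')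
        (Comp C (fob R (fob G a)) (fob R (fob G a)) (fob R (fob G a'))
            (far R (fob G a) (fob G a') g)
          (Idn C (fob R (fob G a))))"
      using * by simp
  qed auto
  with d \<epsilon>d show ?thesis
    by blast
qed

end

section \<open>Pushforward monads\<close>

context monad
begin

lemma unit_in_Hom [simp]: "a \<in> Ob C \<Longrightarrow> munit T a \<in> Hom C a (mob T a)"
  using unit.component by simp

lemma mult_in_Hom [simp]: "a \<in> Ob C \<Longrightarrow> mmult T a \<in> Hom C (mob T (mob T a)) (mob T a)"
  using mult.component by simp

lemma unit_nat: "\<lbrakk>a \<in> Ob C; b \<in> Ob C; f \<in> Hom C a b\<rbrakk> \<Longrightarrow>
    Comp C a (mob T a) (mob T b) (mar T a b f) (munit T a) = Comp C a b (mob T b) (munit T b) f"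
  using unit.naturality by simp

lemma mult_nat: "\<lbrakk>a \<in> Ob C; b \<in> Ob C; f \<in> Hom C a b\<rbrakk> \<Longrightarrow>
    Comp C (mob T (mob T a)) (mob T a) (mob T b) (mar T a b f) (mmult T a)
    = Comp C (mob T (mob T a)) (mob T (mob T b)) (mob T b) (mmult T b)
        (mar T (mob T a) (mob T b) (mar T a b f))"
  using mult.naturality by simp

end

locale pointwise_monad_extension = G: cfunctor A B G + T: monad A T + R: cfunctor B B R
  for A :: "('a, 'm) category" and B :: "('b, 'n) category"
    and G :: "('a, 'm, 'b, 'n) cfunctor" and T :: "('a, 'm) monad"
    and R :: "('b, 'n, 'b, 'n) cfunctor" +
  fixes \<epsilon> :: "'a \<Rightarrow> 'n"
  assumes pointwise: "span.pointwise_extension A B B G (cfcomp A G (mfun T)) R \<epsilon>"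
begin

sublocale span A B B G "cfcomp A G (mfun T)"
  by (intro span.intro G.cfunctor_axioms cfunctor_cfcomp[OF T.unit.tgt.cfunctor_axioms])

lemmas kan = pointwise_right_kan_extension[OF pointwise]

lemma \<epsilon>: "nat_trans A B (cfcomp A R G) (cfcomp A G (mfun T)) \<epsilon>"
  using pointwise by (simp add: pointwise_extension_def)

lemma \<epsilon>_in_Hom [simp]: "a \<in> Ob A \<Longrightarrow> \<epsilon> a \<in> Hom B (fob R (fob G a)) (fob G (mob T a))"
  using counit_in_Hom[OF \<epsilon>] by simp

lemma \<epsilon>_nat: "\<lbrakk>a \<in> Ob A; a' \<in> Ob A; f \<in> Hom A a a'\<rbrakk> \<Longrightarrow>
    Comp B (fob R (fob G a)) (fob R (fob G a')) (fob G (mob T a')) (\<epsilon> a')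
        (far R (fob G a) (fob G a') (far G a a' f))
    = Comp B (fob R (fob G a)) (fob G (mob T a)) (fob G (mob T a'))
        (far G (mob T a) (mob T a') (mar T a a' f)) (\<epsilon> a)"
  using counit_naturality[OF \<epsilon>] by simp

lemma eqI:
  assumes "b \<in> Ob B" "y \<in> Ob B" "h \<in> Hom B y (fob R b)" "k \<in> Hom B y (fob R b)"
    and "\<And>a g. \<lbrakk>a \<in> Ob A; g \<in> Hom B b (fob G a)\<rbrakk> \<Longrightarrow>
      Comp B y (fob R (fob G a)) (fob G (mob T a)) (\<epsilon> a)
          (Comp B y (fob R b) (fob R (fob G a)) (far R b (fob G a) g) h)
      = Comp B y (fob R (fob G a)) (fob G (mob T a)) (\<epsilon> a)
          (Comp B y (fob R b) (fob R (fob G a)) (far R b (fob G a) g) k)"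
  shows "h = k"
  by (rule pointwise_extension_eqI[OF pointwise assms(1-4)]) (use assms in auto)

lemma ex1_factor:
  assumes "cfunctor B B M" "nat_trans A B (cfcomp A M G) (cfcomp A G (mfun T)) \<alpha>"
  shows "\<exists>!\<beta>. nat_trans B B M R \<beta> \<and>
    (\<forall>a\<in>Ob A. Comp B (fob M (fob G a)) (fob R (fob G a)) (fob G (mob T a)) (\<epsilon> a) (\<beta> (fob G a))
        = \<alpha> a)"
  using kan assms unfolding right_kan_extension_def by (simp cong: conj_cong)

text \<open>By \<open>eqI\<close> it suffices to compare after
  \<open>\<epsilon>\<^sub>a \<circ> R g\<close>. Naturality moves the arrow \<open>g\<close> to the
  right, and the hypothesis at \<open>a\<close> applies.\<close>

lemma factor_unique:
  assumes "nat_trans B B M R \<beta>" "nat_trans B B M R \<beta>'"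
    and "\<And>a. a \<in> Ob A \<Longrightarrow> Comp B (fob M (fob G a)) (fob R (fob G a)) (fob G (mob T a)) (\<epsilon> a)
        (\<beta> (fob G a))
      = Comp B (fob M (fob G a)) (fob R (fob G a)) (fob G (mob T a)) (\<epsilon> a) (\<beta>' (fob G a))"
  shows "\<beta> = \<beta>'"
proof (rule nat_trans_eqI[OF assms(1,2)])
  interpret \<beta>: nat_trans B B M R \<beta> by fact
  interpret \<beta>': nat_trans B B M R \<beta>' by fact
  note [simp] = \<beta>.component \<beta>'.component
  fix b assume b: "b \<in> Ob B"
  show "\<beta> b = \<beta>' b"
    by (rule eqI[of b "fob M b"])
      (use b in \<open>auto simp: \<beta>.naturality[symmetric] \<beta>'.naturality[symmetric]
        G.cod.Comp_eq_Comp_right[OF assms(3)]\<close>)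
qed

lemma ex_unit: "\<exists>!\<eta>. nat_trans B B (idf B) R \<eta> \<and>
    (\<forall>a\<in>Ob A. Comp B (fob G a) (fob R (fob G a)) (fob G (mob T a)) (\<epsilon> a) (\<eta> (fob G a))
        = far G a (mob T a) (munit T a))"
proof -
  have "nat_trans A B (cfcomp A (idf B) G) (cfcomp A G (mfun T))
      (\<lambda>a\<in>Ob A. far G a (mob T a) (munit T a))"
    by (rule nat_transI[OF cfunctor_cfcomp[OF G.cfunctor_axioms cfunctor_idf] F.cfunctor_axioms])
      (auto simp: G.cod.category_axioms G.far_eq[OF T.unit_nat])
  from ex1_factor[OF cfunctor_idf[OF G.cod.category_axioms] this] show ?thesis
    by simp
qed

lemma ex_mult: "\<exists>!\<mu>. nat_trans B B (cfcomp B R R) R \<mu> \<and>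
    (\<forall>a\<in>Ob A. Comp B (fob R (fob R (fob G a))) (fob R (fob G a)) (fob G (mob T a)) (\<epsilon> a)
        (\<mu> (fob G a))
      = Comp B (fob R (fob R (fob G a))) (fob G (mob T (mob T a))) (fob G (mob T a))
          (far G (mob T (mob T a)) (mob T a) (mmult T a))
          (Comp B (fob R (fob R (fob G a))) (fob R (fob G (mob T a))) (fob G (mob T (mob T a)))
          (\<epsilon> (mob T a)) (far R (fob R (fob G a)) (fob G (mob T a)) (\<epsilon> a))))"
proof -
  have RR: "cfunctor B B (cfcomp B R R)"
    by (rule cfunctor_cfcomp) (rule R.cfunctor_axioms)+
  note rules = R.far_eq[OF \<epsilon>_nat] \<epsilon>_nat G.cod.Comp_eq_Comp_right[OF \<epsilon>_nat]
    G.far_eq[OF T.mult_nat] G.cod.Comp_eq_Comp_right[OF G.far_eq[OF T.mult_nat]]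
  have "nat_trans A B (cfcomp A (cfcomp B R R) G) (cfcomp A G (mfun T))
    (\<lambda>a\<in>Ob A. Comp B (fob R (fob R (fob G a))) (fob G (mob T (mob T a))) (fob G (mob T a))
        (far G (mob T (mob T a)) (mob T a) (mmult T a))
        (Comp B (fob R (fob R (fob G a))) (fob R (fob G (mob T a))) (fob G (mob T (mob T a)))
        (\<epsilon> (mob T a)) (far R (fob R (fob G a)) (fob G (mob T a)) (\<epsilon> a))))"
    by (rule nat_transI[OF cfunctor_cfcomp[OF G.cfunctor_axioms RR] F.cfunctor_axioms])
      (auto simp: rules)
  from ex1_factor[OF RR this] show ?thesis
    by simp
qed

text \<open>The two compatibility equations already force unit and multiplication through
  \<open>factor_unique\<close>; the content is that the forced cells satisfy the monad laws.\<close>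

lemma ex1_pushforward: "\<exists>!P. mfun P = R \<and> is_pushforward A B G T P \<epsilon>"
proof -
  obtain \<eta> where \<eta>: "nat_trans B B (idf B) R \<eta>"
    and \<epsilon>_\<eta>: "\<And>a. a \<in> Ob A \<Longrightarrow>
      Comp B (fob G a) (fob R (fob G a)) (fob G (mob T a)) (\<epsilon> a) (\<eta> (fob G a))
          = far G a (mob T a) (munit T a)"
    using ex_unit by blast
  obtain \<mu> where \<mu>: "nat_trans B B (cfcomp B R R) R \<mu>"
    and \<epsilon>_\<mu>: "\<And>a. a \<in> Ob A \<Longrightarrow> Comp B (fob R (fob R (fob G a))) (fob R (fob G a)) (fob G (mob T a))
        (\<epsilon> a) (\<mu> (fob G a))
      = Comp B (fob R (fob R (fob G a))) (fob G (mob T (mob T a))) (fob G (mob T a))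
          (far G (mob T (mob T a)) (mob T a) (mmult T a))
          (Comp B (fob R (fob R (fob G a))) (fob R (fob G (mob T a))) (fob G (mob T (mob T a)))
          (\<epsilon> (mob T a)) (far R (fob R (fob G a)) (fob G (mob T a)) (\<epsilon> a)))"
    using ex_mult by blast
  interpret \<eta>: nat_trans B B "idf B" R \<eta> by fact
  interpret \<mu>: nat_trans B B "cfcomp B R R" R \<mu> by fact
  have [simp]: "\<eta> b \<in> Hom B b (fob R b)" "\<mu> b \<in> Hom B (fob R (fob R b)) (fob R b)" if "b \<in> Ob B" for
      b
    using \<eta>.component[OF that] \<mu>.component[OF that] that by simp_all
  have \<eta>_nat: "Comp B b (fob R b) (fob R b') (far R b b' f) (\<eta> b) = Comp B b b' (fob R b') (\<eta> b') f"
    and \<mu>_nat: "Comp B (fob R (fob R b)) (fob R b) (fob R b') (far R b b' f) (\<mu> b)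
      = Comp B (fob R (fob R b)) (fob R (fob R b')) (fob R b') (\<mu> b')
          (far R (fob R b) (fob R b') (far R b b' f))"
    if "b \<in> Ob B" "b' \<in> Ob B" "f \<in> Hom B b b'" for b b' f
    using \<eta>.naturality[OF that] \<mu>.naturality[OF that] that by simp_all
  note base = \<eta>_nat \<mu>_nat \<epsilon>_\<eta> \<epsilon>_\<mu> \<epsilon>_nat
  note rules = base G.cod.Comp_eq_Comp_right[OF \<eta>_nat] G.cod.Comp_eq_Comp_right[OF \<mu>_nat]
    G.cod.Comp_eq_Comp_right[OF \<epsilon>_\<eta>] G.cod.Comp_eq_Comp_right[OF \<epsilon>_\<mu>]
        G.cod.Comp_eq_Comp_right[OF \<epsilon>_nat]
  \<comment> \<open>The laws for \<open>R\<close> contain the images under \<open>R\<close> of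
    \<eta> and \<mu>, so the equations for these cells are needed under \<open>R\<close>;
    \<open>laws\<close> are the laws of \<open>T\<close> under \<open>G\<close>.\<close>
  note images = R.far_eq[OF \<eta>_nat] R.far_eq[OF \<mu>_nat] R.far_eq[OF \<epsilon>_\<eta>] R.far_eq[OF \<epsilon>_\<mu>]
  note images_right = G.cod.Comp_eq_Comp_right[OF images(1)] G.cod.Comp_eq_Comp_right[OF images(2)]
    G.cod.Comp_eq_Comp_right[OF images(3)] G.cod.Comp_eq_Comp_right[OF images(4)]
  note laws = G.far_eq[OF T.unit_left] G.far_eq[OF T.unit_right] G.far_eq[OF T.mult_assoc]
  note laws_right = G.cod.Comp_eq_Comp_right[OF laws(1)] G.cod.Comp_eq_Comp_right[OF laws(2)]
    G.cod.Comp_eq_Comp_right[OF laws(3)]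
  let ?P = "\<lparr>mfun = R, munit = \<eta>, mmult = \<mu>\<rparr>"
  have "monad_axioms B ?P"
    \<comment> \<open>By \<open>eqI\<close> a law may be tested after \<open>\<epsilon>\<^sub>a \<circ> R g\<close>. Naturality moves \<open>R g\<close> to the
      right, and what remains is the image under \<open>G\<close> of the same law of \<open>T\<close>.\<close>
  proof
    fix b assume b: "b \<in> Ob B"
    have "Comp B (fob R b) (fob R (fob R b)) (fob R b) (\<mu> b) (\<eta> (fob R b)) = Idn B (fob R b)"
      by (rule eqI[of b "fob R b"])
          (use b in \<open>auto simp: rules images images_right laws laws_right\<close>)
    then show "Comp B (mob ?P b) (mob ?P (mob ?P b)) (mob ?P b) (mmult ?P b) (munit ?P (mob ?P b))
      = Idn B (mob ?P b)"
      by simp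
    have "Comp B (fob R b) (fob R (fob R b)) (fob R b) (\<mu> b) (far R b (fob R b) (\<eta> b))
        = Idn B (fob R b)"
      by (rule eqI[of b "fob R b"])
          (use b in \<open>auto simp: rules images images_right laws laws_right\<close>)
    then show "Comp B (mob ?P b) (mob ?P (mob ?P b)) (mob ?P b) (mmult ?P b)
        (mar ?P b (mob ?P b) (munit ?P b))
      = Idn B (mob ?P b)"
      by simp
    have "Comp B (fob R (fob R (fob R b))) (fob R (fob R b)) (fob R b) (\<mu> b) (\<mu> (fob R b))
      = Comp B (fob R (fob R (fob R b))) (fob R (fob R b)) (fob R b) (\<mu> b)
          (far R (fob R (fob R b)) (fob R b) (\<mu> b))"
      by (rule eqI[of b "(fob R (fob R (fob R b)))"])
          (use b in \<open>auto simp: rules images images_right laws laws_right\<close>)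
    then show "Comp B (mob ?P (mob ?P (mob ?P b))) (mob ?P (mob ?P b)) (mob ?P b) (mmult ?P b)
        (mmult ?P (mob ?P b))
      = Comp B (mob ?P (mob ?P (mob ?P b))) (mob ?P (mob ?P b)) (mob ?P b) (mmult ?P b)
          (mar ?P (mob ?P (mob ?P b)) (mob ?P b) (mmult ?P b))"
      by simp
  qed
  then have P: "monad B ?P"
    using \<eta> \<mu> by (simp add: monad_def)
  show ?thesis
  proof (intro ex1I[of _ ?P] conjI)
    show "is_pushforward A B G T ?P \<epsilon>"
      using kan P by (simp add: is_pushforward_def \<epsilon>_\<eta> \<epsilon>_\<mu>)
    fix P' assume P': "mfun P' = R \<and> is_pushforward A B G T P' \<epsilon>"
    then interpret P': monad B P'
      by (simp add: is_pushforward_def)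
    have "munit P' = \<eta>"
      by (rule factor_unique) (use P' \<eta> \<epsilon>_\<eta> P'.unit.nat_trans_axioms in \<open>auto simp:
          is_pushforward_def\<close>)
    moreover have "mmult P' = \<mu>"
      by (rule factor_unique) (use P' \<mu> \<epsilon>_\<mu> P'.mult.nat_trans_axioms in \<open>auto simp:
          is_pushforward_def\<close>)
    ultimately show "P' = ?P"
      using P' by simp
  qed simp
qed

end

section \<open>Lifts along full and faithful functors\<close>

locale ff_functor = cfunctor A B G
  for A :: "('a, 'm) category" and B :: "('b, 'n) category" and G :: "('a, 'm, 'b, 'n) cfunctor" +
  assumes full: "full_functor A B G" and faithful: "faithful_functor A G"
begin

lemma far_eq_imp_eq:
  assumes "far G a b f = far G a b f'" "a \<in> Ob A" "b \<in> Ob A" "f \<in> Hom A a b" "f' \<in> Hom A a b"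
  shows "f = f'"
  using faithful assms by (auto simp: faithful_functor_def inj_on_def)

definition G_inv :: "'a \<Rightarrow> 'a \<Rightarrow> 'n \<Rightarrow> 'm" where
  "G_inv a b g = (THE f. f \<in> Hom A a b \<and> far G a b f = g)"

lemma G_inv [simp]:
  assumes "a \<in> Ob A" "b \<in> Ob A" "g \<in> Hom B (fob G a) (fob G b)"
  shows "G_inv a b g \<in> Hom A a b" "far G a b (G_inv a b g) = g"
proof -
  have "\<exists>!f. f \<in> Hom A a b \<and> far G a b f = g"
    using full assms far_eq_imp_eq[OF _ assms(1,2)] unfolding full_functor_def by blast
  from theI'[OF this] show "G_inv a b g \<in> Hom A a b" "far G a b (G_inv a b g) = g"
    by (simp_all add: G_inv_def)
qed

text \<open>A transformation \<open>G M \<rightarrow> H\<close> is the same as one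
  \<open>G M \<rightarrow> G K\<close> by composing with the inverse \<open>l\<close>, and full
  faithfulness strips off \<open>G\<close>. Naturality of \<open>l\<close> comes from that of
  \<kappa> by \<open>inverse_square\<close>.\<close>

lemma iso_right_kan_lift:
  assumes K: "cfunctor C A K" and H: "cfunctor C B H" and \<kappa>: "nat_trans C B (cfcomp C G K) H \<kappa>"
    and l: "\<And>c. c \<in> Ob C \<Longrightarrow> l c \<in> Hom B (fob H c) (fob G (fob K c))"
    and \<kappa>l: "\<And>c. c \<in> Ob C \<Longrightarrow> Comp B (fob H c) (fob G (fob K c)) (fob H c) (\<kappa> c) (l c)
        = Idn B (fob H c)"
    and l\<kappa>: "\<And>c. c \<in> Ob C \<Longrightarrow> Comp B (fob G (fob K c)) (fob H c) (fob G (fob K c)) (l c) (\<kappa> c)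
        = Idn B (fob G (fob K c))"
  shows "right_kan_lift C A B G H K \<kappa>"
  unfolding right_kan_lift_def
proof (intro conjI allI impI)
  interpret K: cfunctor C A K by fact
  interpret H: cfunctor C B H by fact
  have \<kappa>_in [simp]: "\<kappa> c \<in> Hom B (fob G (fob K c)) (fob H c)" if "c \<in> Ob C" for c
    using nat_trans.component[OF \<kappa> that] that by simp
  have \<kappa>_nat: "Comp B (fob G (fob K c)) (fob G (fob K c')) (fob H c') (\<kappa> c')
      (far G (fob K c) (fob K c') (far K c c' f))
    = Comp B (fob G (fob K c)) (fob H c) (fob H c') (far H c c' f) (\<kappa> c)"
    if "c \<in> Ob C" "c' \<in> Ob C" "f \<in> Hom C c c'" for c c' f
    using nat_trans.naturality[OF \<kappa> that] that by simp
  note [simp] = l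
  fix M \<alpha> assume M: "cfunctor C A M" and \<alpha>: "nat_trans C B (cfcomp C G M) H \<alpha>"
  interpret M: cfunctor C A M by fact
  have [simp]: "\<alpha> c \<in> Hom B (fob G (fob M c)) (fob H c)" if "c \<in> Ob C" for c
    using nat_trans.component[OF \<alpha> that] that by simp
  have \<alpha>_nat: "Comp B (fob G (fob M c)) (fob G (fob M c')) (fob H c') (\<alpha> c')
      (far G (fob M c) (fob M c') (far M c c' f))
    = Comp B (fob G (fob M c)) (fob H c) (fob H c') (far H c c' f) (\<alpha> c)"
    if "c \<in> Ob C" "c' \<in> Ob C" "f \<in> Hom C c c'" for c c' f
    using nat_trans.naturality[OF \<alpha> that] that by simp
  have l_nat: "Comp B (fob H c) (fob H c') (fob G (fob K c')) (l c') (far H c c' f)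
    = Comp B (fob H c) (fob G (fob K c)) (fob G (fob K c'))
        (far G (fob K c) (fob K c') (far K c c' f)) (l c)"
    if "c \<in> Ob C" "c' \<in> Ob C" "f \<in> Hom C c c'" for c c' f
    by (rule cod.inverse_square[OF _ _ _ _ \<kappa>_in l \<kappa>_in l \<kappa>l l\<kappa>])
      (use that in \<open>auto simp: \<kappa>_nat\<close>)
  let ?\<beta> = "\<lambda>c\<in>Ob C. G_inv (fob M c) (fob K c)
      (Comp B (fob G (fob M c)) (fob H c) (fob G (fob K c)) (l c) (\<alpha> c))"
  have \<beta>: "nat_trans C A M K ?\<beta>"
  proof (rule nat_transI[OF M K])
    fix c c' f assume *: "c \<in> Ob C" "c' \<in> Ob C" "f \<in> Hom C c c'"
    show "Comp A (fob M c) (fob M c') (fob K c') (?\<beta> c') (far M c c' f)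
      = Comp A (fob M c) (fob K c) (fob K c') (far K c c' f) (?\<beta> c)"
      by (rule far_eq_imp_eq[where a = "fob M c" and b = "fob K c'"])
        (use * in \<open>auto simp: \<alpha>_nat l_nat cod.Comp_eq_Comp_right[OF l_nat]\<close>)
  qed auto
  show "\<exists>!\<beta>. nat_trans C A M K \<beta> \<and> (\<forall>c\<in>Ob C.
    Comp B (fob G (fob M c)) (fob G (fob K c)) (fob H c) (\<kappa> c) (far G (fob M c) (fob K c) (\<beta> c))
        = \<alpha> c)"
  proof (intro ex1I[of _ ?\<beta>] conjI ballI)
    fix c assume "c \<in> Ob C"
    then show "Comp B (fob G (fob M c)) (fob G (fob K c)) (fob H c) (\<kappa> c)
        (far G (fob M c) (fob K c) (?\<beta> c)) = \<alpha> c"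
      by (simp add: cod.Comp_eq_Comp_right[OF \<kappa>l])
  next
    fix \<beta>' assume *: "nat_trans C A M K \<beta>' \<and> (\<forall>c\<in>Ob C.
      Comp B (fob G (fob M c)) (fob G (fob K c)) (fob H c) (\<kappa> c) (far G (fob M c) (fob K c) (\<beta>' c))
          = \<alpha> c)"
    show "\<beta>' = ?\<beta>"
    proof (rule nat_trans_eqI[OF conjunct1[OF *] \<beta>])
      fix c assume c: "c \<in> Ob C"
      have [simp]: "\<beta>' c \<in> Hom A (fob M c) (fob K c)"
        using * nat_trans.component c by fastforce
      have eq: "\<alpha> c = Comp B (fob G (fob M c)) (fob G (fob K c)) (fob H c) (\<kappa> c)
          (far G (fob M c) (fob K c) (\<beta>' c))"
        using * c by simp
      show "\<beta>' c = ?\<beta> c"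
        by (rule far_eq_imp_eq[where a = "fob M c" and b = "fob K c"])
          (use c in \<open>auto simp: eq cod.Comp_eq_Comp_right[OF l\<kappa>]\<close>)
    qed
  qed (rule \<beta>)
qed fact+

lemma right_kan_lift_endo_eq_id:
  assumes lift: "right_kan_lift C A B G H K \<kappa>" and \<beta>: "nat_trans C A K K \<beta>"
    and eq: "\<And>c. c \<in> Ob C \<Longrightarrow> Comp B (fob G (fob K c)) (fob G (fob K c)) (fob H c) (\<kappa> c)
        (far G (fob K c) (fob K c) (\<beta> c)) = \<kappa> c"
  shows "\<beta> = nat_id C A K"
proof -
  have K: "cfunctor C A K" and \<kappa>: "nat_trans C B (cfcomp C G K) H \<kappa>"
    using lift by (auto simp: right_kan_lift_def)
  interpret K: cfunctor C A K by fact
  interpret \<kappa>: nat_trans C B "cfcomp C G K" H \<kappa> by fact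
  have "\<exists>!\<beta>. nat_trans C A K K \<beta> \<and>
    (\<forall>c\<in>Ob C. Comp B (fob G (fob K c)) (fob G (fob K c)) (fob H c) (\<kappa> c)
        (far G (fob K c) (fob K c) (\<beta> c)) = \<kappa> c)"
    using lift K \<kappa> unfolding right_kan_lift_def by blast
  moreover have "nat_trans C A K K (nat_id C A K) \<and> (\<forall>c\<in>Ob C.
    Comp B (fob G (fob K c)) (fob G (fob K c)) (fob H c) (\<kappa> c)
        (far G (fob K c) (fob K c) (nat_id C A K c)) = \<kappa> c)"
    using nat_trans_nat_id[OF K] \<kappa>.component by auto
  ultimately show ?thesis
    using \<beta> eq by blast
qed

text \<open>\<kappa> is \<open>\<sigma> \<circ> G i\<close> and \<sigma> is
  \<open>\<kappa> \<circ> G j\<close> for the comparisons \<open>i\<close> and \<open>j\<close>, so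
  \<open>G j \<circ> \<rho>\<close> inverts \<kappa> as soon as \<open>j \<circ> i\<close> is the
  identity.\<close>

lemma right_kan_lift_iso:
  assumes lift: "right_kan_lift C A B G H K \<kappa>" and lift': "right_kan_lift C A B G H S' \<sigma>"
    and H: "cfunctor C B H"
    and \<rho>: "\<And>c. c \<in> Ob C \<Longrightarrow> \<rho> c \<in> Hom B (fob H c) (fob G (fob S' c))"
    and \<sigma>\<rho>: "\<And>c. c \<in> Ob C \<Longrightarrow> Comp B (fob H c) (fob G (fob S' c)) (fob H c) (\<sigma> c) (\<rho> c)
        = Idn B (fob H c)"
    and \<rho>\<sigma>: "\<And>c. c \<in> Ob C \<Longrightarrow> Comp B (fob G (fob S' c)) (fob H c) (fob G (fob S' c)) (\<rho> c) (\<sigma> c)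
        = Idn B (fob G (fob S' c))"
    and c: "c \<in> Ob C"
  shows "\<exists>d\<in>Hom B (fob H c) (fob G (fob K c)).
    Comp B (fob H c) (fob G (fob K c)) (fob H c) (\<kappa> c) d = Idn B (fob H c) \<and>
    Comp B (fob G (fob K c)) (fob H c) (fob G (fob K c)) d (\<kappa> c) = Idn B (fob G (fob K c))"
proof -
  have K: "cfunctor C A K" and \<kappa>: "nat_trans C B (cfcomp C G K) H \<kappa>"
    and S': "cfunctor C A S'" and \<sigma>: "nat_trans C B (cfcomp C G S') H \<sigma>"
    using lift lift' by (auto simp: right_kan_lift_def)
  interpret K: cfunctor C A K by fact
  interpret S': cfunctor C A S' by fact
  interpret H: cfunctor C B H by fact
  have [simp]: "\<kappa> c \<in> Hom B (fob G (fob K c)) (fob H c)" "\<sigma> c \<in> Hom B (fob G (fob S' c)) (fob H c)"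
    if "c \<in> Ob C" for c
    using nat_trans.component[OF \<kappa> that] nat_trans.component[OF \<sigma> that] that by simp_all
  obtain i where i: "nat_trans C A K S' i" and \<sigma>_i: "\<And>c. c \<in> Ob C \<Longrightarrow>
      Comp B (fob G (fob K c)) (fob G (fob S' c)) (fob H c) (\<sigma> c) (far G (fob K c) (fob S' c) (i c))
          = \<kappa> c"
    using lift' K \<kappa> unfolding right_kan_lift_def by blast
  obtain j where j: "nat_trans C A S' K j" and \<kappa>_j: "\<And>c. c \<in> Ob C \<Longrightarrow>
      Comp B (fob G (fob S' c)) (fob G (fob K c)) (fob H c) (\<kappa> c) (far G (fob S' c) (fob K c) (j c))
          = \<sigma> c"
    using lift S' \<sigma> unfolding right_kan_lift_def by blast
  note [simp] = nat_trans.component[OF i] nat_trans.component[OF j] \<rho>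
  have ji: "nat_comp C A K S' K j i = nat_id C A K"
    by (rule right_kan_lift_endo_eq_id[OF lift nat_trans_nat_comp[OF i j]])
      (simp add: \<sigma>_i cod.Comp_eq_Comp_right[OF \<kappa>_j])
  have G_ji: "Comp B (fob G (fob K c)) (fob G (fob S' c)) (fob G (fob K c))
      (far G (fob S' c) (fob K c) (j c)) (far G (fob K c) (fob S' c) (i c))
      = Idn B (fob G (fob K c))"
    using fun_cong[OF ji, of c] far_eq[of "fob K c" "fob S' c" "fob K c" "j c" "i c"] c by simp
  let ?d = "Comp B (fob H c) (fob G (fob S' c)) (fob G (fob K c)) (far G (fob S' c) (fob K c) (j c))
      (\<rho> c)"
  have "Comp B (fob H c) (fob G (fob K c)) (fob H c) (\<kappa> c) ?d = Idn B (fob H c)"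
    using c by (simp add: \<sigma>\<rho> cod.Comp_eq_Comp_right[OF \<kappa>_j])
  moreover have "Comp B (fob G (fob K c)) (fob H c) (fob G (fob K c)) ?d (\<kappa> c)
      = Idn B (fob G (fob K c))"
    using c G_ji by (simp add: \<sigma>_i[symmetric] cod.Comp_eq_Comp_right[OF \<rho>\<sigma>])
  moreover have "?d \<in> Hom B (fob H c) (fob G (fob K c))"
    using c by simp
  ultimately show ?thesis
    by blast
qed

end

section \<open>Monad lifts\<close>

text \<open>The inverse \<open>l\<close> is a bare family of arrows, so that it can be chosen object
  by object; its naturality is \<open>l_nat\<close>.\<close>

locale iso_lift = ff_functor A B G + S: monad B S + K: cfunctor A A K
  for A :: "('a, 'm) category" and B :: "('b, 'n) category"
    and G :: "('a, 'm, 'b, 'n) cfunctor" and S :: "('b, 'n) monad"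
    and K :: "('a, 'm, 'a, 'm) cfunctor" +
  fixes \<kappa> l :: "'a \<Rightarrow> 'n"
  assumes \<kappa>: "nat_trans A B (cfcomp A G K) (cfcomp A (mfun S) G) \<kappa>"
    and l_in_Hom [simp]: "a \<in> Ob A \<Longrightarrow> l a \<in> Hom B (mob S (fob G a)) (fob G (fob K a))"
    and \<kappa>_l: "a \<in> Ob A \<Longrightarrow> Comp B (mob S (fob G a)) (fob G (fob K a)) (mob S (fob G a)) (\<kappa> a) (l a)
        = Idn B (mob S (fob G a))"
    and l_\<kappa>: "a \<in> Ob A \<Longrightarrow> Comp B (fob G (fob K a)) (mob S (fob G a)) (fob G (fob K a)) (l a) (\<kappa> a)
        = Idn B (fob G (fob K a))"
begin

lemma \<kappa>_in_Hom [simp]: "a \<in> Ob A \<Longrightarrow> \<kappa> a \<in> Hom B (fob G (fob K a)) (mob S (fob G a))"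
  using nat_trans.component[OF \<kappa>] by simp

lemma \<kappa>_nat: "\<lbrakk>a \<in> Ob A; b \<in> Ob A; f \<in> Hom A a b\<rbrakk> \<Longrightarrow>
    Comp B (fob G (fob K a)) (fob G (fob K b)) (mob S (fob G b)) (\<kappa> b)
        (far G (fob K a) (fob K b) (far K a b f))
    = Comp B (fob G (fob K a)) (mob S (fob G a)) (mob S (fob G b))
        (mar S (fob G a) (fob G b) (far G a b f)) (\<kappa> a)"
  using nat_trans.naturality[OF \<kappa>] by simp

lemma l_nat: "\<lbrakk>a \<in> Ob A; b \<in> Ob A; f \<in> Hom A a b\<rbrakk> \<Longrightarrow>
    Comp B (mob S (fob G a)) (fob G (fob K a)) (fob G (fob K b))
        (far G (fob K a) (fob K b) (far K a b f)) (l a)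
    = Comp B (mob S (fob G a)) (mob S (fob G b)) (fob G (fob K b)) (l b)
        (mar S (fob G a) (fob G b) (far G a b f))"
  by (rule cod.inverse_square[symmetric, OF _ _ _ _ \<kappa>_in_Hom l_in_Hom \<kappa>_in_Hom l_in_Hom \<kappa>_l l_\<kappa>])
    (auto simp: \<kappa>_nat)

text \<open>\<open>l\<close> cancels \<kappa> on the left, and \<open>G\<close> is faithful.\<close>

lemma eq_of_\<kappa>:
  assumes "a \<in> Ob A" "b \<in> Ob A" "u \<in> Hom A b (fob K a)" "v \<in> Hom A b (fob K a)"
    and "Comp B (fob G b) (fob G (fob K a)) (mob S (fob G a)) (\<kappa> a) (far G b (fob K a) u)
      = Comp B (fob G b) (fob G (fob K a)) (mob S (fob G a)) (\<kappa> a) (far G b (fob K a) v)"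
  shows "u = v"
proof (rule far_eq_imp_eq)
  show "far G b (fob K a) u = far G b (fob K a) v"
    using arg_cong[OF assms(5), of
        "\<lambda>h. Comp B (fob G b) (mob S (fob G a)) (fob G (fob K a)) (l a) h"] assms(1-4)
    by (simp add: cod.Comp_eq_Comp_right[OF l_\<kappa>])
qed (use assms in auto)

text \<open>The structure of \<open>S\<close> is transported along \<kappa>. Each law is checked
  after \<open>G\<close>, where inserting the inverse pairs \<kappa>, \<open>l\<close> reduces it to
  the same law of \<open>S\<close> at an object \<open>G a\<close>.\<close>

lemma ex1_monad_lift:
  assumes lift: "right_kan_lift A A B G (cfcomp A (mfun S) G) K \<kappa>"
  shows "\<exists>!L. mfun L = K \<and> is_monad_lift A B G S L \<kappa>"
proof -
  \<comment> \<open>Both cells are the defining equations of the lift solved for the unknown: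
    compose with \<open>l\<close> to remove \<kappa>, then take the preimage under
    \<open>G\<close>.\<close>
  define \<eta> where "\<eta> = (\<lambda>a\<in>Ob A. G_inv a (fob K a)
      (Comp B (fob G a) (mob S (fob G a)) (fob G (fob K a)) (l a) (munit S (fob G a))))"
  define \<mu> where "\<mu> = (\<lambda>a\<in>Ob A. G_inv (fob K (fob K a)) (fob K a)
      (Comp B (fob G (fob K (fob K a))) (mob S (fob G a)) (fob G (fob K a)) (l a)
      (Comp B (fob G (fob K (fob K a))) (mob S (mob S (fob G a))) (mob S (fob G a))
      (mmult S (fob G a))
      (Comp B (fob G (fob K (fob K a))) (mob S (fob G (fob K a))) (mob S (mob S (fob G a)))
      (mar S (fob G (fob K a)) (mob S (fob G a)) (\<kappa> a)) (\<kappa> (fob K a))))))"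
  have \<eta>_in [simp]: "\<eta> a \<in> Hom A a (fob K a)"
    and G_\<eta>: "far G a (fob K a) (\<eta> a)
        = Comp B (fob G a) (mob S (fob G a)) (fob G (fob K a)) (l a) (munit S (fob G a))"
    and \<mu>_in [simp]: "\<mu> a \<in> Hom A (fob K (fob K a)) (fob K a)"
    and G_\<mu>: "far G (fob K (fob K a)) (fob K a) (\<mu> a)
        = Comp B (fob G (fob K (fob K a))) (mob S (fob G a)) (fob G (fob K a)) (l a)
        (Comp B (fob G (fob K (fob K a))) (mob S (mob S (fob G a))) (mob S (fob G a))
        (mmult S (fob G a))
        (Comp B (fob G (fob K (fob K a))) (mob S (fob G (fob K a))) (mob S (mob S (fob G a)))
        (mar S (fob G (fob K a)) (mob S (fob G a)) (\<kappa> a)) (\<kappa> (fob K a))))"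
    if "a \<in> Ob A" for a
    using that by (simp_all add: \<eta>_def \<mu>_def)
  note right = cod.Comp_eq_Comp_right
  note rules = G_\<eta> G_\<mu> \<kappa>_l l_\<kappa> \<kappa>_nat l_nat S.unit_nat S.mult_nat S.unit_left S.unit_right
      S.mult_assoc
  note right_rules = right[OF \<kappa>_l] right[OF l_\<kappa>] right[OF \<kappa>_nat] right[OF l_nat]
      right[OF S.unit_nat]
    right[OF S.mult_nat] right[OF S.unit_left] right[OF S.unit_right] right[OF S.mult_assoc]
  note images = S.unit.tgt.far_eq[OF \<kappa>_l] S.unit.tgt.far_eq[OF \<kappa>_nat]
      S.unit.tgt.far_eq[OF S.unit_nat]
  note right_images = right[OF images(1)] right[OF images(2)] right[OF images(3)]
  note all_rules = rules right_rules images right_images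
  let ?L = "\<lparr>mfun = K, munit = \<eta>, mmult = \<mu>\<rparr>"
  have "nat_trans A A (idf A) K \<eta>"
  proof (rule nat_transI[OF cfunctor_idf[OF dom.category_axioms] K.cfunctor_axioms])
    fix a b f assume *: "a \<in> Ob A" "b \<in> Ob A" "f \<in> Hom A a b"
    have "Comp A a b (fob K b) (\<eta> b) f = Comp A a (fob K a) (fob K b) (far K a b f) (\<eta> a)"
      by (rule far_eq_imp_eq[where a = a and b = "fob K b"]) (use * in \<open>auto simp: all_rules\<close>)
    then show "Comp A (fob (idf A) a) (fob (idf A) b) (fob K b) (\<eta> b) (far (idf A) a b f)
      = Comp A (fob (idf A) a) (fob K a) (fob K b) (far K a b f) (\<eta> a)"
      using * by simp
  qed (auto simp: \<eta>_def)
  moreover have "nat_trans A A (cfcomp A K K) K \<mu>"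
  proof (rule nat_transI[OF cfunctor_cfcomp[OF K.cfunctor_axioms K.cfunctor_axioms]
      K.cfunctor_axioms])
    fix a b f assume *: "a \<in> Ob A" "b \<in> Ob A" "f \<in> Hom A a b"
    have "Comp A (fob K (fob K a)) (fob K (fob K b)) (fob K b) (\<mu> b)
        (far K (fob K a) (fob K b) (far K a b f))
      = Comp A (fob K (fob K a)) (fob K a) (fob K b) (far K a b f) (\<mu> a)"
      by (rule far_eq_imp_eq[where a = "fob K (fob K a)" and b = "fob K b"])
          (use * in \<open>auto simp: all_rules\<close>)
    then show "Comp A (fob (cfcomp A K K) a) (fob (cfcomp A K K) b) (fob K b) (\<mu> b)
        (far (cfcomp A K K) a b f)
      = Comp A (fob (cfcomp A K K) a) (fob K a) (fob K b) (far K a b f) (\<mu> a)"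
      using * by simp
  qed (auto simp: \<mu>_def)
  moreover have "monad_axioms A ?L"
  proof
    fix a assume a: "a \<in> Ob A"
    have "Comp A (fob K a) (fob K (fob K a)) (fob K a) (\<mu> a) (\<eta> (fob K a)) = Idn A (fob K a)"
      by (rule far_eq_imp_eq[where a = "fob K a" and b = "fob K a"])
          (use a in \<open>auto simp: all_rules\<close>)
    then show "Comp A (mob ?L a) (mob ?L (mob ?L a)) (mob ?L a) (mmult ?L a) (munit ?L (mob ?L a))
      = Idn A (mob ?L a)"
      by simp
    have "Comp A (fob K a) (fob K (fob K a)) (fob K a) (\<mu> a) (far K a (fob K a) (\<eta> a))
        = Idn A (fob K a)"
      by (rule far_eq_imp_eq[where a = "fob K a" and b = "fob K a"])
          (use a in \<open>auto simp: all_rules\<close>)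
    then show "Comp A (mob ?L a) (mob ?L (mob ?L a)) (mob ?L a) (mmult ?L a)
        (mar ?L a (mob ?L a) (munit ?L a))
      = Idn A (mob ?L a)"
      by simp
    have "Comp A (fob K (fob K (fob K a))) (fob K (fob K a)) (fob K a) (\<mu> a) (\<mu> (fob K a))
      = Comp A (fob K (fob K (fob K a))) (fob K (fob K a)) (fob K a) (\<mu> a)
          (far K (fob K (fob K a)) (fob K a) (\<mu> a))"
      by (rule far_eq_imp_eq[where a = "(fob K (fob K (fob K a)))" and b = "fob K a"])
          (use a in \<open>auto simp: all_rules\<close>)
    then show "Comp A (mob ?L (mob ?L (mob ?L a))) (mob ?L (mob ?L a)) (mob ?L a) (mmult ?L a)
        (mmult ?L (mob ?L a))
      = Comp A (mob ?L (mob ?L (mob ?L a))) (mob ?L (mob ?L a)) (mob ?L a) (mmult ?L a)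
          (mar ?L (mob ?L (mob ?L a)) (mob ?L a) (mmult ?L a))"
      by simp
  qed
  ultimately have L: "monad A ?L"
    by (simp add: monad_def)
  show ?thesis
  proof (intro ex1I[of _ ?L] conjI)
    show "is_monad_lift A B G S ?L \<kappa>"
      using lift L by (simp add: is_monad_lift_def all_rules)
    fix L' assume L': "mfun L' = K \<and> is_monad_lift A B G S L' \<kappa>"
    then interpret L': monad A L'
      by (simp add: is_monad_lift_def)
    have K: "mfun L' = K"
      using L' by simp
    note L'_in [simp] = L'.unit_in_Hom[unfolded K] L'.mult_in_Hom[unfolded K]
    have "munit L' = \<eta>"
    proof (rule extensionalityI[OF L'.unit.extensional])
      fix a assume a: "a \<in> Ob A"
      show "munit L' a = \<eta> a"
        by (rule eq_of_\<kappa>[of a a]) (use L' a in \<open>auto simp: is_monad_lift_def all_rules\<close>)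
    qed (simp add: \<eta>_def)
    moreover have "mmult L' = \<mu>"
    proof (rule extensionalityI[OF L'.mult.extensional])
      fix a assume a: "a \<in> Ob A"
      show "mmult L' a = \<mu> a"
        by (rule eq_of_\<kappa>[of a "fob K (fob K a)"])
            (use L' a in \<open>auto simp: is_monad_lift_def all_rules\<close>)
    qed (simp add: \<mu>_def)
    ultimately show "L' = ?L"
      using K by simp
  qed simp
qed

end

text \<open>The isomorphism in the definition of \<open>restricts\<close> serves as \<kappa>, its
  inverse as \<open>l\<close>.\<close>

lemma (in ff_functor) restricts_kan_lift:
  assumes "monad B S" "restricts A B G S"
  shows "\<exists>K \<kappa> l. iso_lift A B G S K \<kappa> l"
proof -
  interpret S: monad B S by fact
  obtain K \<sigma> \<rho> where K: "cfunctor A A K"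
    and \<sigma>: "nat_trans A B (cfcomp A G K) (cfcomp A (mfun S) G) \<sigma>"
    and \<rho>: "nat_trans A B (cfcomp A (mfun S) G) (cfcomp A G K) \<rho>"
    and \<rho>\<sigma>: "nat_comp A B (cfcomp A G K) (cfcomp A (mfun S) G) (cfcomp A G K) \<rho> \<sigma>
        = nat_id A B (cfcomp A G K)"
    and \<sigma>\<rho>: "nat_comp A B (cfcomp A (mfun S) G) (cfcomp A G K) (cfcomp A (mfun S) G) \<sigma> \<rho>
      = nat_id A B (cfcomp A (mfun S) G)"
    using assms(2) by (auto simp: restricts_def isomorphic_def)
  have "iso_lift_axioms A B G S K \<sigma> \<rho>"
  proof (rule iso_lift_axioms.intro)
    fix a assume a: "a \<in> Ob A"
    show "\<rho> a \<in> Hom B (mob S (fob G a)) (fob G (fob K a))"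
      using nat_trans.component[OF \<rho> a] a by simp
    show "Comp B (mob S (fob G a)) (fob G (fob K a)) (mob S (fob G a)) (\<sigma> a) (\<rho> a)
        = Idn B (mob S (fob G a))"
      using fun_cong[OF \<sigma>\<rho>, of a] a by simp
    show "Comp B (fob G (fob K a)) (mob S (fob G a)) (fob G (fob K a)) (\<rho> a) (\<sigma> a)
        = Idn B (fob G (fob K a))"
      using fun_cong[OF \<rho>\<sigma>, of a] a by simp
  qed (rule \<sigma>)
  then have "iso_lift A B G S K \<sigma> \<rho>"
    using K S.monad_axioms ff_functor_axioms by (simp add: iso_lift_def)
  then show ?thesis
    by blast
qed

lemma (in iso_lift) is_right_kan_lift: "right_kan_lift A A B G (cfcomp A (mfun S) G) K \<kappa>"
  by (rule iso_right_kan_lift[OF K.cfunctor_axioms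
      cfunctor_cfcomp[OF cfunctor_axioms S.unit.tgt.cfunctor_axioms] \<kappa>, of l])
    (auto simp: \<kappa>_l l_\<kappa>)

text \<open>Any right Kan lift is compared with the one coming from the restriction, whose counit is
  invertible, so its own counit is invertible too.\<close>

lemma (in ff_functor) right_kan_lift_iso_lift:
  assumes S: "monad B S" and r: "restricts A B G S"
    and lift: "right_kan_lift A A B G (cfcomp A (mfun S) G) K \<kappa>"
  shows "\<exists>l. iso_lift A B G S K \<kappa> l"
proof -
  interpret S: monad B S by fact
  obtain K' \<kappa>' l' where "iso_lift A B G S K' \<kappa>' l'"
    using restricts_kan_lift[OF S r] by blast
  then interpret K': iso_lift A B G S K' \<kappa>' l' .
  have "\<forall>a\<in>Ob A. \<exists>d. d \<in> Hom B (mob S (fob G a)) (fob G (fob K a)) \<and>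
    Comp B (mob S (fob G a)) (fob G (fob K a)) (mob S (fob G a)) (\<kappa> a) d = Idn B (mob S (fob G a)) \<and>
    Comp B (fob G (fob K a)) (mob S (fob G a)) (fob G (fob K a)) d (\<kappa> a) = Idn B (fob G (fob K a))"
    using right_kan_lift_iso[OF lift K'.is_right_kan_lift
        cfunctor_cfcomp[OF cfunctor_axioms S.unit.tgt.cfunctor_axioms], of l']
    by (auto simp: K'.\<kappa>_l K'.l_\<kappa>)
  then obtain l where "\<forall>a\<in>Ob A. l a \<in> Hom B (mob S (fob G a)) (fob G (fob K a)) \<and>
    Comp B (mob S (fob G a)) (fob G (fob K a)) (mob S (fob G a)) (\<kappa> a) (l a)
        = Idn B (mob S (fob G a)) \<and>
    Comp B (fob G (fob K a)) (mob S (fob G a)) (fob G (fob K a)) (l a) (\<kappa> a)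
        = Idn B (fob G (fob K a))"
    by metis
  then have "iso_lift A B G S K \<kappa> l"
    using lift S.monad_axioms ff_functor_axioms
    by (simp add: iso_lift_def iso_lift_axioms_def right_kan_lift_def)
  then show ?thesis
    by blast
qed

section \<open>Lax and colax morphisms along a functor\<close>

text \<open>A monad functor from \<open>(A, T)\<close> to \<open>(B, M)\<close> in the sense of
  Street, carried by \<open>G\<close>. Naturality is stated on components and nothing is said off
  \<open>Ob A\<close>, so composites need no restriction.\<close>

locale lax_map = G: cfunctor A B G + M: monad B M + T: monad A T
  for A :: "('a, 'm) category" and B :: "('b, 'n) category"
    and G :: "('a, 'm, 'b, 'n) cfunctor" and M :: "('b, 'n) monad" and T :: "('a, 'm) monad" +
  fixes \<alpha> :: "'a \<Rightarrow> 'n"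
  assumes in_Hom [simp]: "a \<in> Ob A \<Longrightarrow> \<alpha> a \<in> Hom B (mob M (fob G a)) (fob G (mob T a))"
    and natural: "\<lbrakk>a \<in> Ob A; b \<in> Ob A; f \<in> Hom A a b\<rbrakk> \<Longrightarrow>
      Comp B (mob M (fob G a)) (mob M (fob G b)) (fob G (mob T b)) (\<alpha> b)
          (mar M (fob G a) (fob G b) (far G a b f))
      = Comp B (mob M (fob G a)) (fob G (mob T a)) (fob G (mob T b))
          (far G (mob T a) (mob T b) (mar T a b f)) (\<alpha> a)"
    and unit_law: "a \<in> Ob A \<Longrightarrow>
      Comp B (fob G a) (mob M (fob G a)) (fob G (mob T a)) (\<alpha> a) (munit M (fob G a))
          = far G a (mob T a) (munit T a)"
    and mult_law: "a \<in> Ob A \<Longrightarrow> Comp B (mob M (mob M (fob G a))) (mob M (fob G a)) (fob G (mob T a))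
        (\<alpha> a) (mmult M (fob G a))
      = Comp B (mob M (mob M (fob G a))) (fob G (mob T (mob T a))) (fob G (mob T a))
          (far G (mob T (mob T a)) (mob T a) (mmult T a))
          (Comp B (mob M (mob M (fob G a))) (mob M (fob G (mob T a))) (fob G (mob T (mob T a)))
          (\<alpha> (mob T a)) (mar M (mob M (fob G a)) (fob G (mob T a)) (\<alpha> a)))"

text \<open>The same data with the transformation reversed: Street's monad opfunctor carried by
  \<open>G\<close>.\<close>

locale colax_map = G: cfunctor A B G + M: monad B M + T: monad A T
  for A :: "('a, 'm) category" and B :: "('b, 'n) category"
    and G :: "('a, 'm, 'b, 'n) cfunctor" and M :: "('b, 'n) monad" and T :: "('a, 'm) monad" +
  fixes \<beta> :: "'a \<Rightarrow> 'n"
  assumes in_Hom [simp]: "a \<in> Ob A \<Longrightarrow> \<beta> a \<in> Hom B (fob G (mob T a)) (mob M (fob G a))"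
    and natural: "\<lbrakk>a \<in> Ob A; b \<in> Ob A; f \<in> Hom A a b\<rbrakk> \<Longrightarrow>
      Comp B (fob G (mob T a)) (fob G (mob T b)) (mob M (fob G b)) (\<beta> b)
          (far G (mob T a) (mob T b) (mar T a b f))
      = Comp B (fob G (mob T a)) (mob M (fob G a)) (mob M (fob G b))
          (mar M (fob G a) (fob G b) (far G a b f)) (\<beta> a)"
    and unit_law: "a \<in> Ob A \<Longrightarrow>
      Comp B (fob G a) (fob G (mob T a)) (mob M (fob G a)) (\<beta> a) (far G a (mob T a) (munit T a))
          = munit M (fob G a)"
    and mult_law: "a \<in> Ob A \<Longrightarrow>
      Comp B (fob G (mob T (mob T a))) (fob G (mob T a)) (mob M (fob G a)) (\<beta> a)
          (far G (mob T (mob T a)) (mob T a) (mmult T a))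
      = Comp B (fob G (mob T (mob T a))) (mob M (mob M (fob G a))) (mob M (fob G a))
          (mmult M (fob G a))
          (Comp B (fob G (mob T (mob T a))) (mob M (fob G (mob T a))) (mob M (mob M (fob G a)))
          (mar M (fob G (mob T a)) (mob M (fob G a)) (\<beta> a)) (\<beta> (mob T a)))"

text \<open>Each law is a square whose two parallel sides \<alpha> are invertible; inverting these
  sides gives the law of the opposite kind.\<close>

lemma lax_map_inverse:
  assumes "lax_map A B G M T \<alpha>"
    and \<beta> [simp]: "\<And>a. a \<in> Ob A \<Longrightarrow> \<beta> a \<in> Hom B (fob G (mob T a)) (mob M (fob G a))"
    and \<alpha>\<beta>: "\<And>a. a \<in> Ob A \<Longrightarrow> Comp B (fob G (mob T a)) (mob M (fob G a)) (fob G (mob T a)) (\<alpha> a) (\<beta> a)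
        = Idn B (fob G (mob T a))"
    and \<beta>\<alpha>: "\<And>a. a \<in> Ob A \<Longrightarrow> Comp B (mob M (fob G a)) (fob G (mob T a)) (mob M (fob G a)) (\<beta> a) (\<alpha> a)
        = Idn B (mob M (fob G a))"
  shows "colax_map A B G M T \<beta>"
proof -
  interpret lax_map A B G M T \<alpha> by fact
  note right = G.cod.Comp_eq_Comp_right
  show ?thesis
  proof unfold_locales
    fix a b f assume *: "a \<in> Ob A" "b \<in> Ob A" "f \<in> Hom A a b"
    show "Comp B (fob G (mob T a)) (fob G (mob T b)) (mob M (fob G b)) (\<beta> b)
        (far G (mob T a) (mob T b) (mar T a b f))
      = Comp B (fob G (mob T a)) (mob M (fob G a)) (mob M (fob G b))
          (mar M (fob G a) (fob G b) (far G a b f)) (\<beta> a)"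
      by (rule G.cod.inverse_square[OF _ _ _ _ in_Hom \<beta> in_Hom \<beta> \<alpha>\<beta> \<beta>\<alpha>])
        (use * in \<open>auto simp: natural\<close>)
  next
    fix a assume a: "a \<in> Ob A"
    then show "Comp B (fob G a) (fob G (mob T a)) (mob M (fob G a)) (\<beta> a)
        (far G a (mob T a) (munit T a)) = munit M (fob G a)"
      by (simp add: unit_law[symmetric] right[OF \<beta>\<alpha>])
    \<comment> \<open>One side of the multiplication square is this composite of two instances of
      \<alpha>; \<open>?g\<close> composes the inverses in opposite order.\<close>
    let ?f = "Comp B (mob M (mob M (fob G a))) (mob M (fob G (mob T a))) (fob G (mob T (mob T a)))
        (\<alpha> (mob T a)) (mar M (mob M (fob G a)) (fob G (mob T a)) (\<alpha> a))"
    let ?g = "Comp B (fob G (mob T (mob T a))) (mob M (fob G (mob T a))) (mob M (mob M (fob G a)))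
        (mar M (fob G (mob T a)) (mob M (fob G a)) (\<beta> a)) (\<beta> (mob T a))"
    have "Comp B (fob G (mob T (mob T a))) (fob G (mob T a)) (mob M (fob G a)) (\<beta> a)
        (far G (mob T (mob T a)) (mob T a) (mmult T a))
      = Comp B (fob G (mob T (mob T a))) (mob M (mob M (fob G a))) (mob M (fob G a))
          (mmult M (fob G a)) ?g"
      by (rule G.cod.inverse_square[OF _ _ _ _ _ _ in_Hom \<beta> _ \<beta>\<alpha>, where f = ?f])
        (use a in \<open>auto simp: mult_law \<alpha>\<beta> right[OF M.unit.tgt.far_eq[OF \<alpha>\<beta>]]\<close>)
    then show "Comp B (fob G (mob T (mob T a))) (fob G (mob T a)) (mob M (fob G a)) (\<beta> a)
        (far G (mob T (mob T a)) (mob T a) (mmult T a))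
      = Comp B (fob G (mob T (mob T a))) (mob M (mob M (fob G a))) (mob M (fob G a))
          (mmult M (fob G a))
          (Comp B (fob G (mob T (mob T a))) (mob M (fob G (mob T a))) (mob M (mob M (fob G a)))
          (mar M (fob G (mob T a)) (mob M (fob G a)) (\<beta> a)) (\<beta> (mob T a)))" .
  qed simp
qed

lemma colax_map_inverse:
  assumes "colax_map A B G M T \<beta>"
    and \<alpha> [simp]: "\<And>a. a \<in> Ob A \<Longrightarrow> \<alpha> a \<in> Hom B (mob M (fob G a)) (fob G (mob T a))"
    and \<alpha>\<beta>: "\<And>a. a \<in> Ob A \<Longrightarrow> Comp B (fob G (mob T a)) (mob M (fob G a)) (fob G (mob T a)) (\<alpha> a) (\<beta> a)
        = Idn B (fob G (mob T a))"
    and \<beta>\<alpha>: "\<And>a. a \<in> Ob A \<Longrightarrow> Comp B (mob M (fob G a)) (fob G (mob T a)) (mob M (fob G a)) (\<beta> a) (\<alpha> a)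
        = Idn B (mob M (fob G a))"
  shows "lax_map A B G M T \<alpha>"
proof -
  interpret colax_map A B G M T \<beta> by fact
  note right = G.cod.Comp_eq_Comp_right
  show ?thesis
  proof unfold_locales
    fix a b f assume *: "a \<in> Ob A" "b \<in> Ob A" "f \<in> Hom A a b"
    show "Comp B (mob M (fob G a)) (mob M (fob G b)) (fob G (mob T b)) (\<alpha> b)
        (mar M (fob G a) (fob G b) (far G a b f))
      = Comp B (mob M (fob G a)) (fob G (mob T a)) (fob G (mob T b))
          (far G (mob T a) (mob T b) (mar T a b f)) (\<alpha> a)"
      by (rule G.cod.inverse_square[OF _ _ _ _ in_Hom \<alpha> in_Hom \<alpha> \<beta>\<alpha> \<alpha>\<beta>])
        (use * in \<open>auto simp: natural\<close>)
  next
    fix a assume a: "a \<in> Ob A"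
    then show "Comp B (fob G a) (mob M (fob G a)) (fob G (mob T a)) (\<alpha> a) (munit M (fob G a))
        = far G a (mob T a) (munit T a)"
      by (simp add: unit_law[symmetric] right[OF \<alpha>\<beta>])
    let ?f = "Comp B (fob G (mob T (mob T a))) (mob M (fob G (mob T a))) (mob M (mob M (fob G a)))
        (mar M (fob G (mob T a)) (mob M (fob G a)) (\<beta> a)) (\<beta> (mob T a))"
    let ?g = "Comp B (mob M (mob M (fob G a))) (mob M (fob G (mob T a))) (fob G (mob T (mob T a)))
        (\<alpha> (mob T a)) (mar M (mob M (fob G a)) (fob G (mob T a)) (\<alpha> a))"
    have "Comp B (mob M (mob M (fob G a))) (mob M (fob G a)) (fob G (mob T a)) (\<alpha> a)
        (mmult M (fob G a))
      = Comp B (mob M (mob M (fob G a))) (fob G (mob T (mob T a))) (fob G (mob T a))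
          (far G (mob T (mob T a)) (mob T a) (mmult T a)) ?g"
      by (rule G.cod.inverse_square[OF _ _ _ _ _ _ in_Hom \<alpha> _ \<alpha>\<beta>, where f = ?f])
        (use a in \<open>auto simp: mult_law right[OF \<beta>\<alpha>] M.unit.tgt.far_eq[OF \<beta>\<alpha>]\<close>)
    then show "Comp B (mob M (mob M (fob G a))) (mob M (fob G a)) (fob G (mob T a)) (\<alpha> a)
        (mmult M (fob G a))
      = Comp B (mob M (mob M (fob G a))) (fob G (mob T (mob T a))) (fob G (mob T a))
          (far G (mob T (mob T a)) (mob T a) (mmult T a))
          (Comp B (mob M (mob M (fob G a))) (mob M (fob G (mob T a))) (fob G (mob T (mob T a)))
          (\<alpha> (mob T a)) (mar M (mob M (fob G a)) (fob G (mob T a)) (\<alpha> a)))" .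
  qed simp
qed

text \<open>Applied to the counit of a pushforward, this is the lax map whose factor is the value of
  the pushforward functor at \<theta>.\<close>

lemma (in lax_map) comp_monad_map:
  assumes "monad_map A T T' \<theta>"
  shows "lax_map A B G M T' (\<lambda>a. Comp B (mob M (fob G a)) (fob G (mob T a)) (fob G (mob T' a))
      (far G (mob T a) (mob T' a) (\<theta> a)) (\<alpha> a))"
proof -
  interpret \<theta>: monad_map A T T' \<theta> by fact
  note [simp] = \<theta>.component
  note right = G.cod.Comp_eq_Comp_right
  note images = G.far_eq[OF \<theta>.naturality] G.far_eq[OF \<theta>.map_unit] G.far_eq[OF \<theta>.map_mult]
  note rules = natural unit_law mult_law images right[OF natural] right[OF images(1)]
      right[OF images(2)]
    right[OF images(3)]
  show ?thesis
    by unfold_locales (auto simp: rules)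
qed

text \<open>Applied to \<kappa>, this is the colax map whose factor is the value of the lift functor
  at \<phi>.\<close>

lemma (in colax_map) comp_monad_map:
  assumes "monad_map B M M' \<phi>"
  shows "colax_map A B G M' T
      (\<lambda>a. Comp B (fob G (mob T a)) (mob M (fob G a)) (mob M' (fob G a)) (\<phi> (fob G a)) (\<beta> a))"
proof -
  interpret \<phi>: monad_map B M M' \<phi> by fact
  note [simp] = \<phi>.component
  note right = G.cod.Comp_eq_Comp_right
  note rules = natural unit_law mult_law \<phi>.naturality \<phi>.map_unit \<phi>.map_mult
    right[OF \<phi>.naturality] right[OF \<phi>.map_mult]
  show ?thesis
    by unfold_locales (auto simp: rules)
qed

section \<open>Universal properties with respect to lax and colax maps\<close>

locale pushforward = pointwise_monad_extension A B G T "mfun P" \<epsilon>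
  for A :: "('a, 'm) category" and B :: "('b, 'n) category"
    and G :: "('a, 'm, 'b, 'n) cfunctor" and T :: "('a, 'm) monad"
    and P :: "('b, 'n) monad" and \<epsilon> :: "'a \<Rightarrow> 'n" +
  assumes is_pushforward: "is_pushforward A B G T P \<epsilon>"
begin

sublocale P: monad B P
  using is_pushforward by (simp add: is_pushforward_def)

sublocale lax_map A B G P T \<epsilon>
  by unfold_locales (use is_pushforward in \<open>auto simp: is_pushforward_def \<epsilon>_nat\<close>)

text \<open>The Kan property lifts from transformations to monad maps: after
  \<open>\<epsilon>\<^sub>a \<circ> P g\<close> both sides of each law for \<phi> reduce, by
  naturality and the lax laws of \<epsilon>, to a lax law of \<alpha> at \<open>a\<close>.\<close>

lemma lax_map_factor:
  assumes "lax_map A B G M T \<alpha>"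
  shows "\<exists>\<phi>. monad_map B M P \<phi> \<and>
    (\<forall>a\<in>Ob A. Comp B (mob M (fob G a)) (mob P (fob G a)) (fob G (mob T a)) (\<epsilon> a) (\<phi> (fob G a))
        = \<alpha> a)"
proof -
  interpret \<alpha>: lax_map A B G M T \<alpha> by fact
  have "nat_trans A B (cfcomp A (mfun M) G) (cfcomp A G (mfun T)) (\<lambda>a\<in>Ob A. \<alpha> a)"
    by (rule nat_transI[OF cfunctor_cfcomp[OF G.cfunctor_axioms \<alpha>.M.unit.tgt.cfunctor_axioms]
        F.cfunctor_axioms]) (auto simp: \<alpha>.natural)
  from ex1_factor[OF \<alpha>.M.unit.tgt.cfunctor_axioms this] obtain \<phi>
    where \<phi>: "nat_trans B B (mfun M) (mfun P) \<phi>"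
      and \<epsilon>_\<phi>: "\<And>a. a \<in> Ob A \<Longrightarrow> Comp B (mob M (fob G a)) (mob P (fob G a)) (fob G (mob T a)) (\<epsilon> a)
          (\<phi> (fob G a)) = \<alpha> a"
    by auto
  interpret \<phi>: nat_trans B B "mfun M" "mfun P" \<phi> by fact
  note [simp] = \<phi>.component
  note right = G.cod.Comp_eq_Comp_right
  note \<phi>_nat = \<phi>.naturality[symmetric]
  note rules = unit_law mult_law P.unit_nat P.mult_nat \<phi>_nat \<epsilon>_\<phi>
    \<alpha>.unit_law \<alpha>.mult_law \<alpha>.M.unit_nat \<alpha>.M.mult_nat
  note right_rules = right[OF unit_law] right[OF mult_law] right[OF P.unit_nat] right[OF P.mult_nat]
    right[OF \<phi>_nat] right[OF \<epsilon>_\<phi>] right[OF \<alpha>.unit_law] right[OF \<alpha>.mult_law]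
    right[OF \<alpha>.M.unit_nat] right[OF \<alpha>.M.mult_nat]
  note images = \<alpha>.M.unit.tgt.far_eq[OF \<phi>_nat] \<alpha>.M.unit.tgt.far_eq[OF \<epsilon>_\<phi>]
  note right_images = right[OF images(1)] right[OF images(2)]
  have "monad_map_axioms B M P \<phi>"
  proof
    fix b assume b: "b \<in> Ob B"
    show "Comp B b (mob M b) (mob P b) (\<phi> b) (munit M b) = munit P b"
      by (rule eqI[of b b]) (use b in \<open>auto simp: rules right_rules\<close>)
    show "Comp B (mob M (mob M b)) (mob M b) (mob P b) (\<phi> b) (mmult M b)
      = Comp B (mob M (mob M b)) (mob P (mob P b)) (mob P b) (mmult P b)
          (Comp B (mob M (mob M b)) (mob P (mob M b)) (mob P (mob P b))
          (mar P (mob M b) (mob P b) (\<phi> b)) (\<phi> (mob M b)))"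
      by (rule eqI[of b "mob M (mob M b)"])
          (use b in \<open>auto simp: rules right_rules images right_images\<close>)
  qed
  then have "monad_map B M P \<phi>"
    using \<phi> \<alpha>.M.monad_axioms P.monad_axioms by (simp add: monad_map_def)
  with \<epsilon>_\<phi> show ?thesis
    by blast
qed

end

text \<open>The common form of two situations: a lift of \<open>S\<close>, with \<kappa> and its
  inverse, and a pushforward of \<open>L\<close>, with the inverse of its counit in the role of
  \<kappa> and the counit in that of \<open>l\<close>.\<close>

locale iso_colax_map = ff_functor A B G + colax: colax_map A B G S L \<kappa> + lax: lax_map A B G S L l
  for A :: "('a, 'm) category" and B :: "('b, 'n) category"
    and G :: "('a, 'm, 'b, 'n) cfunctor" and S :: "('b, 'n) monad" and L :: "('a, 'm) monad"
    and \<kappa> l :: "'a \<Rightarrow> 'n" +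
  assumes \<kappa>_l: "a \<in> Ob A \<Longrightarrow> Comp B (mob S (fob G a)) (fob G (mob L a)) (mob S (fob G a)) (\<kappa> a) (l a)
      = Idn B (mob S (fob G a))"
    and l_\<kappa>: "a \<in> Ob A \<Longrightarrow> Comp B (fob G (mob L a)) (mob S (fob G a)) (fob G (mob L a)) (l a) (\<kappa> a)
        = Idn B (fob G (mob L a))"
begin

lemma factor_unique:
  assumes "nat_trans A A M (mfun L) \<theta>" "nat_trans A A M (mfun L) \<theta>'"
    and "\<And>a. a \<in> Ob A \<Longrightarrow> Comp B (fob G (fob M a)) (fob G (mob L a)) (mob S (fob G a)) (\<kappa> a)
        (far G (fob M a) (mob L a) (\<theta> a))
      = Comp B (fob G (fob M a)) (fob G (mob L a)) (mob S (fob G a)) (\<kappa> a)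
          (far G (fob M a) (mob L a) (\<theta>' a))"
  shows "\<theta> = \<theta>'"
proof (rule nat_trans_eqI[OF assms(1,2)])
  interpret \<theta>: nat_trans A A M "mfun L" \<theta> by fact
  interpret \<theta>': nat_trans A A M "mfun L" \<theta>' by fact
  note [simp] = \<theta>.component \<theta>'.component
  fix a assume a: "a \<in> Ob A"
  have "far G (fob M a) (mob L a) (\<theta> a) = far G (fob M a) (mob L a) (\<theta>' a)"
    using arg_cong[OF assms(3)[OF a], of
        "\<lambda>h. Comp B (fob G (fob M a)) (mob S (fob G a)) (fob G (mob L a)) (l a) h"] a
    by (simp add: cod.Comp_eq_Comp_right[OF l_\<kappa>])
  then show "\<theta> a = \<theta>' a"
    by (rule far_eq_imp_eq) (use a in auto)
qed

text \<open>As \<kappa> is invertible, \<open>G \<theta>\<close> can only be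
  \<open>l \<circ> \<beta>\<close>. After \<open>G\<close>, the laws of a monad map for \<theta>
  combine the lax laws of \<open>l\<close> with the colax laws of \<beta>.\<close>

lemma colax_map_factor:
  assumes "colax_map A B G S T \<beta>"
  shows "\<exists>\<theta>. monad_map A T L \<theta> \<and>
    (\<forall>a\<in>Ob A. Comp B (fob G (mob T a)) (fob G (mob L a)) (mob S (fob G a)) (\<kappa> a)
        (far G (mob T a) (mob L a) (\<theta> a)) = \<beta> a)"
proof -
  interpret \<beta>: colax_map A B G S T \<beta> by fact
  define \<theta> where "\<theta> = (\<lambda>a\<in>Ob A. G_inv (mob T a) (mob L a)
      (Comp B (fob G (mob T a)) (mob S (fob G a)) (fob G (mob L a)) (l a) (\<beta> a)))"
  have [simp]: "\<theta> a \<in> Hom A (mob T a) (mob L a)"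
    and G_\<theta>: "far G (mob T a) (mob L a) (\<theta> a)
        = Comp B (fob G (mob T a)) (mob S (fob G a)) (fob G (mob L a)) (l a) (\<beta> a)"
    if "a \<in> Ob A" for a
    using that by (simp_all add: \<theta>_def)
  note right = cod.Comp_eq_Comp_right
  note rules = G_\<theta> lax.unit_law lax.mult_law lax.natural[symmetric] \<beta>.unit_law \<beta>.mult_law \<beta>.natural
  note right_rules = right[OF lax.unit_law] right[OF lax.mult_law] right[OF lax.natural[symmetric]]
    right[OF \<beta>.unit_law] right[OF \<beta>.mult_law] right[OF \<beta>.natural]
  have "nat_trans A A (mfun T) (mfun L) \<theta>"
  proof (rule nat_transI[OF \<beta>.T.unit.tgt.cfunctor_axioms colax.T.unit.tgt.cfunctor_axioms])
    fix a b f assume *: "a \<in> Ob A" "b \<in> Ob A" "f \<in> Hom A a b"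
    show "Comp A (mob T a) (mob T b) (mob L b) (\<theta> b) (mar T a b f)
        = Comp A (mob T a) (mob L a) (mob L b) (mar L a b f) (\<theta> a)"
      by (rule far_eq_imp_eq[where a = "mob T a" and b = "mob L b"])
          (use * in \<open>auto simp: rules right_rules\<close>)
  qed (auto simp: \<theta>_def)
  moreover have "monad_map_axioms A T L \<theta>"
  proof
    fix a assume a: "a \<in> Ob A"
    show "Comp A a (mob T a) (mob L a) (\<theta> a) (munit T a) = munit L a"
      by (rule far_eq_imp_eq[where a = a and b = "mob L a"])
          (use a in \<open>auto simp: rules right_rules\<close>)
    show "Comp A (mob T (mob T a)) (mob T a) (mob L a) (\<theta> a) (mmult T a)
      = Comp A (mob T (mob T a)) (mob L (mob L a)) (mob L a) (mmult L a)
          (Comp A (mob T (mob T a)) (mob L (mob T a)) (mob L (mob L a))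
          (mar L (mob T a) (mob L a) (\<theta> a)) (\<theta> (mob T a)))"
      by (rule far_eq_imp_eq[where a = "mob T (mob T a)" and b = "mob L a"])
          (use a in \<open>auto simp: rules right_rules\<close>)
  qed
  ultimately have "monad_map A T L \<theta>"
    using \<beta>.T.monad_axioms colax.T.monad_axioms by (simp add: monad_map_def)
  then show ?thesis
    by (intro exI[of _ \<theta>]) (auto simp: G_\<theta> right[OF \<kappa>_l])
qed

end

text \<open>The equations of a monad lift say that \<kappa> is colax; its inverse exists because
  \<open>S\<close> restricts, and is lax.\<close>

lemma (in ff_functor) is_monad_lift_iso_colax_map:
  assumes S: "monad B S" "restricts A B G S" and lift: "is_monad_lift A B G S L \<kappa>"
  shows "\<exists>l. iso_colax_map A B G S L \<kappa> l"
proof -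
  interpret L: monad A L
    using lift by (simp add: is_monad_lift_def)
  obtain l where "iso_lift A B G S (mfun L) \<kappa> l"
    using right_kan_lift_iso_lift[OF S] lift unfolding is_monad_lift_def by blast
  then interpret iso_lift A B G S "mfun L" \<kappa> l .
  interpret colax: colax_map A B G S L \<kappa>
    by unfold_locales (use lift in \<open>auto simp: is_monad_lift_def \<kappa>_nat\<close>)
  interpret lax: lax_map A B G S L l
    by (rule colax_map_inverse[OF colax.colax_map_axioms]) (auto simp: \<kappa>_l l_\<kappa>)
  have "iso_colax_map A B G S L \<kappa> l"
    by unfold_locales (auto simp: \<kappa>_l l_\<kappa>)
  then show ?thesis
    by blast
qed

text \<open>Here the counit is lax and its inverse colax, so \<open>T\<close> has the universal
  property of a monad lift of its own pushforward. This drives the counit of the adjunction and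
  fullness.\<close>

lemma (in ff_functor) pushforward_iso_colax_map:
  assumes "pushforward A B G T P \<epsilon>"
  shows "\<exists>d. iso_colax_map A B G P T d \<epsilon>"
proof -
  interpret pushforward A B G T P \<epsilon> by fact
  have "\<forall>a\<in>Ob A. \<exists>d. d \<in> Hom B (fob G (mob T a)) (mob P (fob G a)) \<and>
    Comp B (fob G (mob T a)) (mob P (fob G a)) (fob G (mob T a)) (\<epsilon> a) d = Idn B (fob G (mob T a)) \<and>
    Comp B (mob P (fob G a)) (fob G (mob T a)) (mob P (fob G a)) d (\<epsilon> a) = Idn B (mob P (fob G a))"
    using pointwise_extension_counit_iso[OF pointwise full faithful] by auto
  then obtain d where d: "\<And>a. a \<in> Ob A \<Longrightarrow> d a \<in> Hom B (fob G (mob T a)) (mob P (fob G a))"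
    and \<epsilon>d: "\<And>a. a \<in> Ob A \<Longrightarrow> Comp B (fob G (mob T a)) (mob P (fob G a)) (fob G (mob T a)) (\<epsilon> a) (d a)
        = Idn B (fob G (mob T a))"
    and d\<epsilon>: "\<And>a. a \<in> Ob A \<Longrightarrow> Comp B (mob P (fob G a)) (fob G (mob T a)) (mob P (fob G a)) (d a) (\<epsilon> a)
        = Idn B (mob P (fob G a))"
    by metis
  interpret d: colax_map A B G P T d
    by (rule lax_map_inverse[OF lax_map_axioms d \<epsilon>d d\<epsilon>])
  have "iso_colax_map A B G P T d \<epsilon>"
    by unfold_locales (auto simp: \<epsilon>d d\<epsilon>)
  then show ?thesis
    by blast
qed

section \<open>The adjunction between categories of monads\<close>

lemma monad_map_nat_id:
  assumes "monad C T"
  shows "monad_map C T T (nat_id C C (mfun T))"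
proof -
  interpret T: monad C T by fact
  interpret nat_trans C C "mfun T" "mfun T" "nat_id C C (mfun T)"
    by (rule nat_trans_nat_id) (rule T.unit.tgt.cfunctor_axioms)
  show ?thesis
    by unfold_locales auto
qed

lemma monad_map_nat_comp:
  assumes "monad_map C T S \<theta>" "monad_map C S R \<phi>"
  shows "monad_map C T R (nat_comp C C (mfun T) (mfun S) (mfun R) \<phi> \<theta>)"
proof -
  interpret \<theta>: monad_map C T S \<theta> by fact
  interpret \<phi>: monad_map C S R \<phi> by fact
  interpret nat_trans C C "mfun T" "mfun R" "nat_comp C C (mfun T) (mfun S) (mfun R) \<phi> \<theta>"
    by (rule nat_trans_nat_comp) (rule \<theta>.nat_trans_axioms \<phi>.nat_trans_axioms)+
  note [simp] = \<theta>.component \<phi>.component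
  note right = \<theta>.dom.unit.src.dom.Comp_eq_Comp_right
  note rules = \<theta>.map_unit \<theta>.map_mult \<phi>.map_unit \<phi>.map_mult \<phi>.naturality
    right[OF \<phi>.map_mult] right[OF \<phi>.naturality]
  show ?thesis
    by unfold_locales (auto simp: rules)
qed

lemma category_Mnd: "category (Mnd C)"
proof
  fix T S \<theta> assume "T \<in> Ob (Mnd C)" "S \<in> Ob (Mnd C)" "\<theta> \<in> Hom (Mnd C) T S"
  then interpret monad_map C T S \<theta>
    by simp
  note [simp] = component
  show "Comp (Mnd C) T S S (Idn (Mnd C) S) \<theta> = \<theta>"
    by (simp, rule nat_trans_eqI[OF nat_trans_nat_comp[OF nat_trans_axioms nat_trans_nat_id]
        nat_trans_axioms])
      (auto simp: cod.unit.tgt.cfunctor_axioms)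
  show "Comp (Mnd C) T T S \<theta> (Idn (Mnd C) T) = \<theta>"
    by (simp, rule nat_trans_eqI[OF nat_trans_nat_comp[OF nat_trans_nat_id nat_trans_axioms]
        nat_trans_axioms])
      (auto simp: dom.unit.tgt.cfunctor_axioms)
next
  fix T S R Q \<theta> \<phi> \<psi> assume "T \<in> Ob (Mnd C)" "S \<in> Ob (Mnd C)" "R \<in> Ob (Mnd C)" "Q \<in> Ob (Mnd C)"
    "\<theta> \<in> Hom (Mnd C) T S" "\<phi> \<in> Hom (Mnd C) S R" "\<psi> \<in> Hom (Mnd C) R Q"
  then interpret \<theta>: monad_map C T S \<theta> + \<phi>: monad_map C S R \<phi> + \<psi>: monad_map C R Q \<psi>
    by simp_all
  note [simp] = \<theta>.component \<phi>.component \<psi>.component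
  note comp = nat_trans_nat_comp
  note nats = \<theta>.nat_trans_axioms \<phi>.nat_trans_axioms \<psi>.nat_trans_axioms
  show "Comp (Mnd C) T S Q (Comp (Mnd C) S R Q \<psi> \<phi>) \<theta>
      = Comp (Mnd C) T R Q \<psi> (Comp (Mnd C) T S R \<phi> \<theta>)"
    by (simp, rule nat_trans_eqI[OF comp[OF nats(1) comp[OF nats(2,3)]]
        comp[OF comp[OF nats(1,2)] nats(3)]])
      simp
qed (auto simp: monad_map_nat_id monad_map_nat_comp)

lemma full_subcategory_simps [simp]:
  "Ob (full_subcategory C X) = Ob C \<inter> X"
  "Hom (full_subcategory C X) = Hom C"
  "Idn (full_subcategory C X) = Idn C"
  "Comp (full_subcategory C X) = Comp C"
  by (simp_all add: full_subcategory_def)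

lemma category_full_subcategory:
  assumes "category C"
  shows "category (full_subcategory C X)"
proof -
  interpret category C by fact
  show ?thesis
    by unfold_locales auto
qed

lemma Mnd_res_simps [simp]:
  "Ob (Mnd_res A B G) = {S. monad B S \<and> restricts A B G S}"
  "Hom (Mnd_res A B G) = Hom (Mnd B)"
  "Idn (Mnd_res A B G) = Idn (Mnd B)"
  "Comp (Mnd_res A B G) = Comp (Mnd B)"
  unfolding Mnd_res_def by auto

lemma category_Mnd_res: "category (Mnd_res A B G)"
  unfolding Mnd_res_def by (rule category_full_subcategory[OF category_Mnd])

text \<open>The endofunctor witnessing restriction is that of \<open>T\<close>, and the isomorphism
  is the inverse of the counit.\<close>

lemma (in pushforward) restricts:
  assumes d [simp]: "\<And>a. a \<in> Ob A \<Longrightarrow> d a \<in> Hom B (fob G (mob T a)) (mob P (fob G a))"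
    and \<epsilon>d: "\<And>a. a \<in> Ob A \<Longrightarrow> Comp B (fob G (mob T a)) (mob P (fob G a)) (fob G (mob T a)) (\<epsilon> a) (d a)
        = Idn B (fob G (mob T a))"
    and d\<epsilon>: "\<And>a. a \<in> Ob A \<Longrightarrow> Comp B (mob P (fob G a)) (fob G (mob T a)) (mob P (fob G a)) (d a) (\<epsilon> a)
        = Idn B (mob P (fob G a))"
  shows "restricts A B G P"
proof -
  interpret d: colax_map A B G P T d
    by (rule lax_map_inverse[OF lax_map_axioms d \<epsilon>d d\<epsilon>])
  let ?d = "\<lambda>a\<in>Ob A. d a"
  have PG: "cfunctor A B (cfcomp A (mfun P) G)"
    by (rule cfunctor_cfcomp[OF G.cfunctor_axioms R.cfunctor_axioms])
  have nat_d: "nat_trans A B (cfcomp A G (mfun T)) (cfcomp A (mfun P) G) ?d"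
    by (rule nat_transI[OF F.cfunctor_axioms PG]) (auto simp: d.natural)
  have "nat_comp A B (cfcomp A G (mfun T)) (cfcomp A (mfun P) G) (cfcomp A G (mfun T)) \<epsilon> ?d
      = nat_id A B (cfcomp A G (mfun T))"
    by (rule nat_trans_eqI[OF nat_trans_nat_comp[OF nat_d \<epsilon>]
        nat_trans_nat_id[OF F.cfunctor_axioms]])
      (auto simp: \<epsilon>d)
  moreover have "nat_comp A B (cfcomp A (mfun P) G) (cfcomp A G (mfun T)) (cfcomp A (mfun P) G) ?d \<epsilon>
      = nat_id A B (cfcomp A (mfun P) G)"
    by (rule nat_trans_eqI[OF nat_trans_nat_comp[OF \<epsilon> nat_d] nat_trans_nat_id[OF PG]])
      (auto simp: d\<epsilon>)
  ultimately show ?thesis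
    unfolding restricts_def isomorphic_def using nat_d \<epsilon> T.unit.tgt.cfunctor_axioms by auto
qed

text \<open>Size and completeness have served their purpose once the pushforwards are pointwise.
  What remains is formal: chosen \<open>P\<close> and \<open>L\<close>, their counits, and inverses
  \<open>d\<close> of \<epsilon> and \<open>l\<close> of \<kappa>.\<close>

locale monad_adjunction = ff_functor A B G
  for A :: "('a, 'm) category" and B :: "('b, 'n) category" and G :: "('a, 'm, 'b, 'n) cfunctor" +
  fixes P :: "('a, 'm) monad \<Rightarrow> ('b, 'n) monad" and \<epsilon> d :: "('a, 'm) monad \<Rightarrow> 'a \<Rightarrow> 'n"
    and L :: "('b, 'n) monad \<Rightarrow> ('a, 'm) monad" and \<kappa> l :: "('b, 'n) monad \<Rightarrow> 'a \<Rightarrow> 'n"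
  assumes pushforward: "monad A T \<Longrightarrow> pushforward A B G T (P T) (\<epsilon> T)"
    and counit_iso: "monad A T \<Longrightarrow> iso_colax_map A B G (P T) T (d T) (\<epsilon> T)"
    and lift_iso: "\<lbrakk>monad B S; restricts A B G S\<rbrakk> \<Longrightarrow> iso_colax_map A B G S (L S) (\<kappa> S) (l S)"
begin

lemma monad_P: "monad A T \<Longrightarrow> monad B (P T)"
  using pushforward.is_pushforward[OF pushforward] by (simp add: is_pushforward_def)

lemma restricts_P: 
  assumes "monad A T"
  shows "restricts A B G (P T)"
proof -
  interpret iso_colax_map A B G "P T" T "d T" "\<epsilon> T"
    by (rule counit_iso[OF assms])
  show ?thesis
    \<comment> \<open>The inverse laws are passed crosswise, since \<epsilon> occupies the position
      of \<open>l\<close> in \<open>iso_colax_map\<close>.\<close>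
    by (rule pushforward.restricts[OF pushforward[OF assms] colax.in_Hom l_\<kappa> \<kappa>_l])
qed

lemma monad_L: "\<lbrakk>monad B S; restricts A B G S\<rbrakk> \<Longrightarrow> monad A (L S)"
  using lift_iso by (simp add: iso_colax_map_def colax_map_def)

abbreviation "PF \<equiv> pushforward_functor A B G P \<epsilon>"
abbreviation "LF \<equiv> monad_lift_functor A B G L \<kappa>"

text \<open>Evaluates the definite description in \<open>pushforward_functor\<close>:
  \<open>lax_map_factor\<close> gives a solution that is a monad map, and
  \<open>factor_unique\<close> makes it the only natural transformation solving the
  equation.\<close>

lemma PF_map:
  assumes "monad_map A T S \<theta>"
  shows PF_monad_map: "monad_map B (P T) (P S) (far PF T S \<theta>)"
    and PF_eq: "a \<in> Ob A \<Longrightarrow>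
      Comp B (mob (P T) (fob G a)) (mob (P S) (fob G a)) (fob G (mob S a)) (\<epsilon> S a)
          (far PF T S \<theta> (fob G a))
      = Comp B (mob (P T) (fob G a)) (fob G (mob T a)) (fob G (mob S a))
          (far G (mob T a) (mob S a) (\<theta> a)) (\<epsilon> T a)"
proof -
  interpret \<theta>: monad_map A T S \<theta> by fact
  interpret T: pushforward A B G T "P T" "\<epsilon> T"
    by (rule pushforward[OF \<theta>.dom.monad_axioms])
  interpret S: pushforward A B G S "P S" "\<epsilon> S"
    by (rule pushforward[OF \<theta>.cod.monad_axioms])
  let ?Q = "\<lambda>\<phi>. nat_trans B B (mfun (P T)) (mfun (P S)) \<phi> \<and> (\<forall>a\<in>Ob A.
    Comp B (mob (P T) (fob G a)) (mob (P S) (fob G a)) (fob G (mob S a)) (\<epsilon> S a) (\<phi> (fob G a))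
      = Comp B (mob (P T) (fob G a)) (fob G (mob T a)) (fob G (mob S a))
          (far G (mob T a) (mob S a) (\<theta> a)) (\<epsilon> T a))"
  obtain \<phi> where \<phi>: "monad_map B (P T) (P S) \<phi>" and "?Q \<phi>"
    using S.lax_map_factor[OF T.comp_monad_map[OF \<theta>.monad_map_axioms]] monad_map.axioms(3) by blast
  moreover from \<open>?Q \<phi>\<close> have "\<phi>' = \<phi>" if "?Q \<phi>'" for \<phi>'
    using that by (intro S.factor_unique) auto
  ultimately have "(THE \<phi>. ?Q \<phi>) = \<phi>"
    by (intro the_equality)
  then have "far PF T S \<theta> = \<phi>"
    unfolding pushforward_functor_def
    using assms \<theta>.dom.monad_axioms \<theta>.cod.monad_axioms by simp
  with \<phi> \<open>?Q \<phi>\<close> show "monad_map B (P T) (P S) (far PF T S \<theta>)"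
    and "a \<in> Ob A \<Longrightarrow> Comp B (mob (P T) (fob G a)) (mob (P S) (fob G a)) (fob G (mob S a)) (\<epsilon> S a)
        (far PF T S \<theta> (fob G a))
      = Comp B (mob (P T) (fob G a)) (fob G (mob T a)) (fob G (mob S a))
          (far G (mob T a) (mob S a) (\<theta> a)) (\<epsilon> T a)"
    by simp_all
qed

text \<open>The same evaluation for the lift functor, by \<open>colax_map_factor\<close> and
  uniqueness of factors through \<kappa>.\<close>

lemma LF_map:
  assumes "monad_map B S R \<phi>" and "restricts A B G S" "restricts A B G R"
  shows LF_monad_map: "monad_map A (L S) (L R) (far LF S R \<phi>)"
    and LF_eq: "a \<in> Ob A \<Longrightarrow>
      Comp B (fob G (mob (L S) a)) (fob G (mob (L R) a)) (mob R (fob G a)) (\<kappa> R a)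
          (far G (mob (L S) a) (mob (L R) a) (far LF S R \<phi> a))
      = Comp B (fob G (mob (L S) a)) (mob S (fob G a)) (mob R (fob G a)) (\<phi> (fob G a)) (\<kappa> S a)"
proof -
  interpret \<phi>: monad_map B S R \<phi> by fact
  interpret S: iso_colax_map A B G S "L S" "\<kappa> S" "l S"
    by (rule lift_iso[OF \<phi>.dom.monad_axioms assms(2)])
  interpret R: iso_colax_map A B G R "L R" "\<kappa> R" "l R"
    by (rule lift_iso[OF \<phi>.cod.monad_axioms assms(3)])
  let ?Q = "\<lambda>\<theta>. nat_trans A A (mfun (L S)) (mfun (L R)) \<theta> \<and> (\<forall>a\<in>Ob A.
      Comp B (fob G (mob (L S) a)) (fob G (mob (L R) a)) (mob R (fob G a)) (\<kappa> R a)
          (far G (mob (L S) a) (mob (L R) a) (\<theta> a))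
      = Comp B (fob G (mob (L S) a)) (mob S (fob G a)) (mob R (fob G a)) (\<phi> (fob G a)) (\<kappa> S a))"
  obtain \<theta> where \<theta>: "monad_map A (L S) (L R) \<theta>" and "?Q \<theta>"
    using R.colax_map_factor[OF S.colax.comp_monad_map[OF \<phi>.monad_map_axioms]] monad_map.axioms(3)
        by blast
  moreover from \<open>?Q \<theta>\<close> have "\<theta>' = \<theta>" if "?Q \<theta>'" for \<theta>'
    using that by (intro R.factor_unique) auto
  ultimately have "(THE \<theta>. ?Q \<theta>) = \<theta>"
    by (intro the_equality)
  then have "far LF S R \<phi> = \<theta>"
    unfolding monad_lift_functor_def
    using assms \<phi>.dom.monad_axioms \<phi>.cod.monad_axioms by simp
  with \<theta> \<open>?Q \<theta>\<close> show "monad_map A (L S) (L R) (far LF S R \<phi>)"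
    and "a \<in> Ob A \<Longrightarrow>
      Comp B (fob G (mob (L S) a)) (fob G (mob (L R) a)) (mob R (fob G a)) (\<kappa> R a)
          (far G (mob (L S) a) (mob (L R) a) (far LF S R \<phi> a))
      = Comp B (fob G (mob (L S) a)) (mob S (fob G a)) (mob R (fob G a)) (\<phi> (fob G a)) (\<kappa> S a)"
    by simp_all
qed

lemma fob_PF [simp]: "monad A T \<Longrightarrow> fob PF T = P T"
  by (simp add: pushforward_functor_def)

lemma fob_LF [simp]: "\<lbrakk>monad B S; restricts A B G S\<rbrakk> \<Longrightarrow> fob LF S = L S"
  by (simp add: monad_lift_functor_def)

lemma P_eqI:
  assumes T: "monad A T" and \<phi>: "monad_map B M (P T) \<phi>" "monad_map B M (P T) \<phi>'"
    and "\<And>a. a \<in> Ob A \<Longrightarrow> Comp B (mob M (fob G a)) (mob (P T) (fob G a)) (fob G (mob T a)) (\<epsilon> T a)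
        (\<phi> (fob G a))
      = Comp B (mob M (fob G a)) (mob (P T) (fob G a)) (fob G (mob T a)) (\<epsilon> T a) (\<phi>' (fob G a))"
  shows "\<phi> = \<phi>'"
proof -
  interpret T: pushforward A B G T "P T" "\<epsilon> T"
    by (rule pushforward[OF T])
  show ?thesis
    by (rule T.factor_unique[OF \<phi>[THEN monad_map.axioms(3)] assms(4)])
qed

lemma L_eqI:
  assumes T: "monad A T" and \<theta>: "monad_map A M T \<theta>" "monad_map A M T \<theta>'"
    and "\<And>a. a \<in> Ob A \<Longrightarrow> far G (mob M a) (mob T a) (\<theta> a) = far G (mob M a) (mob T a) (\<theta>' a)"
  shows "\<theta> = \<theta>'"
proof (rule nat_trans_eqI)
  interpret \<theta>: monad_map A M T \<theta> by fact
  interpret \<theta>': monad_map A M T \<theta>' by fact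
  show "nat_trans A A (mfun M) (mfun T) \<theta>" "nat_trans A A (mfun M) (mfun T) \<theta>'"
    by (rule \<theta>.nat_trans_axioms \<theta>'.nat_trans_axioms)+
  fix a assume a: "a \<in> Ob A"
  show "\<theta> a = \<theta>' a"
    by (rule far_eq_imp_eq[OF assms(4)[OF a]]) (use a \<theta>.component \<theta>'.component in auto)
qed

text \<open>By \<open>P_eqI\<close> a monad map into a pushforward is known by its composite with
  the counit, so functoriality is read off from \<open>PF_eq\<close>.\<close>

lemma cfunctor_PF: "cfunctor (Mnd A) (Mnd_res A B G) PF"
proof (rule cfunctor_of_mk_functor[OF pushforward_functor_def category_Mnd category_Mnd_res])
  fix T assume "T \<in> Ob (Mnd A)"
  then have T: "monad A T"
    by simp
  interpret T: pushforward A B G T "P T" "\<epsilon> T"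
    by (rule pushforward[OF T])
  note id = monad_map_nat_id[OF T]
  show "far PF T T (Idn (Mnd A) T) = Idn (Mnd_res A B G) (P T)"
    unfolding Mnd_simps Mnd_res_simps
    by (rule P_eqI[OF T PF_monad_map[OF id] monad_map_nat_id[OF monad_P[OF T]]])
      (simp add: PF_eq[OF id])
next
  fix T S R \<theta> \<phi> assume "\<theta> \<in> Hom (Mnd A) T S" "\<phi> \<in> Hom (Mnd A) S R"
  then have \<theta>: "monad_map A T S \<theta>" and \<phi>: "monad_map A S R \<phi>"
    by simp_all
  interpret \<theta>: monad_map A T S \<theta> by fact
  interpret \<phi>: monad_map A S R \<phi> by fact
  interpret T: pushforward A B G T "P T" "\<epsilon> T"
    by (rule pushforward[OF \<theta>.dom.monad_axioms])
  interpret S: pushforward A B G S "P S" "\<epsilon> S"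
    by (rule pushforward[OF \<theta>.cod.monad_axioms])
  interpret R: pushforward A B G R "P R" "\<epsilon> R"
    by (rule pushforward[OF \<phi>.cod.monad_axioms])
  interpret P\<theta>: monad_map B "P T" "P S" "far PF T S \<theta>"
    by (rule PF_monad_map[OF \<theta>])
  interpret P\<phi>: monad_map B "P S" "P R" "far PF S R \<phi>"
    by (rule PF_monad_map[OF \<phi>])
  note [simp] = \<theta>.component \<phi>.component P\<theta>.component P\<phi>.component
  note comp = monad_map_nat_comp[OF \<theta> \<phi>]
  show "far PF T R (Comp (Mnd A) T S R \<phi> \<theta>)
      = Comp (Mnd_res A B G) (P T) (P S) (P R) (far PF S R \<phi>) (far PF T S \<theta>)"
    unfolding Mnd_simps Mnd_res_simps
    by (rule P_eqI[OF \<phi>.cod.monad_axioms PF_monad_map[OF comp]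
        monad_map_nat_comp[OF P\<theta>.monad_map_axioms P\<phi>.monad_map_axioms]])
      (simp add: PF_eq[OF comp] PF_eq[OF \<theta>] cod.Comp_eq_Comp_right[OF PF_eq[OF \<phi>]])
qed (auto simp: monad_P restricts_P PF_monad_map)

lemma cfunctor_LF: "cfunctor (Mnd_res A B G) (Mnd A) LF"
proof (rule cfunctor_of_mk_functor[OF monad_lift_functor_def category_Mnd_res category_Mnd])
  fix S assume "S \<in> Ob (Mnd_res A B G)"
  then have S: "monad B S" "restricts A B G S"
    by simp_all
  interpret S: iso_colax_map A B G S "L S" "\<kappa> S" "l S"
    by (rule lift_iso[OF S])
  note id = monad_map_nat_id[OF S(1)]
  note L_id = monad_map_nat_id[OF monad_L[OF S]]
  show "far LF S S (Idn (Mnd_res A B G) S) = Idn (Mnd A) (L S)"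
    unfolding Mnd_simps Mnd_res_simps
    by (rule S.factor_unique[OF monad_map.axioms(3)[OF LF_monad_map[OF id S(2,2)]]
        monad_map.axioms(3)[OF L_id]])
      (simp add: LF_eq[OF id S(2,2)])
next
  fix S R Q \<phi> \<psi> assume "S \<in> Ob (Mnd_res A B G)" "R \<in> Ob (Mnd_res A B G)" "Q \<in> Ob (Mnd_res A B G)"
    "\<phi> \<in> Hom (Mnd_res A B G) S R" "\<psi> \<in> Hom (Mnd_res A B G) R Q"
  then have S: "monad B S" "restricts A B G S" and R: "monad B R" "restricts A B G R"
    and Q: "monad B Q" "restricts A B G Q" and \<phi>: "monad_map B S R \<phi>" and \<psi>: "monad_map B R Q \<psi>"
    by simp_all
  interpret \<phi>: monad_map B S R \<phi> by fact
  interpret \<psi>: monad_map B R Q \<psi> by fact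
  interpret S: iso_colax_map A B G S "L S" "\<kappa> S" "l S"
    by (rule lift_iso[OF S])
  interpret R: iso_colax_map A B G R "L R" "\<kappa> R" "l R"
    by (rule lift_iso[OF R])
  interpret Q: iso_colax_map A B G Q "L Q" "\<kappa> Q" "l Q"
    by (rule lift_iso[OF Q])
  interpret L\<phi>: monad_map A "L S" "L R" "far LF S R \<phi>"
    by (rule LF_monad_map[OF \<phi> S(2) R(2)])
  interpret L\<psi>: monad_map A "L R" "L Q" "far LF R Q \<psi>"
    by (rule LF_monad_map[OF \<psi> R(2) Q(2)])
  note [simp] = \<phi>.component \<psi>.component L\<phi>.component L\<psi>.component
  note comp = monad_map_nat_comp[OF \<phi> \<psi>]
  note eqs = LF_eq[OF \<phi> S(2) R(2)] LF_eq[OF \<psi> R(2) Q(2)]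
  show "far LF S Q (Comp (Mnd_res A B G) S R Q \<psi> \<phi>)
      = Comp (Mnd A) (L S) (L R) (L Q) (far LF R Q \<psi>) (far LF S R \<phi>)"
    unfolding Mnd_simps Mnd_res_simps
    by (rule Q.factor_unique[OF monad_map.axioms(3)[OF LF_monad_map[OF comp S(2) Q(2)]]
        nat_trans_nat_comp[OF L\<phi>.nat_trans_axioms L\<psi>.nat_trans_axioms]])
      (simp add: LF_eq[OF comp S(2) Q(2)] eqs cod.Comp_eq_Comp_right[OF eqs(2)])
qed (auto simp: monad_L LF_monad_map)

text \<open>\<open>\<phi> \<circ> d T\<close> is a colax map out of \<open>G T\<close>. It factors
  through \<open>d S\<close> by some \<open>G \<theta>\<close>, and inverting both \<open>d\<close>
  turns this equation into the one characterising the image of \<theta>.\<close>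

lemma full_PF: "full_functor (Mnd A) (Mnd_res A B G) PF"
  unfolding full_functor_def
proof (intro ballI)
  fix T S \<phi> assume "T \<in> Ob (Mnd A)" "S \<in> Ob (Mnd A)" "\<phi> \<in> Hom (Mnd_res A B G) (fob PF T) (fob PF S)"
  then have T: "monad A T" and S: "monad A S" and \<phi>: "monad_map B (P T) (P S) \<phi>"
    by simp_all
  interpret \<phi>: monad_map B "P T" "P S" \<phi> by fact
  interpret T: iso_colax_map A B G "P T" T "d T" "\<epsilon> T"
    by (rule counit_iso[OF T])
  interpret S: iso_colax_map A B G "P S" S "d S" "\<epsilon> S"
    by (rule counit_iso[OF S])
  note [simp] = \<phi>.component
  note right = cod.Comp_eq_Comp_right
  obtain \<theta> where \<theta>: "monad_map A T S \<theta>" and d_\<theta>: "\<And>a. a \<in> Ob A \<Longrightarrow>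
      Comp B (fob G (mob T a)) (fob G (mob S a)) (mob (P S) (fob G a)) (d S a)
          (far G (mob T a) (mob S a) (\<theta> a))
      = Comp B (fob G (mob T a)) (mob (P T) (fob G a)) (mob (P S) (fob G a)) (\<phi> (fob G a)) (d T a)"
    using S.colax_map_factor[OF T.colax.comp_monad_map[OF \<phi>]] by blast
  interpret \<theta>: monad_map A T S \<theta> by fact
  note [simp] = \<theta>.component
  have "far PF T S \<theta> = \<phi>"
  proof (rule P_eqI[OF S PF_monad_map[OF \<theta>] \<phi>])
    fix a assume a: "a \<in> Ob A"
    \<comment> \<open>The identity \<open>\<epsilon> S \<circ> d S\<close> is inserted in front, so
      that \<open>d_\<theta>\<close> can replace \<open>d S \<circ> G \<theta>\<close>.\<close>
    have "Comp B (mob (P T) (fob G a)) (fob G (mob T a)) (fob G (mob S a))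
        (far G (mob T a) (mob S a) (\<theta> a)) (\<epsilon> T a)
      = Comp B (mob (P T) (fob G a)) (mob (P S) (fob G a)) (fob G (mob S a)) (\<epsilon> S a)
          (Comp B (mob (P T) (fob G a)) (fob G (mob T a)) (mob (P S) (fob G a))
          (Comp B (fob G (mob T a)) (fob G (mob S a)) (mob (P S) (fob G a)) (d S a)
          (far G (mob T a) (mob S a) (\<theta> a))) (\<epsilon> T a))"
      using a by (simp add: right[OF S.l_\<kappa>])
    also have "\<dots> = Comp B (mob (P T) (fob G a)) (mob (P S) (fob G a)) (fob G (mob S a)) (\<epsilon> S a)
        (\<phi> (fob G a))"
      unfolding d_\<theta>[OF a] using a by (simp add: T.\<kappa>_l)
    finally show "Comp B (mob (P T) (fob G a)) (mob (P S) (fob G a)) (fob G (mob S a)) (\<epsilon> S a)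
        (far PF T S \<theta> (fob G a))
      = Comp B (mob (P T) (fob G a)) (mob (P S) (fob G a)) (fob G (mob S a)) (\<epsilon> S a) (\<phi> (fob G a))"
      using a by (simp add: PF_eq[OF \<theta>])
  qed
  with \<theta> show "\<exists>\<theta>\<in>Hom (Mnd A) T S. far PF T S \<theta> = \<phi>"
    by auto
qed

text \<open>\<open>PF_eq\<close> recovers \<open>G \<theta> \<circ> \<epsilon> T\<close> from the
  image of \<theta>; \<open>d T\<close> cancels the counit on the right, and \<open>G\<close> is
  faithful.\<close>

lemma faithful_PF: "faithful_functor (Mnd A) PF"
  unfolding faithful_functor_def
proof (intro ballI inj_onI)
  fix T S \<theta> \<theta>' assume "\<theta> \<in> Hom (Mnd A) T S" "\<theta>' \<in> Hom (Mnd A) T S" and eq: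
      "far PF T S \<theta> = far PF T S \<theta>'"
  then have \<theta>: "monad_map A T S \<theta>" and \<theta>': "monad_map A T S \<theta>'"
    by simp_all
  interpret \<theta>: monad_map A T S \<theta> by fact
  interpret \<theta>': monad_map A T S \<theta>' by fact
  interpret T: iso_colax_map A B G "P T" T "d T" "\<epsilon> T"
    by (rule counit_iso[OF \<theta>.dom.monad_axioms])
  note [simp] = \<theta>.component \<theta>'.component
  show "\<theta> = \<theta>'"
  proof (rule L_eqI[OF \<theta>.cod.monad_axioms \<theta> \<theta>'])
    fix a assume a: "a \<in> Ob A"
    have "Comp B (mob (P T) (fob G a)) (fob G (mob T a)) (fob G (mob S a))
        (far G (mob T a) (mob S a) (\<theta> a)) (\<epsilon> T a)
      = Comp B (mob (P T) (fob G a)) (fob G (mob T a)) (fob G (mob S a))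
          (far G (mob T a) (mob S a) (\<theta>' a)) (\<epsilon> T a)"
      using PF_eq[OF \<theta> a] PF_eq[OF \<theta>' a] eq by simp
    from arg_cong[OF this, of "\<lambda>h. Comp B (fob G (mob T a)) (mob (P T) (fob G a)) (fob G (mob S a))
        h (d T a)"] a
    show "far G (mob T a) (mob S a) (\<theta> a) = far G (mob T a) (mob S a) (\<theta>' a)"
      by (simp add: T.l_\<kappa>)
  qed
qed

text \<open>The inverse \<open>l S\<close> of \<kappa> is lax, so it factors through the counit of
  the pushforward of \<open>L S\<close>.\<close>

lemma ex_unit:
  assumes "monad B S" "restricts A B G S"
  shows "\<exists>u. monad_map B S (P (L S)) u \<and> (\<forall>a\<in>Ob A.
    Comp B (mob S (fob G a)) (mob (P (L S)) (fob G a)) (fob G (mob (L S) a)) (\<epsilon> (L S) a)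
        (u (fob G a)) = l S a)"
  using pushforward.lax_map_factor[OF pushforward[OF monad_L[OF assms]]]
    iso_colax_map.axioms(3)[OF lift_iso[OF assms]] by blast

text \<open>\<kappa> of the pushforward is colax, so it factors through \<open>d T\<close>. The
  factorisation is solved for \<open>G c\<close>, the form in which it rewrites.\<close>

lemma ex_counit:
  assumes T: "monad A T"
  shows "\<exists>c. monad_map A (L (P T)) T c \<and> (\<forall>a\<in>Ob A. far G (mob (L (P T)) a) (mob T a) (c a)
    = Comp B (fob G (mob (L (P T)) a)) (mob (P T) (fob G a)) (fob G (mob T a)) (\<epsilon> T a) (\<kappa> (P T) a))"
proof -
  interpret T: iso_colax_map A B G "P T" T "d T" "\<epsilon> T"
    by (rule counit_iso[OF T])
  interpret PT: iso_colax_map A B G "P T" "L (P T)" "\<kappa> (P T)" "l (P T)"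
    by (rule lift_iso[OF monad_P[OF T] restricts_P[OF T]])
  obtain c where c: "monad_map A (L (P T)) T c" and d_c: "\<And>a. a \<in> Ob A \<Longrightarrow>
      Comp B (fob G (mob (L (P T)) a)) (fob G (mob T a)) (mob (P T) (fob G a)) (d T a)
          (far G (mob (L (P T)) a) (mob T a) (c a))
      = \<kappa> (P T) a"
    using T.colax_map_factor[OF PT.colax.colax_map_axioms] by auto
  interpret c: monad_map A "L (P T)" T c by fact
  note [simp] = c.component
  show ?thesis
  proof (intro exI[of _ c] conjI ballI c)
    fix a assume a: "a \<in> Ob A"
    show "far G (mob (L (P T)) a) (mob T a) (c a)
      = Comp B (fob G (mob (L (P T)) a)) (mob (P T) (fob G a)) (fob G (mob T a)) (\<epsilon> T a)
          (\<kappa> (P T) a)"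
      unfolding d_c[OF a, symmetric] using a by (simp add: cod.Comp_eq_Comp_right[OF T.l_\<kappa>])
  qed
qed

text \<open>Equations of maps into a pushforward are tested after \<epsilon>, which turns the unit
  into \<open>l\<close>; those of maps in \<open>Mnd A\<close> are tested after \<open>G\<close>,
  which turns the counit into \<open>\<epsilon> \<circ> \<kappa>\<close>.\<close>

lemma adjunction: "adjunction (Mnd_res A B G) (Mnd A) LF PF"
proof -
  have "\<exists>u. \<forall>S\<in>Ob (Mnd_res A B G). monad_map B S (P (L S)) (u S) \<and> (\<forall>a\<in>Ob A.
    Comp B (mob S (fob G a)) (mob (P (L S)) (fob G a)) (fob G (mob (L S) a)) (\<epsilon> (L S) a)
        (u S (fob G a)) = l S a)"
    by (intro bchoice ballI ex_unit) auto
  then obtain u where u: "\<And>S. \<lbrakk>monad B S; restricts A B G S\<rbrakk> \<Longrightarrow> monad_map B S (P (L S)) (u S)"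
    and \<epsilon>_u: "\<And>S a. \<lbrakk>monad B S; restricts A B G S; a \<in> Ob A\<rbrakk> \<Longrightarrow>
      Comp B (mob S (fob G a)) (mob (P (L S)) (fob G a)) (fob G (mob (L S) a)) (\<epsilon> (L S) a)
          (u S (fob G a)) = l S a"
    by auto
  have "\<exists>c. \<forall>T\<in>Ob (Mnd A). monad_map A (L (P T)) T (c T)
      \<and> (\<forall>a\<in>Ob A. far G (mob (L (P T)) a) (mob T a) (c T a)
    = Comp B (fob G (mob (L (P T)) a)) (mob (P T) (fob G a)) (fob G (mob T a)) (\<epsilon> T a) (\<kappa> (P T) a))"
    by (intro bchoice ballI ex_counit) auto
  then obtain c where c: "\<And>T. monad A T \<Longrightarrow> monad_map A (L (P T)) T (c T)"
    and G_c: "\<And>T a. \<lbrakk>monad A T; a \<in> Ob A\<rbrakk> \<Longrightarrow> far G (mob (L (P T)) a) (mob T a) (c T a)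
      = Comp B (fob G (mob (L (P T)) a)) (mob (P T) (fob G a)) (fob G (mob T a)) (\<epsilon> T a)
          (\<kappa> (P T) a)"
    by auto
  let ?u = "\<lambda>S\<in>Ob (Mnd_res A B G). u S" and ?c = "\<lambda>T\<in>Ob (Mnd A). c T"
  note right = cod.Comp_eq_Comp_right
  have "nat_trans (Mnd_res A B G) (Mnd_res A B G) (idf (Mnd_res A B G))
      (cfcomp (Mnd_res A B G) PF LF) ?u"
  proof (rule nat_transI[OF cfunctor_idf[OF category_Mnd_res]
      cfunctor_cfcomp[OF cfunctor_LF cfunctor_PF]])
    fix S R \<phi> assume *: "S \<in> Ob (Mnd_res A B G)" "R \<in> Ob (Mnd_res A B G)"
        "\<phi> \<in> Hom (Mnd_res A B G) S R"
    then have S: "monad B S" "restricts A B G S" and R: "monad B R" "restricts A B G R"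
      and \<phi>: "monad_map B S R \<phi>"
      by simp_all
    interpret \<phi>: monad_map B S R \<phi> by fact
    interpret S: iso_colax_map A B G S "L S" "\<kappa> S" "l S"
      by (rule lift_iso[OF S])
    interpret R: iso_colax_map A B G R "L R" "\<kappa> R" "l R"
      by (rule lift_iso[OF R])
    interpret PLS: pushforward A B G "L S" "P (L S)" "\<epsilon> (L S)"
      by (rule pushforward[OF monad_L[OF S]])
    interpret PLR: pushforward A B G "L R" "P (L R)" "\<epsilon> (L R)"
      by (rule pushforward[OF monad_L[OF R]])
    interpret uS: monad_map B S "P (L S)" "u S"
      by (rule u[OF S])
    interpret uR: monad_map B R "P (L R)" "u R"
      by (rule u[OF R])
    note L\<phi> = LF_monad_map[OF \<phi> S(2) R(2)]
    interpret L\<phi>: monad_map A "L S" "L R" "far LF S R \<phi>"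
      by (rule L\<phi>)
    note PL\<phi> = PF_monad_map[OF L\<phi>]
    interpret PL\<phi>: monad_map B "P (L S)" "P (L R)" "far PF (L S) (L R) (far LF S R \<phi>)"
      by (rule PL\<phi>)
    note [simp] = \<phi>.component uS.component uR.component L\<phi>.component PL\<phi>.component
    have "nat_comp B B (mfun S) (mfun R) (mfun (P (L R))) (u R) \<phi>
      = nat_comp B B (mfun S) (mfun (P (L S))) (mfun (P (L R))) (far PF (L S) (L R) (far LF S R \<phi>))
          (u S)"
    proof (rule P_eqI[OF monad_L[OF R] monad_map_nat_comp[OF \<phi> u[OF R]]
        monad_map_nat_comp[OF u[OF S] PL\<phi>]])
      fix a assume a: "a \<in> Ob A"
      \<comment> \<open>Naturality of \<open>l\<close> in the monad: the square \<open>LF_eq\<close>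
        for \<kappa> with its sides inverted.\<close>
      have l_\<phi>: "Comp B (mob S (fob G a)) (mob R (fob G a)) (fob G (mob (L R) a)) (l R a)
          (\<phi> (fob G a))
        = Comp B (mob S (fob G a)) (fob G (mob (L S) a)) (fob G (mob (L R) a))
            (far G (mob (L S) a) (mob (L R) a) (far LF S R \<phi> a)) (l S a)"
        by (rule cod.inverse_square[OF _ _ _ _ _ _ _ _ S.\<kappa>_l R.l_\<kappa>])
          (use a in \<open>auto simp: LF_eq[OF \<phi> S(2) R(2)]\<close>)
      show "Comp B (mob S (fob G a)) (mob (P (L R)) (fob G a)) (fob G (mob (L R) a)) (\<epsilon> (L R) a)
          (nat_comp B B (mfun S) (mfun R) (mfun (P (L R))) (u R) \<phi> (fob G a))
        = Comp B (mob S (fob G a)) (mob (P (L R)) (fob G a)) (fob G (mob (L R) a)) (\<epsilon> (L R) a)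
            (nat_comp B B (mfun S) (mfun (P (L S))) (mfun (P (L R)))
            (far PF (L S) (L R) (far LF S R \<phi>)) (u S) (fob G a))"
        using a by (simp add: right[OF \<epsilon>_u[OF R]] right[OF PF_eq[OF L\<phi>]] \<epsilon>_u[OF S] l_\<phi>)
    qed
    then show "Comp (Mnd_res A B G) (fob (idf (Mnd_res A B G)) S) (fob (idf (Mnd_res A B G)) R)
        (fob (cfcomp (Mnd_res A B G) PF LF) R) (?u R) (far (idf (Mnd_res A B G)) S R \<phi>)
      = Comp (Mnd_res A B G) (fob (idf (Mnd_res A B G)) S) (fob (cfcomp (Mnd_res A B G) PF LF) S)
        (fob (cfcomp (Mnd_res A B G) PF LF) R) (far (cfcomp (Mnd_res A B G) PF LF) S R \<phi>) (?u S)"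
      using * S R by (simp add: monad_L)
  qed (auto simp: monad_L u)
  moreover have "nat_trans (Mnd A) (Mnd A) (cfcomp (Mnd A) LF PF) (idf (Mnd A)) ?c"
  proof (rule nat_transI[OF cfunctor_cfcomp[OF cfunctor_PF cfunctor_LF]
      cfunctor_idf[OF category_Mnd]])
    fix T S \<theta> assume *: "T \<in> Ob (Mnd A)" "S \<in> Ob (Mnd A)" "\<theta> \<in> Hom (Mnd A) T S"
    then have T: "monad A T" and S: "monad A S" and \<theta>: "monad_map A T S \<theta>"
      by simp_all
    interpret \<theta>: monad_map A T S \<theta> by fact
    interpret PT: pushforward A B G T "P T" "\<epsilon> T"
      by (rule pushforward[OF T])
    interpret PS: pushforward A B G S "P S" "\<epsilon> S"
      by (rule pushforward[OF S])
    interpret LPT: iso_colax_map A B G "P T" "L (P T)" "\<kappa> (P T)" "l (P T)"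
      by (rule lift_iso[OF monad_P[OF T] restricts_P[OF T]])
    interpret LPS: iso_colax_map A B G "P S" "L (P S)" "\<kappa> (P S)" "l (P S)"
      by (rule lift_iso[OF monad_P[OF S] restricts_P[OF S]])
    interpret cT: monad_map A "L (P T)" T "c T"
      by (rule c[OF T])
    interpret cS: monad_map A "L (P S)" S "c S"
      by (rule c[OF S])
    note P\<theta> = PF_monad_map[OF \<theta>]
    interpret P\<theta>: monad_map B "P T" "P S" "far PF T S \<theta>"
      by (rule P\<theta>)
    note LP\<theta> = LF_monad_map[OF P\<theta> restricts_P[OF T] restricts_P[OF S]]
    interpret LP\<theta>: monad_map A "L (P T)" "L (P S)" "far LF (P T) (P S) (far PF T S \<theta>)"
      by (rule LP\<theta>)
    note [simp] = \<theta>.component cT.component cS.component P\<theta>.component LP\<theta>.component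
    \<comment> \<open>After \<open>G\<close>, \<open>LF_eq\<close> moves \<kappa> to the right and
      \<open>PF_eq\<close> moves \<epsilon> past the image of \<theta>; both sides become
      \<open>G \<theta> \<circ> \<epsilon> T \<circ> \<kappa> (P T)\<close>.\<close>
    have "nat_comp A A (mfun (L (P T))) (mfun (L (P S))) (mfun S) (c S)
        (far LF (P T) (P S) (far PF T S \<theta>))
      = nat_comp A A (mfun (L (P T))) (mfun T) (mfun S) \<theta> (c T)"
      by (rule L_eqI[OF S monad_map_nat_comp[OF LP\<theta> c[OF S]] monad_map_nat_comp[OF c[OF T] \<theta>]])
        (simp add: G_c[OF S] G_c[OF T] LF_eq[OF P\<theta> restricts_P[OF T] restricts_P[OF S]]
            right[OF PF_eq[OF \<theta>]])
    then show "Comp (Mnd A) (fob (cfcomp (Mnd A) LF PF) T) (fob (cfcomp (Mnd A) LF PF) S)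
        (fob (idf (Mnd A)) S) (?c S) (far (cfcomp (Mnd A) LF PF) T S \<theta>)
      = Comp (Mnd A) (fob (cfcomp (Mnd A) LF PF) T) (fob (idf (Mnd A)) T)
        (fob (idf (Mnd A)) S) (far (idf (Mnd A)) T S \<theta>) (?c T)"
      using * T S by (simp add: monad_P restricts_P)
  qed (auto simp: monad_P restricts_P c)
  moreover have "Comp (Mnd A) (fob LF S) (fob LF (fob PF (fob LF S))) (fob LF S)
      (?c (fob LF S)) (far LF S (fob PF (fob LF S)) (?u S)) = Idn (Mnd A) (fob LF S)"
    if "S \<in> Ob (Mnd_res A B G)" for S
  proof -
    from that have S: "monad B S" "restricts A B G S"
      by simp_all
    note LS = monad_L[OF S]
    note PLS = monad_P[OF LS] restricts_P[OF LS]
    interpret S: iso_colax_map A B G S "L S" "\<kappa> S" "l S"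
      by (rule lift_iso[OF S])
    interpret PLS: pushforward A B G "L S" "P (L S)" "\<epsilon> (L S)"
      by (rule pushforward[OF LS])
    interpret LPLS: iso_colax_map A B G "P (L S)" "L (P (L S))" "\<kappa> (P (L S))" "l (P (L S))"
      by (rule lift_iso[OF PLS])
    interpret u: monad_map B S "P (L S)" "u S"
      by (rule u[OF S])
    interpret c: monad_map A "L (P (L S))" "L S" "c (L S)"
      by (rule c[OF LS])
    note Lu = LF_monad_map[OF u[OF S] S(2) PLS(2)]
    interpret Lu: monad_map A "L S" "L (P (L S))" "far LF S (P (L S)) (u S)"
      by (rule Lu)
    note [simp] = u.component c.component Lu.component
    \<comment> \<open>After \<open>G\<close>:
      \<open>\<epsilon> \<circ> \<kappa> \<circ> G (L u)\<close> is
      \<open>\<epsilon> \<circ> u \<circ> \<kappa>\<close>, hence \<open>l \<circ> \<kappa>\<close>,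
      the identity.\<close>
    have "nat_comp A A (mfun (L S)) (mfun (L (P (L S)))) (mfun (L S)) (c (L S))
        (far LF S (P (L S)) (u S))
      = nat_id A A (mfun (L S))"
      by (rule L_eqI[OF LS monad_map_nat_comp[OF Lu c[OF LS]] monad_map_nat_id[OF LS]])
        (simp add: G_c[OF LS] LF_eq[OF u[OF S] S(2) PLS(2)] right[OF \<epsilon>_u[OF S]] S.l_\<kappa>)
    then show ?thesis
      using S LS PLS by simp
  qed
  moreover have "Comp (Mnd_res A B G) (fob PF T) (fob PF (fob LF (fob PF T))) (fob PF T)
      (far PF (fob LF (fob PF T)) T (?c T)) (?u (fob PF T)) = Idn (Mnd_res A B G) (fob PF T)"
    if "T \<in> Ob (Mnd A)" for T
  proof -
    from that have T: "monad A T"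
      by simp
    note PT = monad_P[OF T] restricts_P[OF T]
    note LPT = monad_L[OF PT]
    interpret PT: pushforward A B G T "P T" "\<epsilon> T"
      by (rule pushforward[OF T])
    interpret LPT: iso_colax_map A B G "P T" "L (P T)" "\<kappa> (P T)" "l (P T)"
      by (rule lift_iso[OF PT])
    interpret PLPT: pushforward A B G "L (P T)" "P (L (P T))" "\<epsilon> (L (P T))"
      by (rule pushforward[OF LPT])
    interpret u: monad_map B "P T" "P (L (P T))" "u (P T)"
      by (rule u[OF PT])
    interpret c: monad_map A "L (P T)" T "c T"
      by (rule c[OF T])
    note Pc = PF_monad_map[OF c[OF T]]
    interpret Pc: monad_map B "P (L (P T))" "P T" "far PF (L (P T)) T (c T)"
      by (rule Pc)
    note [simp] = u.component c.component Pc.component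
    \<comment> \<open>After \<epsilon>: \<open>\<epsilon> \<circ> P c \<circ> u\<close> is
      \<open>G c \<circ> \<epsilon> \<circ> u\<close>, then
      \<open>\<epsilon> \<circ> \<kappa> \<circ> l\<close>, which is \<epsilon>.\<close>
    have "nat_comp B B (mfun (P T)) (mfun (P (L (P T)))) (mfun (P T)) (far PF (L (P T)) T (c T))
        (u (P T))
      = nat_id B B (mfun (P T))"
      by (rule P_eqI[OF T monad_map_nat_comp[OF u[OF PT] Pc] monad_map_nat_id[OF PT(1)]])
        (simp add: right[OF PF_eq[OF c[OF T]]] \<epsilon>_u[OF PT] G_c[OF T] right[OF LPT.\<kappa>_l] LPT.\<kappa>_l)
    then show ?thesis
      using T PT LPT by simp
  qed
  ultimately show ?thesis
    unfolding adjunction_def using cfunctor_LF cfunctor_PF by blast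
qed

end

text \<open>Pushforwards and lifts are determined only up to isomorphism. The first two parts
  therefore give existence and a unique monad structure on every Kan extension or lift; the last
  treats all possible choices at once.\<close>

theorem theorem2p11:
  fixes A :: "('a, 'u) category" and B :: "('b, 'u) category"
    and G :: "('a, 'u, 'b, 'u) cfunctor"
  assumes "universe TYPE('u)"
    and "locally_small A" and "locally_small B"
    and "cfunctor A B G" and "full_functor A B G" and "faithful_functor A G"
    and "representably_small A B G"
    and "complete_category B"
  shows "(\<forall>T\<in>Ob (Mnd A).
            (\<exists>R \<epsilon>. right_kan_extension A B B G (cfcomp A G (mfun T)) R \<epsilon>) \<and>
            (\<forall>R \<epsilon>. right_kan_extension A B B G (cfcomp A G (mfun T)) R \<epsilon> \<longrightarrow>
               (\<exists>!P. mfun P = R \<and> is_pushforward A B G T P \<epsilon>))) \<and>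
         (\<forall>S\<in>Ob (Mnd_res A B G).
            (\<exists>K \<kappa>. right_kan_lift A A B G (cfcomp A (mfun S) G) K \<kappa>) \<and>
            (\<forall>K \<kappa>. right_kan_lift A A B G (cfcomp A (mfun S) G) K \<kappa> \<longrightarrow>
               (\<exists>!L. mfun L = K \<and> is_monad_lift A B G S L \<kappa>))) \<and>
         (\<forall>P \<epsilon> L \<kappa>. pushforward_choice A B G P \<epsilon> \<longrightarrow> monad_lift_choice A B G L \<kappa> \<longrightarrow>
            cfunctor (Mnd A) (Mnd_res A B G) (pushforward_functor A B G P \<epsilon>) \<and>
            cfunctor (Mnd_res A B G) (Mnd A) (monad_lift_functor A B G L \<kappa>) \<and>
            adjunction (Mnd_res A B G) (Mnd A)
              (monad_lift_functor A B G L \<kappa>) (pushforward_functor A B G P \<epsilon>) \<and>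
            full_functor (Mnd A) (Mnd_res A B G) (pushforward_functor A B G P \<epsilon>) \<and>
            faithful_functor (Mnd A) (pushforward_functor A B G P \<epsilon>))"
proof (intro conjI ballI allI impI)
  interpret ff_functor A B G
    using assms(4-6) by (simp add: ff_functor_def ff_functor_axioms_def)
  have small_span: "small_span A B B G (cfcomp A G (mfun T))" if "monad A T" for T
  proof -
    interpret T: monad A T by fact
    show ?thesis
      using assms(2,3) cfunctor_axioms
          cfunctor_cfcomp[OF T.unit.tgt.cfunctor_axioms cfunctor_axioms]
      by (simp add: small_span_def span_def small_span_axioms_def)
  qed
  have ext: "\<exists>R \<epsilon>. span.pointwise_extension A B B G (cfcomp A G (mfun T)) R \<epsilon>" if T: "monad A T" for
      T
  proof -
    interpret small_span A B B G "cfcomp A G (mfun T)"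
      by (rule small_span[OF T])
    show ?thesis
      by (rule pointwise_extension_exists[OF comma_limit_exists])
        (use assms(7,8) in \<open>auto simp: representably_small_def\<close>)
  qed
  \<comment> \<open>The given Kan extension is arbitrary; it is pointwise because the constructed
    one is.\<close>
  have ext_locale: "pointwise_monad_extension A B G T R \<epsilon>"
    if T: "monad A T" and R: "right_kan_extension A B B G (cfcomp A G (mfun T)) R \<epsilon>" for T R \<epsilon>
  proof -
    interpret small_span A B B G "cfcomp A G (mfun T)"
      by (rule small_span[OF T])
    have "pointwise_extension R \<epsilon>"
      using ext[OF T] right_kan_extension_pointwise[OF R] by blast
    then show ?thesis
      using T cfunctor_axioms
      by (simp add: pointwise_monad_extension_def pointwise_monad_extension_axioms_def
          pointwise_extension_def)
  qed
  {
    fix T assume "T \<in> Ob (Mnd A)"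
    then have T: "monad A T"
      by simp
    interpret small_span A B B G "cfcomp A G (mfun T)"
      by (rule small_span[OF T])
    show "\<exists>R \<epsilon>. right_kan_extension A B B G (cfcomp A G (mfun T)) R \<epsilon>"
      using ext[OF T] pointwise_right_kan_extension by blast
    show "\<exists>!P. mfun P = R \<and> is_pushforward A B G T P \<epsilon>"
      if "right_kan_extension A B B G (cfcomp A G (mfun T)) R \<epsilon>" for R \<epsilon>
      by (rule pointwise_monad_extension.ex1_pushforward[OF ext_locale[OF T that]])
  next
    fix S assume "S \<in> Ob (Mnd_res A B G)"
    then have S: "monad B S" "restricts A B G S"
      by simp_all
    show "\<exists>K \<kappa>. right_kan_lift A A B G (cfcomp A (mfun S) G) K \<kappa>"
      using restricts_kan_lift[OF S] iso_lift.is_right_kan_lift by blast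
    show "\<exists>!L. mfun L = K \<and> is_monad_lift A B G S L \<kappa>"
      if lift: "right_kan_lift A A B G (cfcomp A (mfun S) G) K \<kappa>" for K \<kappa>
      using right_kan_lift_iso_lift[OF S lift] iso_lift.ex1_monad_lift lift by blast
  next
    fix P \<epsilon> L \<kappa> assume P: "pushforward_choice A B G P \<epsilon>" and L: "monad_lift_choice A B G L \<kappa>"
    have pushforward: "pushforward A B G T (P T) (\<epsilon> T)" if "monad A T" for T
    proof -
      have "is_pushforward A B G T (P T) (\<epsilon> T)"
        using P that by (simp add: pushforward_choice_def)
      then show ?thesis
        using ext_locale[OF that]
        by (simp add: pushforward_def pushforward_axioms_def is_pushforward_def)
    qed
    \<comment> \<open>The inverses of the counits are not part of the chosen data; they are selected
      here, one family for each monad.\<close>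
    have "\<forall>T. \<exists>d. monad A T \<longrightarrow> iso_colax_map A B G (P T) T d (\<epsilon> T)"
      using pushforward_iso_colax_map[OF pushforward] by blast
    then obtain d where d: "\<And>T. monad A T \<Longrightarrow> iso_colax_map A B G (P T) T (d T) (\<epsilon> T)"
      by metis
    have "\<forall>S. \<exists>l. monad B S \<and> restricts A B G S \<longrightarrow> iso_colax_map A B G S (L S) (\<kappa> S) l"
      using is_monad_lift_iso_colax_map L by (auto simp: monad_lift_choice_def)
    then obtain l where l: "\<And>S. monad B S \<Longrightarrow> restricts A B G S \<Longrightarrow> iso_colax_map A B G S (L S) (\<kappa> S)
        (l S)"
      by metis
    have adj: "monad_adjunction A B G P \<epsilon> d L \<kappa> l"
      by (intro monad_adjunction.intro monad_adjunction_axioms.intro ff_functor_axioms pushforward d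
          l)
    show "cfunctor (Mnd A) (Mnd_res A B G) (pushforward_functor A B G P \<epsilon>)"
      by (rule monad_adjunction.cfunctor_PF[OF adj])
    show "cfunctor (Mnd_res A B G) (Mnd A) (monad_lift_functor A B G L \<kappa>)"
      by (rule monad_adjunction.cfunctor_LF[OF adj])
    show "adjunction (Mnd_res A B G) (Mnd A) (monad_lift_functor A B G L \<kappa>)
        (pushforward_functor A B G P \<epsilon>)"
      by (rule monad_adjunction.adjunction[OF adj])
    show "full_functor (Mnd A) (Mnd_res A B G) (pushforward_functor A B G P \<epsilon>)"
      by (rule monad_adjunction.full_PF[OF adj])
    show "faithful_functor (Mnd A) (pushforward_functor A B G P \<epsilon>)"
      by (rule monad_adjunction.faithful_PF[OF adj])
  }
qed

end
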